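(* Let $k\ge 0$ be a fixed real number and let $A$ be the self-adjoint (Friedrichs) Legendre operator in $L^2(-1,1)$ (defined in the context). Then for every $n\in\mathbb{N}$, $$\mathcal{D}(A^n)=\{f:(-1,1)\to\mathbb{C}\mid f\in AC_{\mathrm{loc}}^{(2n-1)}(-1,1);\ (1-x^2)^n f^{(2n)}\in L^2(-1,1)\}.$$
   Context: $\mathbb{N}$ denotes the positive integers. $L^2(-1,1)$ is the space of complex-valued Lebesgue square-integrable functions on $(-1,1)$. $AC_{\mathrm{loc}}(-1,1)$ is the set of functions $f:(-1,1)\to\mathbb{C}$ that are absolutely continuous on every compact subinterval of $(-1,1)$; for an integer $m\ge 0$, $AC_{\mathrm{loc}}^{(m)}(-1,1)$ is the set of $f:(-1,1)\to\mathbb{C}$ such that $f,f',\ldots,f^{(m)}$ all belong to $AC_{\mathrm{loc}}(-1,1)$ (so $f^{(m+1)}$ exists a.e.). For fixed $k\ge0$, the Legendre expression is $\ell[y](t)=-\big((1-t^2)y'(t)\big)'+ky(t)$ for $t\in(-1,1)$. The Legendre operator $A$ in $L^2(-1,1)$ is defined by $Af=\ell[f]$ with domain $$\mathcal{D}(A)=\{f:(-1,1)\to\mathbb{C}\mid f,f'\in AC_{\mathrm{loc}}(-1,1);\ f,\ell[f]\in L^2(-1,1);\ \lim_{t\to\pm1}(1-t^2)f'(t)=0\}.$$ It is self-adjoint (it is the Friedrichs extension of the minimal operator generated by $\ell$), and it has the Legendre polynomials as a complete sequence of eigenfunctions, with eigenvalues $m(m+1)+k$, $m=0,1,2,\ldots$.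 $A^n$ is the usual $n$-fold composition: $\mathcal{D}(A^1)=\mathcal{D}(A)$ and $\mathcal{D}(A^{n})=\{f\in\mathcal{D}(A^{n-1})\mid A^{n-1}f\in\mathcal{D}(A)\}$ for $n\ge2$. *)

theory Defs
  imports "HOL-Analysis.Analysis"
begin

(* A function (-1,1) \<rightarrow> \<complex> is represented by a total function real \<Rightarrow> complex. Every notion
   below depends only on its values in the open interval (-1,1), so the values elsewhere
   are irrelevant, and an equality of sets of total functions says the same as the equality
   of the sets of restrictions. *)

definition abs_cont_on :: "real set \<Rightarrow> (real \<Rightarrow> complex) \<Rightarrow> bool" where
  "abs_cont_on S f \<longleftrightarrow>
     (\<forall>\<epsilon>>0. \<exists>\<delta>>0. \<forall>\<D>. \<D> division_of \<Union>\<D> \<and> \<Union>\<D> \<subseteq> S \<and> (\<Sum>K\<in>\<D>. Sup K - Inf K) < \<delta> \<longrightarrow>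
        (\<Sum>K\<in>\<D>. norm (f (Sup K) - f (Inf K))) < \<epsilon>)"

definition AC_loc :: "(real \<Rightarrow> complex) set" where
  "AC_loc = {f. \<forall>a b. -1 < a \<and> a \<le> b \<and> b < 1 \<longrightarrow> abs_cont_on {a..b} f}"

definition nth_vderiv :: "nat \<Rightarrow> (real \<Rightarrow> complex) \<Rightarrow> real \<Rightarrow> complex" where
  "nth_vderiv j = (\<lambda>f t. vector_derivative f (at t)) ^^ j"

(* vector_derivative is total, with an unspecified value where no derivative exists; hence
   the explicit demand that the derivatives of order 1, ..., m exist everywhere in (-1,1). *)
definition AC_loc_order :: "nat \<Rightarrow> (real \<Rightarrow> complex) set" where
  "AC_loc_order m =
     {f. (\<forall>j<m. \<forall>t\<in>{-1<..<1}. nth_vderiv j f differentiable (at t)) \<and>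
         (\<forall>j\<le>m. nth_vderiv j f \<in> AC_loc)}"

definition L2 :: "(real \<Rightarrow> complex) set" where
  "L2 = {f. f \<in> borel_measurable (lebesgue_on {-1<..<1}) \<and>
            integrable (lebesgue_on {-1<..<1}) (\<lambda>t. (norm (f t))\<^sup>2)}"

(* If f and f' are locally absolutely continuous then this is the Legendre expression almost
   everywhere; on the remaining null set its value is unspecified and never matters. *)
definition legendre_expr :: "real \<Rightarrow> (real \<Rightarrow> complex) \<Rightarrow> real \<Rightarrow> complex" where
  "legendre_expr k f t =
     - vector_derivative (\<lambda>s. of_real (1 - s\<^sup>2) * vector_derivative f (at s)) (at t)
     + of_real k * f t"

definition legendre_dom :: "real \<Rightarrow> (real \<Rightarrow> complex) set" where
  "legendre_dom k =
     {f. f \<in> AC_loc_order 1 \<and> f \<in> L2 \<and> legendre_expr k f \<in> L2 \<and>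
         ((\<lambda>t. of_real (1 - t\<^sup>2) * vector_derivative f (at t)) \<longlongrightarrow> 0) (at_left 1) \<and>
         ((\<lambda>t. of_real (1 - t\<^sup>2) * vector_derivative f (at t)) \<longlongrightarrow> 0) (at_right (-1))}"

(* The operator as a relation on functions. Its values are elements of the Hilbert space,
   i.e. functions modulo equality almost everywhere, so f is related to every
   representative of the class of its image. Composition of operators is then relational
   composition: an image lies in the domain iff one of its representatives does. *)
definition legendre_op :: "real \<Rightarrow> ((real \<Rightarrow> complex) \<times> (real \<Rightarrow> complex)) set" where
  "legendre_op k =
     {(f, g). f \<in> legendre_dom k \<and> (AE t in lebesgue_on {-1<..<1}. g t = legendre_expr k f t)}"

lemma Domain_legendre_op: "Domain (legendre_op k) = legendre_dom k"
  by (auto simp: legendre_op_def)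

lemma Domain_legendre_op_pow_1: "Domain (legendre_op k ^^ 1) = legendre_dom k"
  by (simp add: Domain_legendre_op)

lemma Domain_legendre_op_pow_Suc:
  "Domain (legendre_op k ^^ Suc n) =
     {f \<in> Domain (legendre_op k ^^ n). \<exists>h. (f, h) \<in> legendre_op k ^^ n \<and> h \<in> legendre_dom k}"
  by (auto simp: Domain_legendre_op[symmetric])


end

theory Submission
  imports Defs
begin

text \<open>
  Write \<open>p = 1 - t\<^sup>2\<close> and let \<open>E\<^sub>n\<close> (\<open>power_dom n\<close>) be the set on the right-hand side. Since
  \<open>A\<^sup>n\<^sup>+\<^sup>1\<close> means \<open>A\<close> followed by \<open>A\<^sup>n\<close>, induction on \<open>n\<close> reduces the theorem to two claims:
  \<open>D(A) = E\<^sub>1\<close> (\<open>legendre_dom_eq\<close>), and \<open>f \<in> E\<^sub>n\<^sub>+\<^sub>1\<close> iff \<open>f \<in> D(A)\<close> and \<open>A f \<in> E\<^sub>n\<close>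
  (\<open>power_dom_SucI\<close>, \<open>power_dom_SucD\<close>).

  Two weighted inequalities of Hardy type carry the analysis. If \<open>p\<^sup>a\<^sup>+\<^sup>1 g'\<close> is square integrable,
  so is \<open>p\<^sup>a g\<close> (\<open>hardy_interior\<close>). If \<open>W' = p\<^sup>m g\<close> with \<open>g\<close> square integrable, and \<open>W\<close> takes
  arbitrarily small values near both end points, then \<open>W / p\<^sup>m\<^sup>+\<^sup>1\<close> is square integrable
  (\<open>hardy_boundary\<close>). Both come from integrating the derivative of \<open>\<phi> |g|\<^sup>2\<close> for an odd weight
  \<open>\<phi>\<close> over \<open>[-b, b]\<close> and letting \<open>b\<close> tend to 1.

  If \<open>h = A f\<close>, the function \<open>f\<close> gains two derivatives over \<open>h\<close> (\<open>legendre_regularity\<close>), and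
  differentiating the equation \<open>m\<close> times gives
    \<open>p f\<^sup>(\<^sup>m\<^sup>+\<^sup>2\<^sup>) = 2 (m + 1) t f\<^sup>(\<^sup>m\<^sup>+\<^sup>1\<^sup>) + (m (m + 1) + k) f\<^sup>(\<^sup>m\<^sup>) - h\<^sup>(\<^sup>m\<^sup>)\<close>,
  or equivalently \<open>(p\<^sup>m\<^sup>+\<^sup>1 f\<^sup>(\<^sup>m\<^sup>+\<^sup>1\<^sup>))' = p\<^sup>m ((m (m + 1) + k) f\<^sup>(\<^sup>m\<^sup>) - h\<^sup>(\<^sup>m\<^sup>))\<close>.
  For \<open>h \<in> E\<^sub>n\<close> the first inequality puts \<open>p\<^sup>j h\<^sup>(\<^sup>m\<^sup>)\<close>, \<open>j = max 0 (m - n)\<close>, in \<open>L\<^sup>2\<close> for all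
  \<open>m \<le> 2 n\<close>. For \<open>m \<le> n\<close> the second inequality then carries \<open>f\<^sup>(\<^sup>m\<^sup>) \<in> L\<^sup>2\<close> to \<open>f\<^sup>(\<^sup>m\<^sup>+\<^sup>1\<^sup>) \<in> L\<^sup>2\<close>,
  and beyond \<open>n\<close> the equation itself bounds each further derivative, up to
  \<open>p\<^sup>n\<^sup>+\<^sup>1 f\<^sup>(\<^sup>2\<^sup>n\<^sup>+\<^sup>2\<^sup>) \<in> L\<^sup>2\<close>. The smallness near the end points is the boundary condition in \<open>D(A)\<close> at \<open>m = 0\<close>;
  later on, \<open>p\<^sup>m\<^sup>+\<^sup>1 f\<^sup>(\<^sup>m\<^sup>+\<^sup>1\<^sup>)\<close> is \<open>p\<close> times an \<open>L\<^sup>2\<close> function, which cannot stay away from zero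
  because \<open>1 / p\<close> is not square integrable at the end points (\<open>L2_weighted_frequently_small\<close>).
  The converse inclusion is the same equation read as a formula for \<open>h\<^sup>(\<^sup>2\<^sup>n\<^sup>)\<close>.

  All this rests on the fundamental theorem of calculus for absolutely continuous functions
  (\<open>abs_cont_on_FTC\<close>): such a function is differentiable almost everywhere and is the integral of
  its derivative. It is proved by splitting the real and imaginary parts into differences of monotone
  absolutely continuous functions, taking the Radon-Nikodym density of their Stieltjes measures, and
  applying Lebesgue's differentiation theorem to that density.
\<close>

section \<open>Nonoverlapping families of intervals\<close>

text \<open>Indexed families replace divisions because cutting and clipping may make intervals coincide or
  degenerate; a family tolerates both, a set of intervals does not.\<close>

definition nonoverlapping :: "'i set \<Rightarrow> ('i \<Rightarrow> real) \<Rightarrow> ('i \<Rightarrow> real) \<Rightarrow> bool" where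
  "nonoverlapping I c d \<longleftrightarrow>
     finite I \<and> (\<forall>i\<in>I. c i \<le> d i) \<and> disjoint_family_on (\<lambda>i. {c i<..<d i}) I"

lemma nonoverlappingD:
  assumes "nonoverlapping I c d"
  shows "finite I" "\<And>i. i \<in> I \<Longrightarrow> c i \<le> d i"
    "\<And>i j. \<lbrakk>i \<in> I; j \<in> I; i \<noteq> j\<rbrakk> \<Longrightarrow> {c i<..<d i} \<inter> {c j<..<d j} = {}"
  using assms unfolding nonoverlapping_def disjoint_family_on_def by auto

text \<open>Two nondegenerate intervals of a nonoverlapping family are ordered, and a monotone map keeps that
  order. This covers clamping to an interval and clipping at a point.\<close>

lemma nonoverlapping_mono_image:
  fixes \<kappa> :: "real \<Rightarrow> real"
  assumes n: "nonoverlapping I c d" and \<kappa>: "mono \<kappa>"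
  shows "nonoverlapping I (\<lambda>i. \<kappa> (c i)) (\<lambda>i. \<kappa> (d i))"
proof -
  have ordered: "d i \<le> c j \<or> d j \<le> c i \<or> c i = d i \<or> c j = d j" if "i \<in> I" "j \<in> I" "i \<noteq> j" for i j
  proof (rule ccontr)
    assume "\<not> ?thesis"
    then have *: "c j < d i" "c i < d j" "c i \<noteq> d i" "c j \<noteq> d j" by auto
    with nonoverlappingD(2)[OF n that(1)] nonoverlappingD(2)[OF n that(2)]
    have "max (c i) (c j) < min (d i) (d j)" by auto
    then obtain z where "max (c i) (c j) < z" "z < min (d i) (d j)" using dense by blast
    with nonoverlappingD(3)[OF n that] show False by auto
  qed
  show ?thesis
    unfolding nonoverlapping_def
  proof (intro conjI ballI)
    show "finite I" using nonoverlappingD(1)[OF n] .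
    show "\<kappa> (c i) \<le> \<kappa> (d i)" if "i \<in> I" for i
      using nonoverlappingD(2)[OF n that] \<kappa> by (simp add: monoD)
    show "disjoint_family_on (\<lambda>i. {\<kappa> (c i)<..<\<kappa> (d i)}) I"
      unfolding disjoint_family_on_def
    proof (intro ballI impI)
      fix i j assume ij: "i \<in> I" "j \<in> I" "i \<noteq> j"
      consider "\<kappa> (d i) \<le> \<kappa> (c j)" | "\<kappa> (d j) \<le> \<kappa> (c i)" | "c i = d i" | "c j = d j"
        using ordered[OF ij] monoD[OF \<kappa>] by blast
      then show "{\<kappa> (c i)<..<\<kappa> (d i)} \<inter> {\<kappa> (c j)<..<\<kappa> (d j)} = {}"
        by cases auto
    qed
  qed
qed

lemma nonoverlapping_total_length:
  assumes n: "nonoverlapping I c d" and sub: "\<And>i. i \<in> I \<Longrightarrow> a \<le> c i \<and> d i \<le> b" and ab: "a \<le> b"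
  shows "(\<Sum>i\<in>I. d i - c i) \<le> b - a"
proof -
  have "(\<Sum>i\<in>I. d i - c i) = (\<Sum>i\<in>I. measure lborel {c i<..<d i})"
    using nonoverlappingD(2)[OF n] by (intro sum.cong) auto
  also have "\<dots> = measure lborel (\<Union>i\<in>I. {c i<..<d i})"
    using n nonoverlappingD(2)[OF n] unfolding nonoverlapping_def
    by (intro measure_finite_Union[symmetric]) auto
  also have "\<dots> \<le> measure lborel {a..b}"
  proof -
    have "{a..b} \<in> fmeasurable lborel" by (rule fmeasurableI) (auto simp: ab)
    then show ?thesis
      using sub nonoverlappingD(1)[OF n] by (intro measure_mono_fmeasurable) force+
  qed
  finally show ?thesis using ab by simp
qed

text \<open>The degenerate members are dropped; the remaining ones are pairwise distinct, hence form a division.\<close>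

lemma nonoverlapping_division:
  fixes c d :: "'i \<Rightarrow> real" and f :: "real \<Rightarrow> 'b::real_normed_vector"
  assumes n: "nonoverlapping I c d"
  shows "\<exists>\<D>. \<D> division_of \<Union>\<D> \<and> \<Union>\<D> \<subseteq> (\<Union>i\<in>I. {c i..d i}) \<and>
    (\<Sum>K\<in>\<D>. Sup K - Inf K) = (\<Sum>i\<in>I. d i - c i) \<and>
    (\<Sum>K\<in>\<D>. norm (f (Sup K) - f (Inf K))) = (\<Sum>i\<in>I. norm (f (d i) - f (c i)))"
proof -
  define J where "J = {i\<in>I. c i < d i}"
  define \<D> where "\<D> = (\<lambda>i. {c i..d i}) ` J"
  have fin: "finite J" and JI: "J \<subseteq> I" using nonoverlappingD(1)[OF n] by (auto simp: J_def)
  have dis: "i = j" if "i \<in> J" "j \<in> J" "{c i<..<d i} \<inter> {c j<..<d j} \<noteq> {}" for i j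
    using nonoverlappingD(3)[OF n, of i j] that JI by blast
  have inj: "inj_on (\<lambda>i. {c i..d i}) J"
  proof (rule inj_onI)
    fix i j assume ij: "i \<in> J" "j \<in> J" "{c i..d i} = {c j..d j}"
    then have "c i = c j" "d i = d j" "c i < d i" by (auto simp: J_def Icc_eq_Icc)
    then have "{c i<..<d i} \<inter> {c j<..<d j} \<noteq> {}" by simp
    then show "i = j" using dis ij by blast
  qed
  have "\<D> division_of \<Union>\<D>"
    unfolding division_of_def
  proof (intro conjI ballI impI)
    show "finite \<D>" using fin by (simp add: \<D>_def)
    show "K \<subseteq> \<Union>\<D>" if "K \<in> \<D>" for K using that by blast
    show "K \<noteq> {}" if "K \<in> \<D>" for K using that by (force simp: \<D>_def J_def)
    show "\<exists>a b. K = cbox a b" if "K \<in> \<D>" for K using that by (auto simp: \<D>_def)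
    show "interior K1 \<inter> interior K2 = {}" if "K1 \<in> \<D>" "K2 \<in> \<D>" "K1 \<noteq> K2" for K1 K2
    proof -
      obtain i j where ij: "i \<in> J" "j \<in> J" "K1 = {c i..d i}" "K2 = {c j..d j}"
        using \<open>K1 \<in> \<D>\<close> \<open>K2 \<in> \<D>\<close> unfolding \<D>_def by blast
      then have "i \<noteq> j" using \<open>K1 \<noteq> K2\<close> by blast
      then have "{c i<..<d i} \<inter> {c j<..<d j} = {}" using dis[OF ij(1,2)] by blast
      then show ?thesis using ij by simp
    qed
  qed simp
  moreover have "\<Union>\<D> \<subseteq> (\<Union>i\<in>I. {c i..d i})" using JI by (auto simp: \<D>_def)
  moreover have S: "(\<Sum>K\<in>\<D>. g (Sup K) (Inf K)) = (\<Sum>i\<in>I. (g (d i) (c i) :: real))" if "\<And>x. g x x = 0" for g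
  proof -
    have "(\<Sum>K\<in>\<D>. g (Sup K) (Inf K)) = (\<Sum>i\<in>J. g (d i) (c i))"
      unfolding \<D>_def by (subst sum.reindex[OF inj]) (auto simp: J_def intro!: sum.cong)
    also have "\<dots> = (\<Sum>i\<in>I. g (d i) (c i))"
    proof (rule sum.mono_neutral_left)
      show "\<forall>i\<in>I - J. g (d i) (c i) = 0"
        using nonoverlappingD(2)[OF n] that by (auto simp: J_def) (metis less_le)
    qed (use nonoverlappingD(1)[OF n] JI in auto)
    finally show ?thesis .
  qed
  ultimately show ?thesis
    using S[of "\<lambda>x y. x - y"] S[of "\<lambda>x y. norm (f x - f y)"] by (intro exI[of _ \<D>]) simp
qed

section \<open>Absolutely continuous real functions and their densities\<close>

definition ac_real :: "(real \<Rightarrow> real) \<Rightarrow> bool" where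
  "ac_real \<phi> \<longleftrightarrow> (\<forall>\<epsilon>>0. \<exists>\<delta>>0. \<forall>(I::nat set) c d. nonoverlapping I c d \<and> (\<Sum>i\<in>I. d i - c i) < \<delta> \<longrightarrow>
      (\<Sum>i\<in>I. \<bar>\<phi> (d i) - \<phi> (c i)\<bar>) < \<epsilon>)"

text \<open>The definition quantifies over families indexed by \<^typ>\<open>nat\<close> only; finiteness makes the index type
  immaterial.\<close>

lemma ac_real_any_index:
  fixes I :: "'i set"
  assumes H: "\<And>(I::nat set) c d. nonoverlapping I c d \<Longrightarrow> (\<Sum>i\<in>I. d i - c i) < \<delta> \<Longrightarrow>
      (\<Sum>i\<in>I. \<bar>\<phi> (d i) - \<phi> (c i)\<bar>) < \<epsilon>"
    and n: "nonoverlapping I c d" and l: "(\<Sum>i\<in>I. d i - c i) < \<delta>"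
  shows "(\<Sum>i\<in>I. \<bar>\<phi> (d i) - \<phi> (c i)\<bar>) < \<epsilon>"
proof -
  obtain h where h: "bij_betw h {0..<card I} I"
    using ex_bij_betw_nat_finite[OF nonoverlappingD(1)[OF n]] by blast
  have "nonoverlapping {0..<card I} (c \<circ> h) (d \<circ> h)"
    unfolding nonoverlapping_def disjoint_family_on_def
  proof (intro conjI ballI impI)
    fix i j assume ij: "i \<in> {0..<card I}" "j \<in> {0..<card I}" "i \<noteq> j"
    then have "h i \<in> I" "h j \<in> I" "h i \<noteq> h j"
      using bij_betwE[OF h] inj_onD[OF bij_betw_imp_inj_on[OF h]] by blast+
    from nonoverlappingD(3)[OF n this]
    show "{(c \<circ> h) i<..<(d \<circ> h) i} \<inter> {(c \<circ> h) j<..<(d \<circ> h) j} = {}" by simp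
  qed (use nonoverlappingD(2)[OF n] bij_betwE[OF h] in \<open>simp_all del: atLeastLessThan_iff\<close>)
  from H[OF this] show ?thesis
    using l sum.reindex_bij_betw[OF h, of "\<lambda>i. d i - c i"]
      sum.reindex_bij_betw[OF h, of "\<lambda>i. \<bar>\<phi> (d i) - \<phi> (c i)\<bar>"] by simp
qed

text \<open>Composing with this retraction onto \<open>[a, b]\<close> extends a function to the whole line, so that
  monotonicity and absolute continuity can be stated globally.\<close>

definition clamp :: "real \<Rightarrow> real \<Rightarrow> real \<Rightarrow> real" where
  "clamp a b t = max a (min b t)"

lemma mono_clamp: "mono (clamp a b)"
  by (auto simp: mono_def clamp_def)

lemma ac_real_clamp:
  fixes r :: "complex \<Rightarrow> real"
  assumes f: "abs_cont_on {a..b} f" and ab: "a \<le> b" and r: "\<And>z w. \<bar>r z - r w\<bar> \<le> norm (z - w)"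
  shows "ac_real (\<lambda>t. r (f (clamp a b t)))"
  unfolding ac_real_def
proof (intro allI impI)
  fix \<epsilon> :: real assume "\<epsilon> > 0"
  then obtain \<delta> where \<delta>: "\<delta> > 0" and H: "\<And>\<D>. \<D> division_of \<Union>\<D> \<Longrightarrow> \<Union>\<D> \<subseteq> {a..b} \<Longrightarrow>
      (\<Sum>K\<in>\<D>. Sup K - Inf K) < \<delta> \<Longrightarrow> (\<Sum>K\<in>\<D>. norm (f (Sup K) - f (Inf K))) < \<epsilon>"
    using f unfolding abs_cont_on_def by meson
  show "\<exists>\<delta>>0. \<forall>(I::nat set) c d. nonoverlapping I c d \<and> (\<Sum>i\<in>I. d i - c i) < \<delta> \<longrightarrow>
      (\<Sum>i\<in>I. \<bar>r (f (clamp a b (d i))) - r (f (clamp a b (c i)))\<bar>) < \<epsilon>"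
  proof (intro exI[of _ \<delta>] conjI allI impI \<delta>, elim conjE)
    fix I :: "nat set" and c d
    assume n: "nonoverlapping I c d" and l: "(\<Sum>i\<in>I. d i - c i) < \<delta>"
    let ?c = "\<lambda>i. clamp a b (c i)" and ?d = "\<lambda>i. clamp a b (d i)"
    have n': "nonoverlapping I ?c ?d" by (rule nonoverlapping_mono_image[OF n mono_clamp])
    obtain \<D> where D: "\<D> division_of \<Union>\<D>" "\<Union>\<D> \<subseteq> (\<Union>i\<in>I. {?c i..?d i})"
      and S: "(\<Sum>K\<in>\<D>. Sup K - Inf K) = (\<Sum>i\<in>I. ?d i - ?c i)"
        "(\<Sum>K\<in>\<D>. norm (f (Sup K) - f (Inf K))) = (\<Sum>i\<in>I. norm (f (?d i) - f (?c i)))"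
      using nonoverlapping_division[OF n'] by blast
    have "\<Union>\<D> \<subseteq> {a..b}"
    proof -
      have "{?c i..?d i} \<subseteq> {a..b}" for i using ab by (auto simp: clamp_def)
      then show ?thesis using D(2) by blast
    qed
    moreover have "(\<Sum>K\<in>\<D>. Sup K - Inf K) < \<delta>"
    proof -
      have "(\<Sum>K\<in>\<D>. Sup K - Inf K) = (\<Sum>i\<in>I. ?d i - ?c i)" by (rule S(1))
      also have "\<dots> \<le> (\<Sum>i\<in>I. d i - c i)"
      proof (rule sum_mono)
        fix i assume "i \<in> I"
        then have "c i \<le> d i" using nonoverlappingD(2)[OF n] by blast
        then show "?d i - ?c i \<le> d i - c i" unfolding clamp_def by linarith
      qed
      finally show ?thesis using l by simp
    qed
    ultimately have "(\<Sum>K\<in>\<D>. norm (f (Sup K) - f (Inf K))) < \<epsilon>" by (rule H[OF D(1)])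
    moreover have "(\<Sum>K\<in>\<D>. norm (f (Sup K) - f (Inf K))) = (\<Sum>i\<in>I. norm (f (?d i) - f (?c i)))" by (rule S(2))
    moreover have "(\<Sum>i\<in>I. \<bar>r (f (?d i)) - r (f (?c i))\<bar>) \<le> (\<Sum>i\<in>I. norm (f (?d i) - f (?c i)))"
      by (intro sum_mono r)
    ultimately show "(\<Sum>i\<in>I. \<bar>r (f (?d i)) - r (f (?c i))\<bar>) < \<epsilon>" by simp
  qed
qed

text \<open>A strip of length \<open>\<delta> / 2\<close> carries variation at most 1, and \<open>[a, b]\<close> is covered by finitely many
  strips; clipping a family at the end of a strip splits its variation.\<close>

lemma ac_real_bounded_variation:
  assumes ac: "ac_real \<phi>" and const: "\<And>t. \<phi> t = \<phi> (clamp a b t)" and ab: "a \<le> b"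
  obtains B where "\<And>(I::nat set) c d. nonoverlapping I c d \<Longrightarrow> (\<Sum>i\<in>I. \<bar>\<phi> (d i) - \<phi> (c i)\<bar>) \<le> B"
proof -
  obtain \<delta> where \<delta>: "\<delta> > 0" and H: "\<And>(I::nat set) c d. nonoverlapping I c d \<Longrightarrow> (\<Sum>i\<in>I. d i - c i) < \<delta> \<Longrightarrow>
      (\<Sum>i\<in>I. \<bar>\<phi> (d i) - \<phi> (c i)\<bar>) < 1"
    using ac unfolding ac_real_def by (meson zero_less_one)
  define \<eta> where "\<eta> = \<delta> / 2"
  have \<eta>: "0 < \<eta>" "\<eta> < \<delta>" using \<delta> by (auto simp: \<eta>_def)
  have step: "(\<Sum>i\<in>I. \<bar>\<phi> (d i) - \<phi> (c i)\<bar>) \<le> real m"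
    if "nonoverlapping I c d" "\<And>i. i \<in> I \<Longrightarrow> a \<le> c i \<and> d i \<le> a + real m * \<eta>" for I :: "nat set" and c d m
    using that
  proof (induction m arbitrary: c d)
    case 0
    then have "c i = d i" if "i \<in> I" for i
      using nonoverlappingD(2)[OF 0(1) that] 0(2)[OF that] by auto
    then show ?case by simp
  next
    case (Suc m)
    let ?y = "a + real m * \<eta>"
    have split: "\<bar>\<phi> (d i) - \<phi> (c i)\<bar> \<le> \<bar>\<phi> (min ?y (d i)) - \<phi> (min ?y (c i))\<bar> + \<bar>\<phi> (max ?y (d i)) - \<phi> (max ?y (c i))\<bar>" for i
      by linarith
    have n1: "nonoverlapping I (\<lambda>i. min ?y (c i)) (\<lambda>i. min ?y (d i))"
      using Suc.prems(1) by (rule nonoverlapping_mono_image) (auto simp: mono_def)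
    have n2: "nonoverlapping I (\<lambda>i. max ?y (c i)) (\<lambda>i. max ?y (d i))"
      using Suc.prems(1) by (rule nonoverlapping_mono_image) (auto simp: mono_def)
    have "(\<Sum>i\<in>I. \<bar>\<phi> (min ?y (d i)) - \<phi> (min ?y (c i))\<bar>) \<le> real m"
    proof (rule Suc.IH[OF n1])
      fix i assume "i \<in> I"
      with Suc.prems(2)[OF this] \<eta>(1) show "a \<le> min ?y (c i) \<and> min ?y (d i) \<le> ?y" by auto
    qed
    moreover have "(\<Sum>i\<in>I. \<bar>\<phi> (max ?y (d i)) - \<phi> (max ?y (c i))\<bar>) < 1"
    proof (rule H[OF n2])
      have "(\<Sum>i\<in>I. max ?y (d i) - max ?y (c i)) \<le> a + real (Suc m) * \<eta> - ?y"
      proof (rule nonoverlapping_total_length[OF n2])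
        fix i assume "i \<in> I"
        with Suc.prems(2)[OF this] \<eta>(1) show "?y \<le> max ?y (c i) \<and> max ?y (d i) \<le> a + real (Suc m) * \<eta>"
          by (auto simp: algebra_simps)
      qed (use \<eta> in \<open>simp add: algebra_simps\<close>)
      also have "\<dots> = \<eta>" by (simp add: algebra_simps)
      finally show "(\<Sum>i\<in>I. max ?y (d i) - max ?y (c i)) < \<delta>" using \<eta> by simp
    qed
    moreover have "(\<Sum>i\<in>I. \<bar>\<phi> (d i) - \<phi> (c i)\<bar>) \<le>
        (\<Sum>i\<in>I. \<bar>\<phi> (min ?y (d i)) - \<phi> (min ?y (c i))\<bar> + \<bar>\<phi> (max ?y (d i)) - \<phi> (max ?y (c i))\<bar>)"
      by (intro sum_mono split)
    ultimately show ?case by (simp add: sum.distrib)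
  qed
  obtain m :: nat where m: "(b - a) / \<eta> \<le> real m" using real_arch_simple by blast
  have m': "b \<le> a + real m * \<eta>" using m \<eta>(1) by (simp add: field_simps)
  show thesis
  proof
    fix I :: "nat set" and c d assume n: "nonoverlapping I c d"
    have "(\<Sum>i\<in>I. \<bar>\<phi> (clamp a b (d i)) - \<phi> (clamp a b (c i))\<bar>) \<le> real m"
      by (rule step[OF nonoverlapping_mono_image[OF n mono_clamp]])
        (use m' ab in \<open>auto simp: clamp_def\<close>)
    then show "(\<Sum>i\<in>I. \<bar>\<phi> (d i) - \<phi> (c i)\<bar>) \<le> real m" using const by simp
  qed
qed

text \<open>Jordan decomposition: \<open>P x\<close> is the supremum of the signed increments of \<open>\<phi>\<close> over families to the
  left of \<open>x\<close>. Adding the interval \<open>[x, y]\<close> to a family shows that \<open>P - \<phi>\<close> increases. For absolute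
  continuity of \<open>P\<close>, each increment of \<open>P\<close> is nearly attained by a family inside the same interval,
  and these families together are again nonoverlapping and no longer than the original one.\<close>

lemma positive_variation:
  assumes ac: "ac_real \<phi>" and const: "\<And>t. \<phi> t = \<phi> (clamp a b t)" and ab: "a \<le> b"
  obtains P where "mono P" "mono (\<lambda>t. P t - \<phi> t)" "ac_real P"
proof -
  obtain B where B: "\<And>(I::nat set) c d. nonoverlapping I c d \<Longrightarrow> (\<Sum>i\<in>I. \<bar>\<phi> (d i) - \<phi> (c i)\<bar>) \<le> B"
    using ac_real_bounded_variation[OF ac const ab] by blast
  define V where "V x = {\<Sum>i\<in>I. \<phi> (d i) - \<phi> (c i) | (I::nat set) c d. nonoverlapping I c d \<and> (\<forall>i\<in>I. d i \<le> x)}" for x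
  define P where "P x = Sup (V x)" for x
  have ne: "V x \<noteq> {}" for x
  proof -
    have "nonoverlapping ({}::nat set) (\<lambda>_. 0) (\<lambda>_. 0)"
      by (simp add: nonoverlapping_def disjoint_family_on_def)
    then show ?thesis unfolding V_def by blast
  qed
  have bdd: "bdd_above (V x)" for x
  proof (rule bdd_aboveI[of _ B])
    fix s assume "s \<in> V x"
    then obtain I :: "nat set" and c d where n: "nonoverlapping I c d" and s: "s = (\<Sum>i\<in>I. \<phi> (d i) - \<phi> (c i))"
      unfolding V_def by blast
    have "s \<le> (\<Sum>i\<in>I. \<bar>\<phi> (d i) - \<phi> (c i)\<bar>)" unfolding s by (intro sum_mono) simp
    also have "\<dots> \<le> B" by (rule B[OF n])
    finally show "s \<le> B" .
  qed
  have upper: "(\<Sum>i\<in>I. \<phi> (d i) - \<phi> (c i)) \<le> P x"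
    if "nonoverlapping I c d" "\<And>i. i \<in> I \<Longrightarrow> d i \<le> x" for I :: "nat set" and c d x
    unfolding P_def using that by (intro cSup_upper bdd) (auto simp: V_def)
  have monoP: "mono P"
    unfolding mono_def P_def
  proof (intro allI impI cSup_subset_mono bdd ne)
    fix x y :: real assume "x \<le> y"
    then show "V x \<subseteq> V y" unfolding V_def by (smt (verit) Collect_mono order_trans)
  qed
  have monoN: "mono (\<lambda>t. P t - \<phi> t)"
    unfolding mono_def
  proof (intro allI impI)
    fix x y :: real assume xy: "x \<le> y"
    have "P x \<le> P y - (\<phi> y - \<phi> x)"
      unfolding P_def[of x]
    proof (rule cSup_least[OF ne])
      fix s assume "s \<in> V x"
      then obtain I :: "nat set" and c d where n: "nonoverlapping I c d"
        and le: "\<And>i. i \<in> I \<Longrightarrow> d i \<le> x" and s: "s = (\<Sum>i\<in>I. \<phi> (d i) - \<phi> (c i))"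
        unfolding V_def by blast
      obtain j where j: "j \<notin> I" using nonoverlappingD(1)[OF n] by (metis ex_new_if_finite infinite_UNIV_nat)
      have "nonoverlapping (insert j I) (c(j := x)) (d(j := y))"
        unfolding nonoverlapping_def disjoint_family_on_def
      proof (intro conjI ballI impI)
        show "finite (insert j I)" using nonoverlappingD(1)[OF n] by simp
        show "(c(j := x)) i \<le> (d(j := y)) i" if "i \<in> insert j I" for i
          using that nonoverlappingD(2)[OF n, of i] xy by auto
        fix i k assume ik: "i \<in> insert j I" "k \<in> insert j I" "i \<noteq> k"
        then consider "i \<in> I" "k \<in> I" "i \<noteq> j" "k \<noteq> j" | "i = j" "k \<in> I" "k \<noteq> j" | "k = j" "i \<in> I" "i \<noteq> j"
          using j by blast
        then show "{(c(j := x)) i<..<(d(j := y)) i} \<inter> {(c(j := x)) k<..<(d(j := y)) k} = {}"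
        proof cases
          case 1
          then show ?thesis using nonoverlappingD(3)[OF n 1(1,2) ik(3)] by simp
        next
          case 2
          then show ?thesis using le[OF 2(2)] by auto
        next
          case 3
          then show ?thesis using le[OF 3(2)] by auto
        qed
      qed
      then have "(\<Sum>i\<in>insert j I. \<phi> ((d(j := y)) i) - \<phi> ((c(j := x)) i)) \<le> P y"
        by (rule upper) (use le xy in \<open>auto intro: order_trans\<close>)
      moreover have "(\<Sum>i\<in>insert j I. \<phi> ((d(j := y)) i) - \<phi> ((c(j := x)) i)) = (\<phi> y - \<phi> x) + s"
      proof -
        have "(\<Sum>i\<in>I. \<phi> ((d(j := y)) i) - \<phi> ((c(j := x)) i)) = s"
          unfolding s using j by (intro sum.cong) auto
        then show ?thesis using j nonoverlappingD(1)[OF n] by simp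
      qed
      ultimately show "s \<le> P y - (\<phi> y - \<phi> x)" by simp
    qed
    then show "P x - \<phi> x \<le> P y - \<phi> y" by simp
  qed
  have approx: "\<exists>(J::nat set) u v. nonoverlapping J u v \<and> (\<forall>j\<in>J. x \<le> u j \<and> v j \<le> y) \<and>
      P y - P x \<le> (\<Sum>j\<in>J. \<phi> (v j) - \<phi> (u j)) + \<eta>"
    if "x \<le> y" "\<eta> > 0" for x y \<eta>
  proof -
    have "P y - \<eta> < P y" using that by simp
    then obtain s where sV: "s \<in> V y" and s2: "P y - \<eta> < s"
      unfolding P_def[of y] less_cSup_iff[OF ne bdd] by blast
    then obtain I :: "nat set" and c d where n: "nonoverlapping I c d"
      and le: "\<And>i. i \<in> I \<Longrightarrow> d i \<le> y" and s: "s = (\<Sum>i\<in>I. \<phi> (d i) - \<phi> (c i))"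
      unfolding V_def by blast
    have n1: "nonoverlapping I (\<lambda>i. min x (c i)) (\<lambda>i. min x (d i))"
      using n by (rule nonoverlapping_mono_image) (auto simp: mono_def)
    have n2: "nonoverlapping I (\<lambda>i. max x (c i)) (\<lambda>i. max x (d i))"
      using n by (rule nonoverlapping_mono_image) (auto simp: mono_def)
    have "\<phi> (d i) - \<phi> (c i) = (\<phi> (min x (d i)) - \<phi> (min x (c i))) + (\<phi> (max x (d i)) - \<phi> (max x (c i)))" for i
      by (auto simp: min_def max_def)
    then have "s = (\<Sum>i\<in>I. \<phi> (min x (d i)) - \<phi> (min x (c i))) + (\<Sum>i\<in>I. \<phi> (max x (d i)) - \<phi> (max x (c i)))"
      unfolding s by (simp add: sum.distrib)
    also have "(\<Sum>i\<in>I. \<phi> (min x (d i)) - \<phi> (min x (c i))) \<le> P x"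
      by (rule upper[OF n1]) simp
    finally have "P y - P x \<le> (\<Sum>i\<in>I. \<phi> (max x (d i)) - \<phi> (max x (c i))) + \<eta>"
      using s2 by simp
    moreover have "\<forall>i\<in>I. x \<le> max x (c i) \<and> max x (d i) \<le> y" using le that by auto
    ultimately show ?thesis using n2 by blast
  qed
  have "ac_real P"
    unfolding ac_real_def
  proof (intro allI impI)
    fix \<epsilon> :: real assume e: "\<epsilon> > 0"
    then obtain \<delta> where \<delta>: "\<delta> > 0" and H: "\<And>(I::nat set) c d. nonoverlapping I c d \<Longrightarrow> (\<Sum>i\<in>I. d i - c i) < \<delta> \<Longrightarrow>
      (\<Sum>i\<in>I. \<bar>\<phi> (d i) - \<phi> (c i)\<bar>) < \<epsilon>/2"
      using ac unfolding ac_real_def by (meson half_gt_zero)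
    show "\<exists>\<delta>>0. \<forall>(I::nat set) c d. nonoverlapping I c d \<and> (\<Sum>i\<in>I. d i - c i) < \<delta> \<longrightarrow>
      (\<Sum>i\<in>I. \<bar>P (d i) - P (c i)\<bar>) < \<epsilon>"
    proof (intro exI[of _ \<delta>] conjI allI impI \<delta>, elim conjE)
      fix I :: "nat set" and c d
      assume n: "nonoverlapping I c d" and l: "(\<Sum>i\<in>I. d i - c i) < \<delta>"
      define \<eta> where "\<eta> = \<epsilon> / (2 * (real (card I) + 1))"
      have \<eta>: "\<eta> > 0" using e by (simp add: \<eta>_def)
      have "\<forall>i\<in>I. \<exists>(J::nat set) u v. nonoverlapping J u v \<and> (\<forall>j\<in>J. c i \<le> u j \<and> v j \<le> d i) \<and>
          P (d i) - P (c i) \<le> (\<Sum>j\<in>J. \<phi> (v j) - \<phi> (u j)) + \<eta>"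
        using approx[OF nonoverlappingD(2)[OF n] \<eta>] by blast
      then obtain J :: "nat \<Rightarrow> nat set" and u v :: "nat \<Rightarrow> nat \<Rightarrow> real" where
        Juv: "\<forall>i\<in>I. nonoverlapping (J i) (u i) (v i) \<and> (\<forall>j\<in>J i. c i \<le> u i j \<and> v i j \<le> d i) \<and>
          P (d i) - P (c i) \<le> (\<Sum>j\<in>J i. \<phi> (v i j) - \<phi> (u i j)) + \<eta>"
        unfolding bchoice_iff by blast
      have J: "\<And>i. i \<in> I \<Longrightarrow> nonoverlapping (J i) (u i) (v i)"
        and uv: "\<And>i j. i \<in> I \<Longrightarrow> j \<in> J i \<Longrightarrow> c i \<le> u i j \<and> v i j \<le> d i"
        and Pd: "\<And>i. i \<in> I \<Longrightarrow> P (d i) - P (c i) \<le> (\<Sum>j\<in>J i. \<phi> (v i j) - \<phi> (u i j)) + \<eta>"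
        using Juv by blast+
      let ?S = "Sigma I J"
      let ?u = "\<lambda>p. u (fst p) (snd p)" and ?v = "\<lambda>p. v (fst p) (snd p)"
      have finI: "finite I" and finJ: "\<forall>i\<in>I. finite (J i)"
        using nonoverlappingD(1)[OF n] nonoverlappingD(1)[OF J] by auto
      have nS: "nonoverlapping ?S ?u ?v"
        unfolding nonoverlapping_def disjoint_family_on_def
      proof (intro conjI ballI impI)
        show "finite ?S" using finI finJ by blast
        show "?u p \<le> ?v p" if "p \<in> ?S" for p
          using that nonoverlappingD(2)[OF J] by auto
        fix p q assume pq: "p \<in> ?S" "q \<in> ?S" "p \<noteq> q"
        obtain i j i' j' where p: "p = (i, j)" and q: "q = (i', j')" by (metis surj_pair)
        have m: "i \<in> I" "j \<in> J i" "i' \<in> I" "j' \<in> J i'" using pq p q by auto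
        show "{?u p<..<?v p} \<inter> {?u q<..<?v q} = {}"
        proof (cases "i = i'")
          case True
          then have "j \<noteq> j'" using pq p q by auto
          then have "{u i j<..<v i j} \<inter> {u i j'<..<v i j'} = {}"
            using nonoverlappingD(3)[OF J[OF m(1)] m(2)] m(4) True by blast
          then show ?thesis using True p q by simp
        next
          case False
          have "{u i j<..<v i j} \<subseteq> {c i<..<d i}" "{u i' j'<..<v i' j'} \<subseteq> {c i'<..<d i'}"
            using uv[OF m(1,2)] uv[OF m(3,4)] by auto
          moreover have "{c i<..<d i} \<inter> {c i'<..<d i'} = {}"
            by (rule nonoverlappingD(3)[OF n m(1,3) False])
          ultimately show ?thesis unfolding p q fst_conv snd_conv by blast
        qed
      qed
      have "(\<Sum>p\<in>?S. ?v p - ?u p) = (\<Sum>i\<in>I. \<Sum>j\<in>J i. v i j - u i j)"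
        using sum.Sigma[OF finI finJ, of "\<lambda>i j. v i j - u i j"] by (simp add: case_prod_beta)
      also have "\<dots> \<le> (\<Sum>i\<in>I. d i - c i)"
      proof (rule sum_mono)
          fix i assume i: "i \<in> I"
          show "(\<Sum>j\<in>J i. v i j - u i j) \<le> d i - c i"
            by (rule nonoverlapping_total_length[OF J[OF i] uv[OF i] nonoverlappingD(2)[OF n i]])
        qed
      finally have "(\<Sum>p\<in>?S. ?v p - ?u p) < \<delta>" using l by simp
      then have small: "(\<Sum>p\<in>?S. \<bar>\<phi> (?v p) - \<phi> (?u p)\<bar>) < \<epsilon>/2"
        using ac_real_any_index[of \<delta> \<phi> "\<epsilon>/2" ?S ?u ?v] H nS by blast
      have "(\<Sum>i\<in>I. \<bar>P (d i) - P (c i)\<bar>) \<le> (\<Sum>i\<in>I. (\<Sum>j\<in>J i. \<phi> (v i j) - \<phi> (u i j)) + \<eta>)"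
      proof (rule sum_mono)
        fix i assume "i \<in> I"
        moreover from this have "P (c i) \<le> P (d i)"
          using monoP nonoverlappingD(2)[OF n] by (simp add: monoD)
        ultimately show "\<bar>P (d i) - P (c i)\<bar> \<le> (\<Sum>j\<in>J i. \<phi> (v i j) - \<phi> (u i j)) + \<eta>"
          using Pd by simp
      qed
      also have "\<dots> = (\<Sum>p\<in>?S. \<phi> (?v p) - \<phi> (?u p)) + real (card I) * \<eta>"
        using sum.Sigma[OF finI finJ, of "\<lambda>i j. \<phi> (v i j) - \<phi> (u i j)"]
        by (simp add: case_prod_beta sum.distrib)
      also have "(\<Sum>p\<in>?S. \<phi> (?v p) - \<phi> (?u p)) \<le> (\<Sum>p\<in>?S. \<bar>\<phi> (?v p) - \<phi> (?u p)\<bar>)"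
        by (intro sum_mono) simp
      also have "real (card I) * \<eta> \<le> \<epsilon>/2"
        using e by (simp add: \<eta>_def field_simps)
      finally show "(\<Sum>i\<in>I. \<bar>P (d i) - P (c i)\<bar>) < \<epsilon>" using small by simp
    qed
  qed
  with monoP monoN show thesis by (rule that)
qed

lemma ac_real_diff:
  assumes "ac_real f" "ac_real g"
  shows "ac_real (\<lambda>t. f t - g t)"
  unfolding ac_real_def
proof (intro allI impI)
  fix \<epsilon> :: real assume e: "\<epsilon> > 0"
  obtain \<delta>1 where \<delta>1: "\<delta>1 > 0" and H1: "\<And>(I::nat set) c d. nonoverlapping I c d \<Longrightarrow> (\<Sum>i\<in>I. d i - c i) < \<delta>1 \<Longrightarrow>
      (\<Sum>i\<in>I. \<bar>f (d i) - f (c i)\<bar>) < \<epsilon>/2"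
    using assms(1) e unfolding ac_real_def by (meson half_gt_zero)
  obtain \<delta>2 where \<delta>2: "\<delta>2 > 0" and H2: "\<And>(I::nat set) c d. nonoverlapping I c d \<Longrightarrow> (\<Sum>i\<in>I. d i - c i) < \<delta>2 \<Longrightarrow>
      (\<Sum>i\<in>I. \<bar>g (d i) - g (c i)\<bar>) < \<epsilon>/2"
    using assms(2) e unfolding ac_real_def by (meson half_gt_zero)
  show "\<exists>\<delta>>0. \<forall>(I::nat set) c d. nonoverlapping I c d \<and> (\<Sum>i\<in>I. d i - c i) < \<delta> \<longrightarrow>
      (\<Sum>i\<in>I. \<bar>(f (d i) - g (d i)) - (f (c i) - g (c i))\<bar>) < \<epsilon>"
  proof (intro exI[of _ "min \<delta>1 \<delta>2"] conjI allI impI, use \<delta>1 \<delta>2 in simp, elim conjE)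
    fix I :: "nat set" and c d
    assume n: "nonoverlapping I c d" and l: "(\<Sum>i\<in>I. d i - c i) < min \<delta>1 \<delta>2"
    have "(\<Sum>i\<in>I. \<bar>(f (d i) - g (d i)) - (f (c i) - g (c i))\<bar>) \<le>
        (\<Sum>i\<in>I. \<bar>f (d i) - f (c i)\<bar> + \<bar>g (d i) - g (c i)\<bar>)"
      by (intro sum_mono) linarith
    then show "(\<Sum>i\<in>I. \<bar>(f (d i) - g (d i)) - (f (c i) - g (c i))\<bar>) < \<epsilon>"
      using H1[OF n] H2[OF n] l by (simp add: sum.distrib)
  qed
qed

lemma ac_real_continuous:
  assumes "ac_real f" shows "continuous_on UNIV f"
  unfolding continuous_on_iff
proof (intro ballI allI impI)
  fix x e :: real assume "e > 0"
  then obtain \<delta> where \<delta>: "\<delta> > 0" and H: "\<And>(I::nat set) c d. nonoverlapping I c d \<Longrightarrow> (\<Sum>i\<in>I. d i - c i) < \<delta> \<Longrightarrow>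
      (\<Sum>i\<in>I. \<bar>f (d i) - f (c i)\<bar>) < e"
    using assms unfolding ac_real_def by meson
  have "\<bar>f y - f x\<bar> < e" if "\<bar>y - x\<bar> < \<delta>" for y
  proof (cases x y rule: linorder_le_cases)
    case le
    then show ?thesis using H[of "{0}" "\<lambda>_. x" "\<lambda>_. y"] that
      by (simp add: nonoverlapping_def disjoint_family_on_def)
  next
    case ge
    then show ?thesis using H[of "{0}" "\<lambda>_. y" "\<lambda>_. x"] that
      by (simp add: nonoverlapping_def disjoint_family_on_def abs_minus_commute)
  qed
  then show "\<exists>d>0. \<forall>x'\<in>UNIV. dist x' x < d \<longrightarrow> dist (f x') (f x) < e"
    using \<delta> by (auto simp: dist_real_def)
qed

text \<open>A bounded null set is covered by countably many nonoverlapping intervals of small total length;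
  every finite part of the cover has small Stieltjes measure by absolute continuity.\<close>

lemma ac_mono_null:
  assumes ac: "ac_real F" and mono: "mono F" and N: "N \<in> null_sets lborel"
  shows "N \<in> null_sets (interval_measure F)"
proof -
  let ?M = "interval_measure F"
  have cont: "continuous_on UNIV F" by (rule ac_real_continuous[OF ac])
  have [measurable]: "N \<in> sets borel" using N by (auto simp: null_sets_def)
  have Icc: "emeasure ?M {x..y} = ennreal (F y - F x)" if "x \<le> y" for x y
    using emeasure_interval_measure_Icc[OF that _ cont] mono by (simp add: monoD)
  have bounded: "emeasure ?M (N \<inter> {-real n..real n}) \<le> ennreal \<epsilon>" if e: "\<epsilon> > 0" for n and \<epsilon> :: real
  proof -
    obtain \<delta> where \<delta>: "\<delta> > 0" and H: "\<And>(I::nat set) c d. nonoverlapping I c d \<Longrightarrow> (\<Sum>i\<in>I. d i - c i) < \<delta> \<Longrightarrow>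
      (\<Sum>i\<in>I. \<bar>F (d i) - F (c i)\<bar>) < \<epsilon>"
      using ac e unfolding ac_real_def by meson
    let ?S = "N \<inter> {-real n..real n}"
    have Snull: "?S \<in> null_sets lebesgue"
      using N by (intro null_sets_completionI null_set_Int2) auto
    then have meas: "?S \<in> lmeasurable" "measure lebesgue ?S = 0"
      by (auto simp: fmeasurable_def null_sets_def measure_def)
    obtain \<D> where D: "countable \<D>" "\<And>K. K \<in> \<D> \<Longrightarrow> K \<subseteq> cbox (-real n) (real n) \<and> K \<noteq> {} \<and> (\<exists>c d. K = cbox c d)"
      "pairwise (\<lambda>A B. interior A \<inter> interior B = {}) \<D>"
      "?S \<subseteq> \<Union>\<D>" "\<Union>\<D> \<in> lmeasurable" "measure lebesgue (\<Union>\<D>) \<le> measure lebesgue ?S + \<delta>/2"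
    proof (rule measurable_outer_intervals_bounded[OF meas(1), of "-real n" "real n" "\<delta>/2"])
      show "?S \<subseteq> cbox (-real n) (real n)" by auto
      show "0 < \<delta>/2" using \<delta> by simp
    qed (rule that)
    \<comment> \<open>An enumeration of the cover in which every interval occurs once, padded with empty sets.\<close>
    define A where "A i = (if i \<in> to_nat_on \<D> ` \<D> then from_nat_into \<D> i else {})" for i
    have A_in: "A i \<in> \<D>" if "A i \<noteq> {}" for i
      using that D(1) by (auto simp: A_def)
    have A_Icc: "\<exists>c d. c \<le> d \<and> A i = {c..d}" if ne: "A i \<noteq> {}" for i
    proof -
      obtain c d where "A i = cbox c d" using D(2)[OF A_in[OF ne]] by blast
      then show ?thesis using ne by auto
    qed
    have A_inj: "i = j" if "A i \<noteq> {}" "A i = A j" for i j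
    proof -
      have *: "\<exists>K\<in>\<D>. l = to_nat_on \<D> K" if "A l \<noteq> {}" for l
        using that by (cases "l \<in> to_nat_on \<D> ` \<D>") (auto simp: A_def)
      have "A j \<noteq> {}" using that by simp
      then obtain K K' where K: "K \<in> \<D>" "i = to_nat_on \<D> K" "K' \<in> \<D>" "j = to_nat_on \<D> K'"
        using *[of i] *[of j] \<open>A i \<noteq> {}\<close> by blast
      then have "A i = K" "A j = K'" using D(1) by (simp_all add: A_def)
      then show ?thesis using K that(2) by simp
    qed
    have [measurable]: "A i \<in> sets borel" for i
      using A_Icc[of i] by (cases "A i = {}") auto
    define c where "c i = Inf (A i)" for i
    define d where "d i = Sup (A i)" for i
    have A_cd: "c i \<le> d i" "A i = {c i..d i}" if ne: "A i \<noteq> {}" for i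
    proof -
      obtain u v where "u \<le> v" "A i = {u..v}" using A_Icc[OF ne] by blast
      then show "c i \<le> d i" "A i = {c i..d i}" unfolding c_def d_def by simp_all
    qed
    have Un: "(\<Union>i. A i) = \<Union>\<D>"
    proof
      show "\<Union>\<D> \<subseteq> (\<Union>i. A i)"
      proof
        fix x assume "x \<in> \<Union>\<D>"
        then obtain K where K: "K \<in> \<D>" "x \<in> K" by blast
        then have "A (to_nat_on \<D> K) = K" using D(1) by (simp add: A_def)
        then show "x \<in> (\<Union>i. A i)" using K by blast
      qed
      show "(\<Union>i. A i) \<subseteq> \<Union>\<D>" using A_in by blast
    qed
    have part: "(\<Sum>i<m. emeasure ?M (A i)) \<le> ennreal \<epsilon>" for m
    proof -
      define I where "I = {i. i < m \<and> A i \<noteq> {}}"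
      have finI: "finite I" by (simp add: I_def)
      have ne: "A i \<noteq> {}" if "i \<in> I" for i using that by (simp add: I_def)
      have n: "nonoverlapping I c d"
        unfolding nonoverlapping_def disjoint_family_on_def
      proof (intro conjI ballI impI finI)
        show "c i \<le> d i" if "i \<in> I" for i using A_cd(1)[OF ne[OF that]] .
        fix i j assume ij: "i \<in> I" "j \<in> I" "i \<noteq> j"
        have "interior (A i) \<inter> interior (A j) = {}"
          using D(3) A_in[OF ne[OF ij(1)]] A_in[OF ne[OF ij(2)]] A_inj[OF ne[OF ij(1)], of j] ij(3)
          unfolding pairwise_def by blast
        then show "{c i<..<d i} \<inter> {c j<..<d j} = {}"
          unfolding A_cd(2)[OF ne[OF ij(1)]] A_cd(2)[OF ne[OF ij(2)]] by simp
      qed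
      have "(\<Sum>i\<in>I. d i - c i) = (\<Sum>i\<in>I. measure lborel {c i<..<d i})"
        using nonoverlappingD(2)[OF n] by (intro sum.cong) auto
      also have "\<dots> = measure lborel (\<Union>i\<in>I. {c i<..<d i})"
        using n nonoverlappingD(2)[OF n] unfolding nonoverlapping_def
        by (intro measure_finite_Union[symmetric]) auto
      also have "\<dots> = measure lebesgue (\<Union>i\<in>I. {c i<..<d i})"
        using finI by (intro measure_completion[symmetric]) auto
      also have "\<dots> \<le> measure lebesgue (\<Union>\<D>)"
      proof (rule measure_mono_fmeasurable[OF _ _ D(5)])
        show "(\<Union>i\<in>I. {c i<..<d i}) \<subseteq> \<Union>\<D>"
        proof
          fix t assume "t \<in> (\<Union>i\<in>I. {c i<..<d i})"
          then obtain i where i: "i \<in> I" "t \<in> {c i<..<d i}" by blast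
          then have "t \<in> A i" unfolding A_cd(2)[OF ne[OF i(1)]] by simp
          then show "t \<in> \<Union>\<D>" using A_in[OF ne[OF i(1)]] by blast
        qed
      qed (use finI in auto)
      finally have "(\<Sum>i\<in>I. d i - c i) < \<delta>" using D(6) meas(2) \<delta> by simp
      from H[OF n this] have sm: "(\<Sum>i\<in>I. \<bar>F (d i) - F (c i)\<bar>) < \<epsilon>" .
      have "(\<Sum>i<m. emeasure ?M (A i)) = (\<Sum>i\<in>I. emeasure ?M (A i))"
        by (rule sum.mono_neutral_right) (auto simp: I_def)
      also have "\<dots> = (\<Sum>i\<in>I. ennreal \<bar>F (d i) - F (c i)\<bar>)"
      proof (rule sum.cong[OF refl])
        fix i assume i: "i \<in> I"
        have "F (c i) \<le> F (d i)" using mono A_cd(1)[OF ne[OF i]] by (simp add: monoD)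
        then show "emeasure ?M (A i) = ennreal \<bar>F (d i) - F (c i)\<bar>"
          using A_cd(2)[OF ne[OF i]] Icc[OF A_cd(1)[OF ne[OF i]]] by simp
      qed
      also have "\<dots> = ennreal (\<Sum>i\<in>I. \<bar>F (d i) - F (c i)\<bar>)" by (rule sum_ennreal) simp
      also have "\<dots> \<le> ennreal \<epsilon>" using sm by (intro ennreal_leI) simp
      finally show ?thesis .
    qed
    have "emeasure ?M ?S \<le> emeasure ?M (\<Union>i. A i)"
      by (rule emeasure_mono) (use D(4) Un in blast, simp)
    also have "\<dots> \<le> (\<Sum>i. emeasure ?M (A i))"
      by (rule emeasure_subadditive_countably) auto
    also have "\<dots> \<le> ennreal \<epsilon>"
      by (rule suminf_le_const[OF summableI part])
    finally show ?thesis .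
  qed
  have "emeasure ?M (N \<inter> {-real n..real n}) = 0" for n
  proof -
    have "emeasure ?M (N \<inter> {-real n..real n}) \<le> 0"
      by (rule ennreal_le_epsilon) (use bounded[of _ n] in auto)
    then show ?thesis by simp
  qed
  then have "N \<inter> {-real n..real n} \<in> null_sets ?M" for n by (auto simp: null_sets_def)
  then have "(\<Union>n. N \<inter> {-real n..real n}) \<in> null_sets ?M" by (intro null_sets_UN) auto
  moreover have "(\<Union>n. N \<inter> {-real n..real n}) = N"
  proof -
    have "\<exists>n. x \<in> {-real n..real n}" for x :: real
      using real_arch_simple[of "\<bar>x\<bar>"] by (auto simp: abs_le_iff)  (metis minus_le_iff)
    then show ?thesis by blast
  qed
  ultimately show ?thesis by simp
qed

lemma ac_mono_density:
  assumes ac: "ac_real F" and mono: "mono F"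
  obtains \<rho> where "\<And>x y. x \<le> y \<Longrightarrow> (\<rho> has_integral (F y - F x)) {x..y}" "\<And>x. 0 \<le> \<rho> x"
proof -
  let ?M = "interval_measure F"
  have cont: "continuous_on UNIV F" by (rule ac_real_continuous[OF ac])
  have Icc: "emeasure ?M {x..y} = ennreal (F y - F x)" if "x \<le> y" for x y
    using emeasure_interval_measure_Icc[OF that _ cont] mono by (simp add: monoD)
  have "absolutely_continuous lborel ?M"
    unfolding absolutely_continuous_def using ac_mono_null[OF ac mono] by blast
  then obtain r where r[measurable]: "r \<in> borel_measurable lborel" and rM: "density lborel r = ?M"
    using sigma_finite_measure.Radon_Nikodym[OF sigma_finite_lborel, of ?M] by auto
  have int: "((\<lambda>t. enn2real (r t)) has_integral (F y - F x)) {x..y}" if xy: "x \<le> y" for x y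
  proof -
    have eq: "(\<integral>\<^sup>+t. r t * indicator {x..y} t \<partial>lborel) = ennreal (F y - F x)"
      using Icc[OF xy] emeasure_density[OF r, of "{x..y}"] rM by simp
    then have "AE t in lborel. r t * indicator {x..y} t \<noteq> \<infinity>"
      by (intro nn_integral_noteq_infinite) auto
    then have "AE t in lborel. r t * indicator {x..y} t = ennreal (enn2real (r t) * indicator {x..y} t)"
      by (auto simp: indicator_def less_top[symmetric])
    then have "(\<integral>\<^sup>+t. ennreal (enn2real (r t) * indicator {x..y} t) \<partial>lborel) = ennreal (F y - F x)"
      using nn_integral_cong_AE eq by metis
    then have "((\<lambda>t. enn2real (r t) * indicator {x..y} t) has_integral (F y - F x)) UNIV"
      by (intro nn_integral_has_integral) (use mono xy in \<open>auto simp: monoD\<close>)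
    moreover have "(\<lambda>t. enn2real (r t) * indicator {x..y} t) = (\<lambda>t. if t \<in> {x..y} then enn2real (r t) else 0)"
      by (auto simp: indicator_def)
    ultimately show ?thesis by (simp only: has_integral_restrict_UNIV)
  qed
  then show thesis by (rule that) auto
qed

lemma ac_real_density:
  assumes ac: "ac_real \<phi>" and const: "\<And>t. \<phi> t = \<phi> (clamp a b t)" and ab: "a \<le> b"
  obtains \<rho> where "\<And>x y. x \<le> y \<Longrightarrow> (\<rho> has_integral (\<phi> y - \<phi> x)) {x..y}"
    "\<And>x y. \<rho> absolutely_integrable_on {x..y}"
proof -
  obtain P where P: "mono P" "mono (\<lambda>t. P t - \<phi> t)" "ac_real P"
    using positive_variation[OF ac const ab] by blast
  obtain \<rho>1 where \<rho>1: "\<And>x y. x \<le> y \<Longrightarrow> (\<rho>1 has_integral (P y - P x)) {x..y}" "\<And>x. 0 \<le> \<rho>1 x"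
    using ac_mono_density[OF P(3,1)] by blast
  obtain \<rho>2 where \<rho>2: "\<And>x y. x \<le> y \<Longrightarrow> (\<rho>2 has_integral ((P y - \<phi> y) - (P x - \<phi> x))) {x..y}" "\<And>x. 0 \<le> \<rho>2 x"
    using ac_mono_density[OF ac_real_diff[OF P(3) ac] P(2)] by blast
  show thesis
  proof
    show "((\<lambda>t. \<rho>1 t - \<rho>2 t) has_integral (\<phi> y - \<phi> x)) {x..y}" if "x \<le> y" for x y
      using has_integral_diff[OF \<rho>1(1)[OF that] \<rho>2(1)[OF that]] by (simp add: algebra_simps)
    show "(\<lambda>t. \<rho>1 t - \<rho>2 t) absolutely_integrable_on {x..y}" for x y
    proof (cases "x \<le> y")
      case True
      have "\<rho>1 absolutely_integrable_on {x..y}" "\<rho>2 absolutely_integrable_on {x..y}"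
        using \<rho>1(1)[OF True] \<rho>1(2) \<rho>2(1)[OF True] \<rho>2(2)
        by (auto intro!: nonnegative_absolutely_integrable_1 simp: integrable_on_def)
      then show ?thesis by (rule set_integral_diff)
    qed (auto simp: absolutely_integrable_on_def)
  qed
qed

text \<open>Lebesgue differentiation over cubes with a given lower corner is, in dimension one, a statement about
  right derivatives; applied to the reflected density it gives the left ones.\<close>

lemma indefinite_integral_derivative_ae:
  fixes \<rho> :: "real \<Rightarrow> complex"
  assumes int: "\<And>x y. x \<le> y \<Longrightarrow> (\<rho> has_integral (F y - F x)) {x..y}"
  obtains N where "negligible N" "\<And>x. x \<notin> N \<Longrightarrow> (F has_vector_derivative \<rho> x) (at x)"
proof -
  have i1: "\<rho> integrable_on cbox x y" for x y
    using int[of x y] by (cases "x \<le> y") (auto simp: integrable_on_def)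
  have i2: "(\<lambda>t. \<rho> (- t)) integrable_on cbox x y" for x y
    using i1[of "-y" "-x"] integrable_reflect[of \<rho> "-x" "-y"] by simp
  obtain N1 where N1: "negligible N1" "\<And>x e. x \<notin> N1 \<Longrightarrow> 0 < e \<Longrightarrow>
      \<exists>d>0. \<forall>h. 0 < h \<and> h < d \<longrightarrow> norm (integral (cbox x (x + h *\<^sub>R One)) \<rho> /\<^sub>R h ^ DIM(real) - \<rho> x) < e"
    using integrable_ccontinuous_explicit[of \<rho>, OF i1] by blast
  obtain N2 where N2: "negligible N2" "\<And>x e. x \<notin> N2 \<Longrightarrow> 0 < e \<Longrightarrow>
      \<exists>d>0. \<forall>h. 0 < h \<and> h < d \<longrightarrow> norm (integral (cbox x (x + h *\<^sub>R One)) (\<lambda>t. \<rho> (- t)) /\<^sub>R h ^ DIM(real) - \<rho> (- x)) < e"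
    using integrable_ccontinuous_explicit[of "\<lambda>t. \<rho> (- t)", OF i2] by blast
  show thesis
  proof
    have "negligible (uminus ` N2)"
      by (rule negligible_differentiable_image_negligible[OF _ N2(1)]) (auto intro!: derivative_intros)
    then show "negligible (N1 \<union> uminus ` N2)" using N1(1) by (rule negligible_Un[rotated])
    fix x assume x: "x \<notin> N1 \<union> uminus ` N2"
    then have x1: "x \<notin> N1" and x2: "- x \<notin> N2" by (auto simp: image_iff) 
    show "(F has_vector_derivative \<rho> x) (at x)"
      unfolding has_vector_derivative_def has_derivative_at_alt
    proof (intro conjI allI impI)
      show "bounded_linear (\<lambda>h. h *\<^sub>R \<rho> x)" by (rule bounded_linear_scaleR_left)
      fix e :: real assume e: "e > 0"
      obtain d1 where d1: "d1 > 0" "\<And>h. 0 < h \<Longrightarrow> h < d1 \<Longrightarrow> norm (integral {x..x + h} \<rho> /\<^sub>R h - \<rho> x) < e"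
        using N1(2)[OF x1 e] by auto
      obtain d2 where d2: "d2 > 0" "\<And>h. 0 < h \<Longrightarrow> h < d2 \<Longrightarrow> norm (integral {-x..-x + h} (\<lambda>t. \<rho> (- t)) /\<^sub>R h - \<rho> x) < e"
        using N2(2)[OF x2 e] by auto
      have quot: "norm (v - h *\<^sub>R \<rho> x) \<le> e * h" if "h > 0" "norm (v /\<^sub>R h - \<rho> x) < e" for v and h :: real
      proof -
        have "v - h *\<^sub>R \<rho> x = h *\<^sub>R (v /\<^sub>R h - \<rho> x)" using that by (simp add: algebra_simps)
        then have "norm (v - h *\<^sub>R \<rho> x) = h * norm (v /\<^sub>R h - \<rho> x)" using that by simp
        then show ?thesis using that by simp
      qed
      have "norm (F y - F x - (y - x) *\<^sub>R \<rho> x) \<le> e * norm (y - x)" if y: "norm (y - x) < min d1 d2" for y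
      proof -
        consider "y = x" | "x < y" | "y < x" by linarith
        then show ?thesis
        proof cases
          case 2
          have "integral {x..x + (y - x)} \<rho> = F y - F x"
            using int[of x y] 2 by (simp add: integral_unique)
          then have "norm (F y - F x - (y - x) *\<^sub>R \<rho> x) \<le> e * (y - x)"
            using quot[OF _ d1(2)[of "y - x"]] 2 y by simp
          then show ?thesis using 2 by simp
        next
          case 3
          have "((\<lambda>t. \<rho> (- t)) has_integral (F x - F y)) {-x..-y}"
            using int[of y x] 3 by simp
          then have "integral {-x..-x + (x - y)} (\<lambda>t. \<rho> (- t)) = F x - F y"
            by (simp add: integral_unique)
          then have "norm (F x - F y - (x - y) *\<^sub>R \<rho> x) \<le> e * (x - y)"
            using quot[OF _ d2(2)[of "x - y"]] 3 y by simp
          moreover have "F y - F x - (y - x) *\<^sub>R \<rho> x = - (F x - F y - (x - y) *\<^sub>R \<rho> x)"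
            by (simp add: algebra_simps)
          ultimately show ?thesis using 3 by (metis abs_of_pos norm_minus_cancel norm_minus_commute diff_gt_0_iff_gt real_norm_def)
        qed simp
      qed
      then show "\<exists>d>0. \<forall>y. norm (y - x) < d \<longrightarrow> norm (F y - F x - (y - x) *\<^sub>R \<rho> x) \<le> e * norm (y - x)"
        using d1(1) d2(1) by (intro exI[of _ "min d1 d2"]) auto
    qed
  qed
qed

theorem abs_cont_on_FTC:
  assumes f: "abs_cont_on {a..b} f" and ab: "a \<le> b"
  obtains \<rho> N where "\<And>x y. a \<le> x \<Longrightarrow> x \<le> y \<Longrightarrow> y \<le> b \<Longrightarrow> (\<rho> has_integral (f y - f x)) {x..y}"
    "\<rho> absolutely_integrable_on {a..b}"
    "negligible N" "\<And>x. x \<in> {a<..<b} - N \<Longrightarrow> (f has_vector_derivative \<rho> x) (at x)"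
proof -
  define F where "F t = f (clamp a b t)" for t
  have idem: "clamp a b (clamp a b t) = clamp a b t" for t using ab by (auto simp: clamp_def)
  have inside: "F t = f t" if "a \<le> t" "t \<le> b" for t using that by (simp add: F_def clamp_def)
  have "ac_real (\<lambda>t. Re (F t))"
    unfolding F_def by (rule ac_real_clamp[OF f ab]) (metis abs_Re_le_cmod minus_complex.sel(1))
  then obtain r where r: "\<And>x y. x \<le> y \<Longrightarrow> (r has_integral (Re (F y) - Re (F x))) {x..y}"
    "\<And>x y. r absolutely_integrable_on {x..y}"
    by (rule ac_real_density[of "\<lambda>t. Re (F t)" a b]) (use ab idem in \<open>auto simp: F_def\<close>)
  have "ac_real (\<lambda>t. Im (F t))"
    unfolding F_def by (rule ac_real_clamp[OF f ab]) (metis abs_Im_le_cmod minus_complex.sel(2))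
  then obtain s where s: "\<And>x y. x \<le> y \<Longrightarrow> (s has_integral (Im (F y) - Im (F x))) {x..y}"
    "\<And>x y. s absolutely_integrable_on {x..y}"
    by (rule ac_real_density[of "\<lambda>t. Im (F t)" a b]) (use ab idem in \<open>auto simp: F_def\<close>)
  define \<rho> where "\<rho> t = Complex (r t) (s t)" for t
  have int: "(\<rho> has_integral (F y - F x)) {x..y}" if "x \<le> y" for x y
  proof -
    have "((\<lambda>t. of_real (r t) + \<i> * of_real (s t)) has_integral
        (of_real (Re (F y) - Re (F x)) + \<i> * of_real (Im (F y) - Im (F x)))) {x..y}"
      using has_integral_linear[OF r(1)[OF that] bounded_linear_of_real]
        has_integral_linear[OF s(1)[OF that] bounded_linear_of_real]
      by (intro has_integral_add has_integral_mult_right) (simp_all add: o_def)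
    moreover have "of_real (Re (F y) - Re (F x)) + \<i> * of_real (Im (F y) - Im (F x)) = F y - F x"
      by (simp add: complex_eq_iff)
    ultimately show ?thesis by (simp only: \<rho>_def[abs_def] Complex_eq)
  qed
  have abs: "\<rho> absolutely_integrable_on {a..b}"
  proof -
    have "(\<lambda>t. of_real (r t) + \<i> * of_real (s t) :: complex) absolutely_integrable_on {a..b}"
      using r(2) s(2)
      by (intro set_integral_add set_integrable_mult_right) 
        (auto intro: absolutely_integrable_linear[of _ _ complex_of_real, unfolded o_def] bounded_linear_of_real)
    then show ?thesis by (simp add: \<rho>_def[abs_def] Complex_eq)
  qed
  obtain N where N: "negligible N" "\<And>x. x \<notin> N \<Longrightarrow> (F has_vector_derivative \<rho> x) (at x)"
    using indefinite_integral_derivative_ae[OF int] by blast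
  show thesis
  proof
    show "(\<rho> has_integral (f y - f x)) {x..y}" if "a \<le> x" "x \<le> y" "y \<le> b" for x y
      using int[OF that(2)] inside[of x] inside[of y] that by simp
    show "\<rho> absolutely_integrable_on {a..b}" by (rule abs)
    show "negligible N" by (rule N)
    show "(f has_vector_derivative \<rho> x) (at x)" if "x \<in> {a<..<b} - N" for x
      by (rule has_vector_derivative_transform_within_open[OF N(2), of _ "{a<..<b}"])
        (use that inside in auto)
  qed
qed

section \<open>Locally absolutely continuous functions\<close>

lemma division_of_ends:
  assumes "\<D> division_of \<Union>\<D>" "\<Union>\<D> \<subseteq> {a..b::real}" "K \<in> \<D>"
  shows "Inf K \<in> {a..b}" "Sup K \<in> {a..b}" "Inf K \<le> Sup K"
proof -
  obtain u v where uv: "K = {u..v}" "u \<le> v"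
    using division_ofD(3,4)[OF assms(1,3)] by auto
  moreover have "K \<subseteq> {a..b}" using assms by blast
  ultimately show "Inf K \<in> {a..b}" "Sup K \<in> {a..b}" "Inf K \<le> Sup K" by auto
qed

text \<open>One criterion for all closure properties: sums, products, Lipschitz functions and changes outside
  the interval all have increments dominated in this way.\<close>

lemma abs_cont_on_dominated:
  assumes f: "abs_cont_on {a..b} f" and g: "abs_cont_on {a..b} g"
    and dom: "\<And>x y. x \<in> {a..b} \<Longrightarrow> y \<in> {a..b} \<Longrightarrow>
      norm (F y - F x) \<le> C * (norm (f y - f x) + norm (g y - g x) + \<bar>y - x\<bar>)"
  shows "abs_cont_on {a..b} F"
  unfolding abs_cont_on_def
proof (intro allI impI)
  fix \<epsilon> :: real assume e: "\<epsilon> > 0"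
  define C' where "C' = \<bar>C\<bar> + 1"
  have C': "C' > 0" "C \<le> C'" by (auto simp: C'_def)
  define \<eta> where "\<eta> = \<epsilon> / (3 * C')"
  have eta: "\<eta> > 0" using e C' by (simp add: \<eta>_def)
  obtain d1 where d1: "d1 > 0" and H1: "\<forall>\<D>. \<D> division_of \<Union>\<D> \<and> \<Union>\<D> \<subseteq> {a..b} \<and> (\<Sum>K\<in>\<D>. Sup K - Inf K) < d1 \<longrightarrow>
        (\<Sum>K\<in>\<D>. norm (f (Sup K) - f (Inf K))) < \<eta>"
    using f eta unfolding abs_cont_on_def by blast
  obtain d2 where d2: "d2 > 0" and H2: "\<forall>\<D>. \<D> division_of \<Union>\<D> \<and> \<Union>\<D> \<subseteq> {a..b} \<and> (\<Sum>K\<in>\<D>. Sup K - Inf K) < d2 \<longrightarrow>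
        (\<Sum>K\<in>\<D>. norm (g (Sup K) - g (Inf K))) < \<eta>"
    using g eta unfolding abs_cont_on_def by blast
  show "\<exists>\<delta>>0. \<forall>\<D>. \<D> division_of \<Union>\<D> \<and> \<Union>\<D> \<subseteq> {a..b} \<and> (\<Sum>K\<in>\<D>. Sup K - Inf K) < \<delta> \<longrightarrow>
        (\<Sum>K\<in>\<D>. norm (F (Sup K) - F (Inf K))) < \<epsilon>"
  proof (intro exI[of _ "min \<eta> (min d1 d2)"] conjI allI impI, use d1 d2 eta in simp, elim conjE)
    fix \<D> assume D: "\<D> division_of \<Union>\<D>" "\<Union>\<D> \<subseteq> {a..b}" "(\<Sum>K\<in>\<D>. Sup K - Inf K) < min \<eta> (min d1 d2)"
    note ends = division_of_ends[OF D(1,2)]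
    have "(\<Sum>K\<in>\<D>. norm (F (Sup K) - F (Inf K))) \<le>
        (\<Sum>K\<in>\<D>. C' * (norm (f (Sup K) - f (Inf K)) + norm (g (Sup K) - g (Inf K)) + (Sup K - Inf K)))"
    proof (rule sum_mono)
      fix K assume K: "K \<in> \<D>"
      have "norm (F (Sup K) - F (Inf K)) \<le>
          C * (norm (f (Sup K) - f (Inf K)) + norm (g (Sup K) - g (Inf K)) + \<bar>Sup K - Inf K\<bar>)"
        using dom ends[OF K] by blast
      also have "\<dots> \<le> C' * (norm (f (Sup K) - f (Inf K)) + norm (g (Sup K) - g (Inf K)) + \<bar>Sup K - Inf K\<bar>)"
        using C' by (intro mult_right_mono) auto
      finally show "norm (F (Sup K) - F (Inf K)) \<le>
          C' * (norm (f (Sup K) - f (Inf K)) + norm (g (Sup K) - g (Inf K)) + (Sup K - Inf K))"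
        using ends(3)[OF K] by simp
    qed
    also have "\<dots> = C' * ((\<Sum>K\<in>\<D>. norm (f (Sup K) - f (Inf K))) + (\<Sum>K\<in>\<D>. norm (g (Sup K) - g (Inf K)))
        + (\<Sum>K\<in>\<D>. Sup K - Inf K))"
      by (simp only: sum.distrib sum_distrib_left[symmetric])
    also have "\<dots> < C' * (\<eta> + \<eta> + \<eta>)"
    proof (intro mult_strict_left_mono add_strict_mono C')
      show "(\<Sum>K\<in>\<D>. norm (f (Sup K) - f (Inf K))) < \<eta>" using H1 D by simp
      show "(\<Sum>K\<in>\<D>. norm (g (Sup K) - g (Inf K))) < \<eta>" using H2 D by simp
    qed (use D in simp)
    also have "\<dots> = \<epsilon>" using C' by (simp add: \<eta>_def)
    finally show "(\<Sum>K\<in>\<D>. norm (F (Sup K) - F (Inf K))) < \<epsilon>" .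
  qed
qed

lemma abs_cont_on_const: "abs_cont_on S (\<lambda>_. c)"
  by (auto simp: abs_cont_on_def intro: exI[of _ 1])

lemma abs_cont_on_continuous:
  assumes f: "abs_cont_on {a..b} f"
  shows "continuous_on {a..b} f"
  unfolding continuous_on_iff
proof (intro ballI allI impI)
  fix x e :: real assume x: "x \<in> {a..b}" and e: "e > 0"
  then obtain \<delta> where \<delta>: "\<delta> > 0" and H: "\<forall>\<D>. \<D> division_of \<Union>\<D> \<and> \<Union>\<D> \<subseteq> {a..b} \<and> (\<Sum>K\<in>\<D>. Sup K - Inf K) < \<delta> \<longrightarrow>
        (\<Sum>K\<in>\<D>. norm (f (Sup K) - f (Inf K))) < e"
    using f unfolding abs_cont_on_def by blast
  have 1: "norm (f v - f u) < e" if "a \<le> u" "u \<le> v" "v \<le> b" "v - u < \<delta>" for u v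
  proof -
    have "{{u..v}} division_of \<Union>{{u..v}}" using that division_of_self[of u v] by simp
    then show ?thesis using H[rule_format, of "{{u..v}}"] that by simp
  qed
  have "dist (f y) (f x) < e" if "y \<in> {a..b}" "dist y x < \<delta>" for y
  proof (cases x y rule: linorder_le_cases)
    case le
    then show ?thesis using 1[of x y] x that by (simp add: dist_norm)
  next
    case ge
    then show ?thesis using 1[of y x] x that by (simp add: dist_norm norm_minus_commute)
  qed
  then show "\<exists>d>0. \<forall>x'\<in>{a..b}. dist x' x < d \<longrightarrow> dist (f x') (f x) < e"
    using \<delta> by blast
qed

abbreviation J :: "real set" where "J \<equiv> {-1<..<1}"

lemma AC_locD: "f \<in> AC_loc \<Longrightarrow> -1 < a \<Longrightarrow> a \<le> b \<Longrightarrow> b < 1 \<Longrightarrow> abs_cont_on {a..b} f"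
  by (simp add: AC_loc_def)

lemma symmetric_interval: "\<exists>b. 0 < b \<and> b < 1 \<and> \<bar>x\<bar> < b \<and> \<bar>y\<bar> < b" if "x \<in> J" "y \<in> J" for x y :: real
proof -
  have "max \<bar>x\<bar> \<bar>y\<bar> < 1" using that by auto
  then obtain b where "max \<bar>x\<bar> \<bar>y\<bar> < b" "b < 1" using dense by blast
  then show ?thesis by (intro exI[of _ b]) auto
qed

lemma AC_loc_continuous:
  assumes "f \<in> AC_loc" shows "continuous_on J f"
proof -
  have "isCont f x" if x: "x \<in> J" for x
  proof -
    obtain b where b: "0 < b" "b < 1" "\<bar>x\<bar> < b" using symmetric_interval[OF x x] by blast
    have "continuous_on {-b..b} f"
      using abs_cont_on_continuous[OF AC_locD[OF assms, of "-b" b]] b by simp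
    then have "continuous_on {-b<..<b} f" by (rule continuous_on_subset) auto
    then show ?thesis using b by (simp add: continuous_on_eq_continuous_at abs_less_iff)
  qed
  then show ?thesis by (simp add: continuous_at_imp_continuous_on)
qed

lemma AC_loc_bounded:
  assumes "f \<in> AC_loc" "-1 < a" "b < 1"
  obtains M where "M \<ge> 0" "\<And>x. x \<in> {a..b} \<Longrightarrow> norm (f x) \<le> M"
proof -
  have "continuous_on {a..b} f"
    using AC_loc_continuous[OF assms(1)] by (rule continuous_on_subset) (use assms in auto)
  then have "bounded (f ` {a..b})" by (intro compact_imp_bounded compact_continuous_image) auto
  then obtain M where "M > 0" "\<And>y. y \<in> f ` {a..b} \<Longrightarrow> norm y \<le> M" unfolding bounded_pos by blast
  then show thesis using that[of M] by auto
qed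

lemma AC_loc_dominated:
  assumes f: "f \<in> AC_loc" and g: "g \<in> AC_loc"
    and dom: "\<And>a b. -1 < a \<Longrightarrow> a \<le> b \<Longrightarrow> b < 1 \<Longrightarrow> \<exists>C. \<forall>x\<in>{a..b}. \<forall>y\<in>{a..b}.
      norm (F y - F x) \<le> C * (norm (f y - f x) + norm (g y - g x) + \<bar>y - x\<bar>)"
  shows "F \<in> AC_loc"
  unfolding AC_loc_def
proof (intro CollectI allI impI, elim conjE)
  fix a b :: real assume ab: "-1 < a" "a \<le> b" "b < 1"
  then obtain C where "\<forall>x\<in>{a..b}. \<forall>y\<in>{a..b}.
      norm (F y - F x) \<le> C * (norm (f y - f x) + norm (g y - g x) + \<bar>y - x\<bar>)"
    using dom by blast
  then show "abs_cont_on {a..b} F"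
    by (intro abs_cont_on_dominated[OF AC_locD[OF f ab] AC_locD[OF g ab], of F C]) blast
qed

lemma AC_loc_const [simp]: "(\<lambda>_. c) \<in> AC_loc"
  by (simp add: AC_loc_def abs_cont_on_const)

lemma AC_loc_cong:
  assumes "\<And>t. t \<in> J \<Longrightarrow> f t = g t" "f \<in> AC_loc"
  shows "g \<in> AC_loc"
  by (rule AC_loc_dominated[OF assms(2,2)]) (intro exI[of _ 1], use assms(1) in auto)

lemma AC_loc_cnj: "f \<in> AC_loc \<Longrightarrow> (\<lambda>t. cnj (f t)) \<in> AC_loc"
proof (rule AC_loc_dominated[of f f], assumption, assumption)
  have "norm (cnj (f y) - cnj (f x)) = norm (f y - f x)" for x y
    by (metis complex_cnj_diff complex_mod_cnj)
  then show "\<exists>C. \<forall>x\<in>{a..b}. \<forall>y\<in>{a..b}. cmod (cnj (f y) - cnj (f x))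
      \<le> C * (cmod (f y - f x) + cmod (f y - f x) + \<bar>y - x\<bar>)" for a b
    by (intro exI[of _ 1]) simp
qed

lemma AC_loc_add:
  assumes "f \<in> AC_loc" "g \<in> AC_loc"
  shows "(\<lambda>t. f t + g t) \<in> AC_loc"
proof (rule AC_loc_dominated[OF assms])
  have "norm ((f y + g y) - (f x + g x)) \<le> norm (f y - f x) + norm (g y - g x)" for x y
    by (metis add_diff_add norm_triangle_ineq)
  then show "\<exists>C. \<forall>x\<in>{a..b}. \<forall>y\<in>{a..b}. norm ((f y + g y) - (f x + g x))
      \<le> C * (cmod (f y - f x) + cmod (g y - g x) + \<bar>y - x\<bar>)" for a b
    by (intro exI[of _ 1] ballI) (smt (verit))
qed

lemma AC_loc_mult:
  assumes f: "f \<in> AC_loc" and g: "g \<in> AC_loc"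
  shows "(\<lambda>t. f t * g t) \<in> AC_loc"
proof (rule AC_loc_dominated[OF assms])
  fix a b :: real assume ab: "-1 < a" "a \<le> b" "b < 1"
  obtain M where M: "M \<ge> 0" "\<And>x. x \<in> {a..b} \<Longrightarrow> norm (f x) \<le> M"
    using AC_loc_bounded[OF f ab(1,3)] by blast
  obtain N where N: "N \<ge> 0" "\<And>x. x \<in> {a..b} \<Longrightarrow> norm (g x) \<le> N"
    using AC_loc_bounded[OF g ab(1,3)] by blast
  have "norm (f y * g y - f x * g x) \<le> (M + N) * (norm (f y - f x) + norm (g y - g x) + \<bar>y - x\<bar>)"
    if "x \<in> {a..b}" "y \<in> {a..b}" for x y
  proof -
    have "f y * g y - f x * g x = f y * (g y - g x) + (f y - f x) * g x" by (simp add: algebra_simps)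
    then have "norm (f y * g y - f x * g x) \<le> norm (f y) * norm (g y - g x) + norm (f y - f x) * norm (g x)"
      by (metis norm_mult norm_triangle_ineq)
    also have "\<dots> \<le> (M + N) * norm (g y - g x) + norm (f y - f x) * (M + N)"
      using M N that by (intro add_mono mult_mono) (auto intro: add_increasing add_increasing2)
    also have "\<dots> \<le> (M + N) * (norm (f y - f x) + norm (g y - g x) + \<bar>y - x\<bar>)"
      using M N by (simp add: algebra_simps)
    finally show ?thesis .
  qed
  then show "\<exists>C. \<forall>x\<in>{a..b}. \<forall>y\<in>{a..b}. norm (f y * g y - f x * g x)
      \<le> C * (cmod (f y - f x) + cmod (g y - g x) + \<bar>y - x\<bar>)" by blast
qed

lemma AC_loc_C1:
  assumes d: "\<And>t. t \<in> J \<Longrightarrow> (f has_vector_derivative f' t) (at t)" and c: "continuous_on J f'"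
  shows "f \<in> AC_loc"
proof (rule AC_loc_dominated[OF AC_loc_const AC_loc_const])
  fix a b :: real assume ab: "-1 < a" "a \<le> b" "b < 1"
  have "continuous_on {a..b} f'" using c by (rule continuous_on_subset) (use ab in auto)
  then have "bounded (f' ` {a..b})" by (intro compact_imp_bounded compact_continuous_image) auto
  then obtain M where M: "\<And>x. x \<in> {a..b} \<Longrightarrow> norm (f' x) \<le> M" unfolding bounded_pos by blast
  have "norm (f y - f x) \<le> M * norm (y - x)" if "x \<in> {a..b}" "y \<in> {a..b}" for x y
  proof (rule differentiable_bound[of "{a..b}" f "\<lambda>x h. h *\<^sub>R f' x"])
    show "(f has_derivative (\<lambda>h. h *\<^sub>R f' t)) (at t within {a..b})" if "t \<in> {a..b}" for t
      using d[of t] that ab by (auto simp: has_vector_derivative_def intro: has_derivative_at_withinI)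
    show "onorm (\<lambda>h. h *\<^sub>R f' t) \<le> M" if "t \<in> {a..b}" for t
    proof (rule onorm_le)
      show "norm (h *\<^sub>R f' t) \<le> M * norm h" for h
        using mult_left_mono[OF M[OF that], of "\<bar>h\<bar>"] by (simp add: mult.commute)
    qed
  qed (use that in auto)
  then show "\<exists>C. \<forall>x\<in>{a..b}. \<forall>y\<in>{a..b}. norm (f y - f x) \<le> C * (norm ((0::complex) - 0) + norm ((0::complex) - 0) + \<bar>y - x\<bar>)"
    by (intro exI[of _ M]) auto
qed

text \<open>End points of an exhaustion of \<open>(-1, 1)\<close> by compact intervals.\<close>

definition inner_end :: "nat \<Rightarrow> real" where
  "inner_end n = 1 - 1 / (real n + 2)"

lemma inner_end: "0 < inner_end n" "inner_end n < 1" "inner_end n \<le> inner_end (Suc n)"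
  by (auto simp: inner_end_def field_simps)

lemma eventually_inner_end:
  assumes "t \<in> J" shows "\<forall>\<^sub>F n in sequentially. \<bar>t\<bar> < inner_end n"
proof -
  have s: "0 < 1 - \<bar>t\<bar>" using assms by auto
  obtain m :: nat where m: "1 / (1 - \<bar>t\<bar>) < real m" using reals_Archimedean2 by blast
  have "\<bar>t\<bar> < inner_end n" if "m \<le> n" for n
  proof -
    have "1 / (1 - \<bar>t\<bar>) < real n + 2" using m that by linarith
    then have "1 < (real n + 2) * (1 - \<bar>t\<bar>)" using s by (simp add: divide_less_eq)
    then have "1 / (real n + 2) < 1 - \<bar>t\<bar>" by (simp add: divide_less_eq mult.commute)
    then show ?thesis by (simp add: inner_end_def)
  qed
  then show ?thesis unfolding eventually_sequentially by blast
qed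

lemma AC_loc_derivative:
  assumes f: "f \<in> AC_loc"
  obtains N where "negligible N"
    "\<And>t. t \<in> J - N \<Longrightarrow> (f has_vector_derivative vector_derivative f (at t)) (at t)"
proof -
  have "\<exists>N. negligible N \<and> (\<forall>t\<in>{-inner_end n<..<inner_end n} - N. f differentiable (at t))" for n
  proof -
    have ac: "abs_cont_on {-inner_end n..inner_end n} f" and le: "-inner_end n \<le> inner_end n"
      using AC_locD[OF f, of "-inner_end n" "inner_end n"] inner_end[of n] by auto
    show ?thesis
      by (rule abs_cont_on_FTC[OF ac le]) (meson differentiableI_vector)
  qed
  then obtain N where N: "\<And>n. negligible (N n)" "\<And>n t. t \<in> {-inner_end n<..<inner_end n} - N n \<Longrightarrow> f differentiable (at t)"
    by metis
  show thesis
  proof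
    show "negligible (\<Union>n. N n)" using N(1) by (rule negligible_Union_nat)
    fix t assume t: "t \<in> J - (\<Union>n. N n)"
    have "\<exists>n. \<bar>t\<bar> < inner_end n"
      using eventually_happens[OF eventually_inner_end[of t]] t by auto
    then obtain n where "\<bar>t\<bar> < inner_end n" by blast
    then have "t \<in> {-inner_end n<..<inner_end n}" by auto
    then have "f differentiable (at t)" using N(2)[of t n] t by blast
    then show "(f has_vector_derivative vector_derivative f (at t)) (at t)"
      by (simp add: vector_derivative_works)
  qed
qed

lemma AC_loc_FTC:
  assumes f: "f \<in> AC_loc" and xy: "-1 < x" "x \<le> y" "y < 1"
  shows "((\<lambda>t. vector_derivative f (at t)) has_integral (f y - f x)) {x..y}"
    and "(\<lambda>t. vector_derivative f (at t)) absolutely_integrable_on {x..y}"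
proof -
  obtain \<rho> N where \<rho>: "(\<rho> has_integral (f y - f x)) {x..y}" "\<rho> absolutely_integrable_on {x..y}"
    "negligible N" "\<And>t. t \<in> {x<..<y} - N \<Longrightarrow> (f has_vector_derivative \<rho> t) (at t)"
    by (rule abs_cont_on_FTC[OF AC_locD[OF f xy] xy(2)]) (use xy in blast)
  have N: "negligible (N \<union> {x, y})" using \<rho>(3) by simp
  have eq: "vector_derivative f (at t) = \<rho> t" if "t \<in> {x..y} - (N \<union> {x, y})" for t
    using that by (intro vector_derivative_at \<rho>(4)) auto
  show "((\<lambda>t. vector_derivative f (at t)) has_integral (f y - f x)) {x..y}"
    by (rule has_integral_spike[OF N _ \<rho>(1)]) (use eq in blast)
  show "(\<lambda>t. vector_derivative f (at t)) absolutely_integrable_on {x..y}"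
    by (rule absolutely_integrable_spike[OF \<rho>(2) N]) (use eq in blast)
qed

section \<open>Square integrable functions and the energy inequality\<close>

lemma J_lebesgue [simp]: "J \<in> sets lebesgue" by simp

lemma L2_measurable: "f \<in> L2 \<Longrightarrow> f \<in> borel_measurable (lebesgue_on J)"
  by (simp add: L2_def)

lemma L2_iff: "f \<in> L2 \<longleftrightarrow> f \<in> borel_measurable (lebesgue_on J) \<and> (\<lambda>t. (norm (f t))\<^sup>2) integrable_on J"
proof -
  have "integrable (lebesgue_on J) (\<lambda>t. (norm (f t))\<^sup>2) \<longleftrightarrow> (\<lambda>t. (norm (f t))\<^sup>2) absolutely_integrable_on J"
    by (simp add: integrable_restrict_space set_integrable_def)
  also have "\<dots> \<longleftrightarrow> (\<lambda>t. (norm (f t))\<^sup>2) integrable_on J"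
    using nonnegative_absolutely_integrable_1[of "\<lambda>t. (norm (f t))\<^sup>2" J]
      set_lebesgue_integral_eq_integral(1)[of J "\<lambda>t. (norm (f t))\<^sup>2"] by auto
  finally show ?thesis by (simp add: L2_def)
qed

lemma measurable_spike:
  fixes f g :: "real \<Rightarrow> complex"
  assumes f: "f \<in> borel_measurable (lebesgue_on J)" and N: "negligible N" and eq: "\<And>t. t \<in> J - N \<Longrightarrow> g t = f t"
  shows "g \<in> borel_measurable (lebesgue_on J)"
proof -
  have "(\<lambda>x. if x \<in> J then f x else 0) \<in> borel_measurable lebesgue"
    using f borel_measurable_if[OF J_lebesgue, of f] by blast
  moreover have "AE x in lebesgue. (if x \<in> J then f x else 0) = (if x \<in> J then g x else 0)"
  proof (rule AE_I'[of N])
    show "N \<in> null_sets lebesgue" using N by (simp add: negligible_iff_null_sets)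
    show "{x \<in> space lebesgue. (if x \<in> J then f x else 0) \<noteq> (if x \<in> J then g x else 0)} \<subseteq> N"
    proof
      fix x assume "x \<in> {x \<in> space lebesgue. (if x \<in> J then f x else 0) \<noteq> (if x \<in> J then g x else 0)}"
      then have "x \<in> J" "f x \<noteq> g x" by (auto split: if_splits)
      then show "x \<in> N" using eq[of x] by auto
    qed
  qed
  ultimately have "(\<lambda>x. if x \<in> J then g x else 0) \<in> borel_measurable lebesgue"
    by (rule borel_measurable_AE)
  then show ?thesis using borel_measurable_if[OF J_lebesgue, of g] by blast
qed

lemma L2_spike:
  assumes f: "f \<in> L2" and N: "negligible N" and eq: "\<And>t. t \<in> J - N \<Longrightarrow> g t = f t"
  shows "g \<in> L2"
  unfolding L2_iff
proof
  show "g \<in> borel_measurable (lebesgue_on J)" by (rule measurable_spike[OF L2_measurable[OF f] N eq])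
  have "(\<lambda>t. (norm (f t))\<^sup>2) integrable_on J" using f by (simp add: L2_iff)
  then show "(\<lambda>t. (norm (g t))\<^sup>2) integrable_on J"
    by (rule integrable_spike[OF _ N]) (use eq in auto)
qed

lemma L2_cong:
  assumes "f \<in> L2" "\<And>t. t \<in> J \<Longrightarrow> g t = f t" shows "g \<in> L2"
  by (rule L2_spike[OF assms(1), of "{}"]) (use assms(2) in auto)

lemma L2_dominated:
  assumes f: "f \<in> L2" and g: "g \<in> borel_measurable (lebesgue_on J)"
    and le: "\<And>t. t \<in> J \<Longrightarrow> norm (g t) \<le> C * norm (f t)"
  shows "g \<in> L2"
  unfolding L2_def
proof (intro CollectI conjI g)
  have "integrable (lebesgue_on J) (\<lambda>t. C\<^sup>2 * (norm (f t))\<^sup>2)" using f by (simp add: L2_def)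
  then show "integrable (lebesgue_on J) (\<lambda>t. (norm (g t))\<^sup>2)"
  proof (rule Bochner_Integration.integrable_bound)
    show "(\<lambda>t. (norm (g t))\<^sup>2) \<in> borel_measurable (lebesgue_on J)" using g by measurable
    show "AE t in lebesgue_on J. norm ((norm (g t))\<^sup>2) \<le> norm (C\<^sup>2 * (norm (f t))\<^sup>2)"
    proof (intro AE_I2)
      fix t assume "t \<in> space (lebesgue_on J)"
      then have "(norm (g t))\<^sup>2 \<le> (C * norm (f t))\<^sup>2" using le[of t] by (intro power_mono) auto
      then show "norm ((norm (g t))\<^sup>2) \<le> norm (C\<^sup>2 * (norm (f t))\<^sup>2)" by (simp add: power_mult_distrib)
    qed
  qed
qed

lemma L2_add:
  assumes f: "f \<in> L2" and g: "g \<in> L2"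
  shows "(\<lambda>t. f t + g t) \<in> L2"
  unfolding L2_def
proof (intro CollectI conjI)
  show m: "(\<lambda>t. f t + g t) \<in> borel_measurable (lebesgue_on J)"
    using L2_measurable[OF f] L2_measurable[OF g] by measurable
  have "integrable (lebesgue_on J) (\<lambda>t. 2 * (norm (f t))\<^sup>2 + 2 * (norm (g t))\<^sup>2)"
    using f g by (simp add: L2_def)
  then show "integrable (lebesgue_on J) (\<lambda>t. (norm (f t + g t))\<^sup>2)"
  proof (rule Bochner_Integration.integrable_bound)
    show "(\<lambda>t. (norm (f t + g t))\<^sup>2) \<in> borel_measurable (lebesgue_on J)" using m by measurable
    have "(norm (f t + g t))\<^sup>2 \<le> 2 * (norm (f t))\<^sup>2 + 2 * (norm (g t))\<^sup>2" for t
    proof -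
      have "(norm (f t + g t))\<^sup>2 \<le> (norm (f t) + norm (g t))\<^sup>2"
        by (intro power_mono norm_triangle_ineq) simp
      also have "\<dots> \<le> 2 * (norm (f t))\<^sup>2 + 2 * (norm (g t))\<^sup>2"
        using sum_squares_bound[of "norm (f t)" "norm (g t)"] by (simp add: power2_sum)
      finally show ?thesis .
    qed
    then show "AE t in lebesgue_on J. norm ((norm (f t + g t))\<^sup>2) \<le> norm (2 * (norm (f t))\<^sup>2 + 2 * (norm (g t))\<^sup>2)"
      by (intro AE_I2) simp
  qed
qed

lemma L2_mult_bounded:
  assumes f: "f \<in> L2" and c: "continuous_on J c" and le: "\<And>t. t \<in> J \<Longrightarrow> norm (c t) \<le> C"
  shows "(\<lambda>t. c t * f t) \<in> L2"
proof (rule L2_dominated[OF f])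
  have "c \<in> borel_measurable (lebesgue_on J)" by (rule continuous_imp_measurable_on_sets_lebesgue[OF c]) simp
  then show "(\<lambda>t. c t * f t) \<in> borel_measurable (lebesgue_on J)" using L2_measurable[OF f] by measurable
  show "norm (c t * f t) \<le> C * norm (f t)" if "t \<in> J" for t
    using le[OF that] by (simp add: norm_mult mult_right_mono)
qed

lemma L2_cmult: "f \<in> L2 \<Longrightarrow> (\<lambda>t. c * f t) \<in> L2"
  by (rule L2_mult_bounded[of f "\<lambda>_. c" "norm c"]) auto

lemma L2_diff: "f \<in> L2 \<Longrightarrow> g \<in> L2 \<Longrightarrow> (\<lambda>t. f t - g t) \<in> L2"
  using L2_add[of f "\<lambda>t. -1 * g t"] L2_cmult[of g "-1"] by simp

lemma L2_interval:
  assumes f: "f \<in> L2" and xy: "-1 < x" "y < 1"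
  shows "(\<lambda>t. (norm (f t))\<^sup>2) integrable_on {x..y}"
    and "integral {x..y} (\<lambda>t. (norm (f t))\<^sup>2) \<le> integral J (\<lambda>t. (norm (f t))\<^sup>2)"
proof -
  have i: "(\<lambda>t. (norm (f t))\<^sup>2) integrable_on J" using f by (simp add: L2_iff)
  have s: "{x..y} \<subseteq> J" using xy by auto
  show i2: "(\<lambda>t. (norm (f t))\<^sup>2) integrable_on {x..y}" by (rule integrable_on_subinterval[OF i s])
  show "integral {x..y} (\<lambda>t. (norm (f t))\<^sup>2) \<le> integral J (\<lambda>t. (norm (f t))\<^sup>2)"
    by (rule integral_subset_le[OF s i2 i]) simp
qed

lemma continuous_integrable_interval:
  fixes f :: "real \<Rightarrow> 'b::euclidean_space"
  assumes "continuous_on J f" "-1 < x" "y < 1" shows "f integrable_on {x..y}"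
  by (intro integrable_continuous_real continuous_on_subset[OF assms(1)]) (use assms in auto)

text \<open>Monotone convergence along an exhaustion: a continuous function belongs to \<open>L\<^sup>2\<close> as soon as its
  energy on compact subintervals is bounded. Both Hardy inequalities end with this.\<close>

lemma L2_if_bounded:
  assumes c: "continuous_on J f"
    and b: "\<And>b. 0 < b \<Longrightarrow> b < 1 \<Longrightarrow> integral {-b..b} (\<lambda>t. (norm (f t))\<^sup>2) \<le> B"
  shows "f \<in> L2"
  unfolding L2_iff
proof
  show "f \<in> borel_measurable (lebesgue_on J)"
    by (rule continuous_imp_measurable_on_sets_lebesgue[OF c]) simp
  let ?F = "\<lambda>t. (norm (f t))\<^sup>2"
  let ?I = "\<lambda>n. {-inner_end n..inner_end n}"
  let ?f = "\<lambda>n t. if t \<in> ?I n then ?F t else 0"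
  have sub: "?I n \<subseteq> J" for n using inner_end[of n] by auto
  have int: "?F integrable_on ?I n" for n
    by (rule continuous_integrable_interval) (use c inner_end[of n] in \<open>auto intro!: continuous_intros\<close>)
  have "?F integrable_on J \<and> (\<lambda>k. integral J (?f k)) \<longlonglongrightarrow> integral J ?F"
  proof (rule monotone_convergence_increasing)
    show "?f n integrable_on J" for n
      using int[of n] unfolding integrable_restrict_Int Int_absorb2[OF sub] .
    show "?f n t \<le> ?f (Suc n) t" for n t using inner_end(3)[of n] by auto
    show "(\<lambda>n. ?f n t) \<longlonglongrightarrow> ?F t" if "t \<in> J" for t
    proof (rule tendsto_eventually)
      show "\<forall>\<^sub>F n in sequentially. ?f n t = ?F t"
        using eventually_inner_end[OF that] by eventually_elim auto
    qed
    have "integral J (?f n) = integral (?I n) ?F" for n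
      unfolding integral_restrict_Int Int_absorb2[OF sub] ..
    moreover have "integral (?I n) ?F \<in> {0..B}" for n
      using b[of "inner_end n"] inner_end[of n] by (auto intro: integral_nonneg int)
    ultimately have "range (\<lambda>n. integral J (?f n)) \<subseteq> {0..B}" by auto
    then show "bounded (range (\<lambda>n. integral J (?f n)))" using bounded_subset bounded_closed_interval by blast
  qed
  then show "?F integrable_on J" ..
qed

text \<open>The function \<open>\<phi> |g|\<^sup>2\<close> is absolutely continuous and its derivative is at most
  \<open>\<phi>' |g|\<^sup>2 + 2 |\<phi>| |g| |g'|\<close>. The Hardy inequalities follow by choosing \<open>\<phi>\<close> so that the first term
  dominates the second one.\<close>

lemma energy_inequality:
  fixes \<phi> \<phi>' :: "real \<Rightarrow> real"
  assumes g: "g \<in> AC_loc" and xy: "-1 < x" "x \<le> y" "y < 1"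
    and \<phi>: "\<And>t. t \<in> J \<Longrightarrow> (\<phi> has_real_derivative \<phi>' t) (at t)" and \<phi>c: "continuous_on J \<phi>'"
    and D: "D integrable_on {x..y}" and N: "negligible N"
    and le: "\<And>t. t \<in> {x..y} - N \<Longrightarrow>
      \<phi>' t * (norm (g t))\<^sup>2 + 2 * \<bar>\<phi> t\<bar> * norm (g t) * norm (vector_derivative g (at t)) \<le> D t"
  shows "\<phi> y * (norm (g y))\<^sup>2 - \<phi> x * (norm (g x))\<^sup>2 \<le> integral {x..y} D"
proof -
  define E where "E t = complex_of_real (\<phi> t) * (g t * cnj (g t))" for t
  have \<phi>v: "((\<lambda>t. complex_of_real (\<phi> t)) has_vector_derivative complex_of_real (\<phi>' t)) (at t)" if "t \<in> J" for t
    using \<phi>[OF that] by (intro has_vector_derivative_of_real) (simp add: has_real_derivative_iff_has_vector_derivative)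
  have "(\<lambda>t. complex_of_real (\<phi> t)) \<in> AC_loc"
    by (rule AC_loc_C1[OF \<phi>v]) (auto intro!: continuous_intros \<phi>c)
  then have E: "E \<in> AC_loc" unfolding E_def by (intro AC_loc_mult AC_loc_cnj g)
  obtain N' where N': "negligible N'"
    "\<And>t. t \<in> J - N' \<Longrightarrow> (g has_vector_derivative vector_derivative g (at t)) (at t)"
    using AC_loc_derivative[OF g] by blast
  have ReE: "Re (E t) = \<phi> t * (norm (g t))\<^sup>2" for t
    by (simp add: E_def complex_norm_square[symmetric])
  have "((\<lambda>t. Re (vector_derivative E (at t))) has_integral Re (E y - E x)) {x..y}"
    using has_integral_linear[OF AC_loc_FTC(1)[OF E xy] bounded_linear_Re] by (simp add: o_def)
  moreover have "((\<lambda>t. if t \<in> N \<union> N' then Re (vector_derivative E (at t)) else D t)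
      has_integral integral {x..y} D) {x..y}"
    by (rule has_integral_spike[OF _ _ integrable_integral[OF D], of "N \<union> N'"]) (use N N'(1) in auto)
  ultimately have "Re (E y - E x) \<le> integral {x..y} D"
  proof (rule has_integral_le)
    fix t assume txy: "t \<in> {x..y}"
    show "Re (vector_derivative E (at t)) \<le> (if t \<in> N \<union> N' then Re (vector_derivative E (at t)) else D t)"
    proof (cases "t \<in> N \<union> N'")
      case False
      then have t: "t \<in> {x..y} - (N \<union> N')" using txy by blast
      then have tJ: "t \<in> J" using xy by auto
      let ?g' = "vector_derivative g (at t)"
      have d: "(g has_vector_derivative ?g') (at t)" using N'(2) t tJ by blast
      have "(E has_vector_derivative (\<phi> t * (g t * cnj ?g' + ?g' * cnj (g t)) + \<phi>' t * (g t * cnj (g t)))) (at t)"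
        unfolding E_def
        by (rule has_vector_derivative_mult[OF \<phi>v[OF tJ] has_vector_derivative_mult[OF d
            bounded_linear.has_vector_derivative[OF bounded_linear_cnj d]]])
      then have "vector_derivative E (at t) = \<phi> t * (g t * cnj ?g' + ?g' * cnj (g t)) + \<phi>' t * (g t * cnj (g t))"
        by (rule vector_derivative_at)
      then have "Re (vector_derivative E (at t)) = \<phi> t * (2 * Re (g t * cnj ?g')) + \<phi>' t * (norm (g t))\<^sup>2"
        by (simp add: complex_norm_square[symmetric] algebra_simps cmod_power2 power2_eq_square)
      also have "\<phi> t * (2 * Re (g t * cnj ?g')) \<le> 2 * \<bar>\<phi> t\<bar> * norm (g t) * norm ?g'"
      proof -
        have "\<bar>Re (g t * cnj ?g')\<bar> \<le> norm (g t * cnj ?g')" by (rule abs_Re_le_cmod)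
        then have "\<bar>\<phi> t\<bar> * \<bar>Re (g t * cnj ?g')\<bar> \<le> \<bar>\<phi> t\<bar> * (norm (g t) * norm ?g')"
          by (intro mult_left_mono) (simp_all only: norm_mult complex_mod_cnj abs_ge_zero)
        moreover have "\<phi> t * Re (g t * cnj ?g') \<le> \<bar>\<phi> t\<bar> * \<bar>Re (g t * cnj ?g')\<bar>"
          by (metis abs_ge_self abs_mult)
        ultimately show ?thesis by linarith
      qed
      finally show ?thesis using le[of t] t by simp
    qed simp
  qed
  then show ?thesis by (simp add: ReE)
qed

section \<open>Weighted Hardy inequalities\<close>

lemma weight_pos: "t \<in> J \<Longrightarrow> 0 < 1 - t\<^sup>2" for t :: real
  by (auto simp: power2_eq_square) (metis abs_square_less_1 abs_less_iff minus_less_iff power2_eq_square)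

lemma norm_weight_mult:
  assumes "t \<in> J"
  shows "norm (complex_of_real ((1 - t\<^sup>2) ^ a) * z) = (1 - t\<^sup>2) ^ a * norm z"
proof -
  have "0 \<le> (1 - t\<^sup>2) ^ a" using weight_pos[OF assms] by simp
  then show ?thesis by (simp only: norm_mult norm_of_real abs_of_nonneg)
qed

lemma weight_nonzero: "t \<in> J \<Longrightarrow> complex_of_real ((1 - t\<^sup>2) ^ a) \<noteq> 0"
  using weight_pos[of t] by (simp only: of_real_eq_0_iff) simp

text \<open>Energy inequality with \<open>\<phi> = t p\<^sup>2\<^sup>a\<^sup>+\<^sup>1\<close>. Being odd, \<open>\<phi>\<close> makes the boundary terms at \<open>b\<close> and \<open>-b\<close>
  nonnegative, and \<open>-\<phi>' = p\<^sup>2\<^sup>a ((4 a + 3) t\<^sup>2 - 1)\<close> is at least \<open>p\<^sup>2\<^sup>a\<close> where \<open>t\<^sup>2 \<ge> 2/3\<close>. On the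
  remaining compact middle part \<open>g\<close> is bounded.\<close>

lemma hardy_interior:
  fixes a :: nat
  assumes g: "g \<in> AC_loc" and L: "(\<lambda>t. of_real ((1 - t\<^sup>2) ^ (a + 1)) * vector_derivative g (at t)) \<in> L2"
  shows "(\<lambda>t. of_real ((1 - t\<^sup>2) ^ a) * g t) \<in> L2"
proof -
  let ?h = "\<lambda>t. complex_of_real ((1 - t\<^sup>2) ^ a) * g t"
  let ?v = "\<lambda>t. complex_of_real ((1 - t\<^sup>2) ^ (a + 1)) * vector_derivative g (at t)"
  define \<phi> :: "real \<Rightarrow> real" where "\<phi> t = t * (1 - t\<^sup>2) ^ (2 * a + 1)" for t
  define \<phi>' :: "real \<Rightarrow> real" where "\<phi>' t = - ((1 - t\<^sup>2) ^ (2 * a) * ((4 * real a + 3) * t\<^sup>2 - 1))" for t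
  define V where "V = integral J (\<lambda>t. (norm (?v t))\<^sup>2)"
  have gc: "continuous_on J g" by (rule AC_loc_continuous[OF g])
  have hc: "continuous_on J ?h" by (intro continuous_intros gc)
  \<comment> \<open>The interval contains all \<open>t\<close> with \<open>t\<^sup>2 < 2/3\<close>.\<close>
  obtain M where M: "M \<ge> 0" "\<And>t. t \<in> {-9/10..9/10} \<Longrightarrow> norm (g t) \<le> M"
    using AC_loc_bounded[OF g, of "-9/10" "9/10"] by auto
  have \<phi>: "(\<phi> has_real_derivative \<phi>' t) (at t)" for t
    unfolding \<phi>_def \<phi>'_def
    by (rule derivative_eq_intros refl | simp)+ (simp add: algebra_simps power2_eq_square)
  have bound: "integral {-b..b} (\<lambda>t. (norm (?h t))\<^sup>2) \<le> 4 * V + 8 * M\<^sup>2" if b: "0 < b" "b < 1" for b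
  proof -
    define D where "D t = 2 * (norm (?v t))\<^sup>2 + 2 * M\<^sup>2 - (1/2) * (norm (?h t))\<^sup>2" for t
    have iv: "(\<lambda>t. (norm (?v t))\<^sup>2) integrable_on {-b..b}" using L2_interval(1)[OF L] b by simp
    have ih: "(\<lambda>t. (norm (?h t))\<^sup>2) integrable_on {-b..b}"
      by (rule continuous_integrable_interval) (use hc b in \<open>auto intro!: continuous_intros\<close>)
    have hD: "(D has_integral (2 * integral {-b..b} (\<lambda>t. (norm (?v t))\<^sup>2) + 2 * M\<^sup>2 * (2 * b)
        - (1/2) * integral {-b..b} (\<lambda>t. (norm (?h t))\<^sup>2))) {-b..b}"
    proof -
      have "((\<lambda>t. 2 * M\<^sup>2) has_integral (2 * M\<^sup>2 * (2 * b))) {-b..b}"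
        using has_integral_const_real[of "2 * M\<^sup>2" "-b" b] b by (simp add: mult.commute)
      then show ?thesis unfolding D_def
        by (intro has_integral_add has_integral_diff has_integral_mult_right integrable_integral iv ih)
    qed
    have "\<phi> b * (norm (g b))\<^sup>2 - \<phi> (-b) * (norm (g (-b)))\<^sup>2 \<le> integral {-b..b} D"
    proof (rule energy_inequality[OF g, where N = "{}" and \<phi>' = \<phi>'])
      show "D integrable_on {-b..b}" using hD by blast
      show "continuous_on J \<phi>'" unfolding \<phi>'_def by (intro continuous_intros)
      fix t assume "t \<in> {-b..b} - {}"
      then have t: "t \<in> J" using b by auto
      define p P n n' where "p = 1 - t\<^sup>2" and "P = (1 - t\<^sup>2) ^ a"
        and "n = norm (g t)" and "n' = norm (vector_derivative g (at t))"
      have p: "0 < p" "p \<le> 1" using weight_pos[OF t] by (auto simp: p_def)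
      have P: "0 < P" "P \<le> 1" unfolding P_def using p by (auto simp: p_def power_le_one)
      have n: "0 \<le> n" "0 \<le> n'" by (auto simp: n_def n'_def)
      have eqs: "norm (?h t) = P * n" "norm (?v t) = p * P * n'"
        unfolding norm_weight_mult[OF t] by (simp_all add: n_def n'_def P_def p_def)
      have P2: "(1 - t\<^sup>2) ^ (2 * a) = P\<^sup>2" by (simp add: P_def power_mult[symmetric] mult.commute)
      have t1: "\<bar>t\<bar> \<le> 1" using t by auto
      have "2 * \<bar>\<phi> t\<bar> * n * n' = 2 * \<bar>t\<bar> * (P * n) * (p * P * n')"
      proof -
        have "\<phi> t = t * (p * P\<^sup>2)" by (simp add: \<phi>_def P2 p_def)
        then have "\<bar>\<phi> t\<bar> = \<bar>t\<bar> * (p * P\<^sup>2)" using p by (simp add: abs_mult)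
        then show ?thesis by (simp add: power2_eq_square)
      qed
      also have "\<dots> \<le> 2 * 1 * (P * n) * (p * P * n')"
        using p P n t1 by (intro mult_right_mono mult_left_mono) auto
      also have "\<dots> \<le> (1/2) * (P * n)\<^sup>2 + 2 * (p * P * n')\<^sup>2"
        using zero_le_power2[of "P * n - 2 * (p * P * n')"] by (simp add: power2_eq_square algebra_simps)
      finally have 1: "2 * \<bar>\<phi> t\<bar> * n * n' \<le> (1/2) * (P * n)\<^sup>2 + 2 * (p * P * n')\<^sup>2" .
      have 2: "\<phi>' t * n\<^sup>2 = (1 - (4 * real a + 3) * t\<^sup>2) * (P * n)\<^sup>2"
        unfolding \<phi>'_def P2 by (simp add: power_mult_distrib algebra_simps)
      have 3: "(2 - (4 * real a + 3) * t\<^sup>2) * (P * n)\<^sup>2 \<le> 2 * M\<^sup>2"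
      proof (cases "t\<^sup>2 \<ge> 2/3")
        case True
        then have "2 - (4 * real a + 3) * t\<^sup>2 \<le> 0"
          using mult_mono[of 3 "4 * real a + 3" "2/3" "t\<^sup>2"] by simp
        then have "(2 - (4 * real a + 3) * t\<^sup>2) * (P * n)\<^sup>2 \<le> 0" by (intro mult_nonpos_nonneg) auto
        also have "0 \<le> 2 * M\<^sup>2" by simp
        finally show ?thesis .
      next
        case False
        then have "t\<^sup>2 \<le> (9/10)\<^sup>2" by (simp add: power2_eq_square)
        then have "\<bar>t\<bar> \<le> 9/10" using abs_le_square_iff[of t "9/10"] by simp
        then have "n \<le> M" unfolding n_def
          by (intro M(2)) (simp only: atLeastAtMost_iff, linarith)
        then have "P * n \<le> M" using P n mult_mono[of P 1 n M] by simp
        then have "(P * n)\<^sup>2 \<le> M\<^sup>2" using P n by (intro power_mono) auto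
        moreover have "2 - (4 * real a + 3) * t\<^sup>2 \<le> 2" by simp
        ultimately show ?thesis by (intro mult_mono) auto
      qed
      show "\<phi>' t * (norm (g t))\<^sup>2 + 2 * \<bar>\<phi> t\<bar> * norm (g t) * norm (vector_derivative g (at t)) \<le> D t"
        unfolding D_def eqs n_def[symmetric] n'_def[symmetric]
        using 1 2 3 by (simp add: algebra_simps)
    qed (use b \<phi> in auto)
    moreover have "0 \<le> \<phi> b * (norm (g b))\<^sup>2 - \<phi> (-b) * (norm (g (-b)))\<^sup>2"
    proof -
      have "0 < 1 - b\<^sup>2" using weight_pos[of b] b by simp
      then have "0 \<le> \<phi> b" "\<phi> (-b) \<le> 0" using b by (auto simp: \<phi>_def)
      then have "0 \<le> \<phi> b * (norm (g b))\<^sup>2" "\<phi> (-b) * (norm (g (-b)))\<^sup>2 \<le> 0"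
        by (auto intro: mult_nonpos_nonneg)
      then show ?thesis by linarith
    qed
    moreover have "integral {-b..b} (\<lambda>t. (norm (?v t))\<^sup>2) \<le> V"
      unfolding V_def by (rule L2_interval(2)[OF L]) (use b in auto)
    moreover have "2 * M\<^sup>2 * (2 * b) \<le> 4 * M\<^sup>2" using b mult_left_mono[of b 1 "4 * M\<^sup>2"] by simp
    ultimately show ?thesis using integral_unique[OF hD] by simp
  qed
  show ?thesis by (rule L2_if_bounded[OF hc bound])
qed

text \<open>Integrates \<open>|g| \<le> 1 / (2 s) + s |g|\<^sup>2 / 2\<close> with \<open>s = sqrt q\<close>, which plays the part of the
  Cauchy-Schwarz inequality.\<close>

lemma primitive_oscillation:
  assumes W: "W \<in> AC_loc" and g: "g \<in> L2" and N: "negligible N"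
    and W': "\<And>t. t \<in> J - N \<Longrightarrow> vector_derivative W (at t) = of_real ((1 - t\<^sup>2) ^ m) * g t"
    and uv: "-1 < u" "u \<le> v" "v < 1" and q: "0 < q" "v - u \<le> q" "\<And>t. t \<in> {u..v} \<Longrightarrow> 1 - t\<^sup>2 \<le> q"
  shows "norm (W v - W u) \<le> q ^ m * sqrt q * ((1 + integral J (\<lambda>t. (norm (g t))\<^sup>2)) / 2)"
proof -
  define G where "G = integral J (\<lambda>t. (norm (g t))\<^sup>2)"
  define s where "s = sqrt q"
  have s: "0 < s" "s * s = q" using q by (auto simp: s_def)
  define D where "D t = q ^ m * (1 / (2 * s) + (s / 2) * (norm (g t))\<^sup>2)" for t
  have ig: "(\<lambda>t. (norm (g t))\<^sup>2) integrable_on {u..v}" by (rule L2_interval(1)[OF g]) (use uv in auto)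
  have hD: "(D has_integral (q ^ m * ((v - u) / (2 * s) + (s / 2) * integral {u..v} (\<lambda>t. (norm (g t))\<^sup>2)))) {u..v}"
  proof -
    have "((\<lambda>t. 1 / (2 * s)) has_integral ((v - u) / (2 * s))) {u..v}"
      using has_integral_const_real[of "1 / (2 * s)" u v] uv by simp
    then show ?thesis unfolding D_def
      by (intro has_integral_mult_right has_integral_add integrable_integral ig)
  qed
  have W1: "((\<lambda>t. if t \<in> N then 0 else vector_derivative W (at t)) has_integral (W v - W u)) {u..v}"
    by (rule has_integral_spike[OF N _ AC_loc_FTC(1)[OF W uv]]) auto
  have "norm (integral {u..v} (\<lambda>t. if t \<in> N then 0 else vector_derivative W (at t))) \<le> integral {u..v} D"
  proof (rule integral_norm_bound_integral)
    show "(\<lambda>t. if t \<in> N then 0 else vector_derivative W (at t)) integrable_on {u..v}" using W1 by blast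
    show "D integrable_on {u..v}" using hD by blast
    fix t assume t: "t \<in> {u..v}"
    then have tJ: "t \<in> J" using uv by auto
    have amgm: "norm (g t) \<le> 1 / (2 * s) + (s / 2) * (norm (g t))\<^sup>2"
      using s zero_le_power2[of "1 - s * norm (g t)"] by (simp add: field_simps power2_eq_square)
    have pm: "(1 - t\<^sup>2) ^ m \<le> q ^ m" using q(3)[OF t] weight_pos[OF tJ] by (intro power_mono) auto
    have "(1 - t\<^sup>2) ^ m * norm (g t) \<le> D t"
      unfolding D_def using weight_pos[OF tJ] q by (intro mult_mono pm amgm) auto
    moreover have "0 \<le> D t" unfolding D_def using q s by simp
    moreover have "norm (vector_derivative W (at t)) = (1 - t\<^sup>2) ^ m * norm (g t)" if "t \<notin> N"
      using W'[of t] that tJ norm_weight_mult[OF tJ] by simp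
    ultimately show "norm (if t \<in> N then 0 else vector_derivative W (at t)) \<le> D t" by auto
  qed
  then have "norm (W v - W u) \<le> q ^ m * ((v - u) / (2 * s) + (s / 2) * integral {u..v} (\<lambda>t. (norm (g t))\<^sup>2))"
    using integral_unique[OF W1] integral_unique[OF hD] by simp
  also have "\<dots> \<le> q ^ m * (s / 2 + (s / 2) * G)"
  proof (intro mult_left_mono add_mono)
    show "(v - u) / (2 * s) \<le> s / 2" using s q(2) by (simp add: field_simps)
    show "integral {u..v} (\<lambda>t. (norm (g t))\<^sup>2) \<le> G"
      unfolding G_def by (rule L2_interval(2)[OF g]) (use uv in auto)
  qed (use s q in auto)
  finally show ?thesis by (simp add: s_def G_def field_simps)
qed

text \<open>Between \<open>x\<close> and the nearer end point both \<open>p\<close> and the distance are at most \<open>p x\<close>, so \<open>W x\<close> differs by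
  at most a multiple of \<open>p\<^sup>m\<^sup>+\<^sup>1\<^sup>/\<^sup>2\<close> from every value of \<open>W\<close> beyond \<open>x\<close> on that side, and some of these are arbitrarily
  small. Asking for small values only frequently covers the boundary condition of the operator and the
  consequence of square integrability alike.\<close>

lemma primitive_decay:
  assumes W: "W \<in> AC_loc" and g: "g \<in> L2" and N: "negligible N"
    and W': "\<And>t. t \<in> J - N \<Longrightarrow> vector_derivative W (at t) = of_real ((1 - t\<^sup>2) ^ m) * g t"
    and right: "\<And>c. c > 0 \<Longrightarrow> \<exists>\<^sub>F y in at_left 1. norm (W y) < c"
    and left: "\<And>c. c > 0 \<Longrightarrow> \<exists>\<^sub>F y in at_right (-1). norm (W y) < c"
  obtains C where "\<And>x. x \<in> J \<Longrightarrow> (norm (W x))\<^sup>2 \<le> C * (1 - x\<^sup>2) ^ (2 * m + 1)"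
proof -
  define K where "K = (1 + integral J (\<lambda>t. (norm (g t))\<^sup>2)) / 2"
  have "(norm (W x))\<^sup>2 \<le> K\<^sup>2 * (1 - x\<^sup>2) ^ (2 * m + 1)" if x: "x \<in> J" for x
  proof -
    let ?q = "1 - x\<^sup>2"
    have q: "0 < ?q" by (rule weight_pos[OF x])
    have "norm (W x) \<le> ?q ^ m * sqrt ?q * K"
    proof (rule field_le_epsilon)
      fix c :: real assume c: "c > 0"
      show "norm (W x) \<le> ?q ^ m * sqrt ?q * K + c"
      proof (cases "0 \<le> x")
        case True
        have "\<forall>\<^sub>F y in at_left 1. x < y \<and> y < 1"
          using x eventually_at_left_field[of "\<lambda>y. x < y \<and> y < 1" 1] by auto
        then obtain y where y: "x < y" "y < 1" "norm (W y) < c"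
          using frequently_ex[OF frequently_eventually_conj[OF right[OF c]]] by blast
        have "norm (W y - W x) \<le> ?q ^ m * sqrt ?q * K"
          unfolding K_def
        proof (rule primitive_oscillation[OF W g N W'])
          show "1 - t\<^sup>2 \<le> 1 - x\<^sup>2" if "t \<in> {x..y}" for t using that True by (simp add: power_mono)
          have "y - x \<le> (1 - x) * 1" using y by simp
          also have "\<dots> \<le> (1 - x) * (1 + x)" using True x by (intro mult_left_mono) auto
          finally show "y - x \<le> 1 - x\<^sup>2" by (simp add: algebra_simps power2_eq_square)
        qed (use x y q in auto)
        then show ?thesis using y(3) norm_triangle_ineq3[of "W y" "W x"] by linarith
      next
        case False
        have "\<forall>\<^sub>F y in at_right (-1). -1 < y \<and> y < x"
          using x eventually_at_right_field[of "\<lambda>y. -1 < y \<and> y < x" "-1"] by auto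
        then obtain y where y: "y < x" "-1 < y" "norm (W y) < c"
          using frequently_ex[OF frequently_eventually_conj[OF left[OF c]]] by blast
        have "norm (W x - W y) \<le> ?q ^ m * sqrt ?q * K"
          unfolding K_def
        proof (rule primitive_oscillation[OF W g N W'])
          show "1 - t\<^sup>2 \<le> 1 - x\<^sup>2" if "t \<in> {y..x}" for t
            using that False power_mono[of "-x" "-t" 2] by simp
          have "x - y \<le> (1 + x) * 1" using y by simp
          also have "\<dots> \<le> (1 + x) * (1 - x)" using False x by (intro mult_left_mono) auto
          finally show "x - y \<le> 1 - x\<^sup>2" by (simp add: algebra_simps power2_eq_square)
        qed (use x y q in auto)
        then show ?thesis using y(3) norm_triangle_ineq3[of "W x" "W y"] by linarith
      qed
    qed
    then have "(norm (W x))\<^sup>2 \<le> (?q ^ m * sqrt ?q * K)\<^sup>2" by (intro power_mono) auto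
    also have "\<dots> = K\<^sup>2 * ?q ^ (2 * m + 1)"
      using q by (simp add: power_mult_distrib power_mult[symmetric] mult.commute)
    finally show ?thesis .
  qed
  then show thesis by (rule that)
qed

text \<open>Energy inequality with \<open>\<phi> = -t / p\<^sup>2\<^sup>m\<^sup>+\<^sup>1\<close>, for which
  \<open>-\<phi>' = (1 + (4 m + 1) t\<^sup>2) / p\<^sup>2\<^sup>m\<^sup>+\<^sup>2\<close>. The boundary terms have the unfavourable sign here;
  they stay bounded by \<open>primitive_decay\<close>.\<close>

lemma hardy_boundary:
  assumes W: "W \<in> AC_loc" and g: "g \<in> L2" and N: "negligible N"
    and W': "\<And>t. t \<in> J - N \<Longrightarrow> vector_derivative W (at t) = of_real ((1 - t\<^sup>2) ^ m) * g t"
    and right: "\<And>c. c > 0 \<Longrightarrow> \<exists>\<^sub>F y in at_left 1. norm (W y) < c"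
    and left: "\<And>c. c > 0 \<Longrightarrow> \<exists>\<^sub>F y in at_right (-1). norm (W y) < c"
  shows "(\<lambda>t. W t / of_real ((1 - t\<^sup>2) ^ (m + 1))) \<in> L2"
proof -
  let ?u = "\<lambda>t. W t / complex_of_real ((1 - t\<^sup>2) ^ (m + 1))"
  obtain C where C: "\<And>x. x \<in> J \<Longrightarrow> (norm (W x))\<^sup>2 \<le> C * (1 - x\<^sup>2) ^ (2 * m + 1)"
    using primitive_decay[OF assms] by blast
  define G where "G = integral J (\<lambda>t. (norm (g t))\<^sup>2)"
  define \<phi> :: "real \<Rightarrow> real" where "\<phi> t = - t / (1 - t\<^sup>2) ^ (2 * m + 1)" for t
  define \<phi>' :: "real \<Rightarrow> real" where "\<phi>' t = - ((1 + (4 * real m + 1) * t\<^sup>2) / (1 - t\<^sup>2) ^ (2 * m + 2))" for t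
  have nz: "1 - t\<^sup>2 \<noteq> 0" if "t \<in> J" for t :: real using weight_pos[OF that] by simp
  have uc: "continuous_on J ?u"
    by (intro continuous_intros AC_loc_continuous[OF W]) (use weight_nonzero in blast)
  have \<phi>: "(\<phi> has_real_derivative \<phi>' t) (at t)" if "t \<in> J" for t
  proof -
    have "(\<phi> has_real_derivative ((-1) * (1 - t\<^sup>2) ^ (2 * m + 1)
        - (-t) * (real (2 * m + 1) * (1 - t\<^sup>2) ^ (2 * m) * (- (2 * t)))) / ((1 - t\<^sup>2) ^ (2 * m + 1))\<^sup>2) (at t)"
    proof -
      have "((\<lambda>t. 1 - t\<^sup>2) has_real_derivative (- (2 * t))) (at t)"
        by (auto intro!: derivative_eq_intros)
      from DERIV_power_Suc[OF this, of "2 * m"]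
      have "((\<lambda>t. (1 - t\<^sup>2) ^ (2 * m + 1)) has_real_derivative
          (real (2 * m + 1) * (1 - t\<^sup>2) ^ (2 * m) * (- (2 * t)))) (at t)"
        by (simp add: mult_ac add.commute)
      moreover have "((\<lambda>t. - t) has_real_derivative (-1)) (at t)"
        by (auto intro!: derivative_eq_intros)
      moreover have "(1 - t\<^sup>2) ^ (2 * m + 1) \<noteq> 0" using nz[OF that] by simp
      ultimately show ?thesis
        unfolding \<phi>_def power2_eq_square[of "(1 - t\<^sup>2) ^ (2 * m + 1)"] by (intro DERIV_divide)
    qed
    moreover have "((-1) * (1 - t\<^sup>2) ^ (2 * m + 1)
        - (-t) * (real (2 * m + 1) * (1 - t\<^sup>2) ^ (2 * m) * (- (2 * t)))) / ((1 - t\<^sup>2) ^ (2 * m + 1))\<^sup>2 = \<phi>' t"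
    proof -
      define p where "p = 1 - t\<^sup>2"
      have p: "p \<noteq> 0" using nz[OF that] by (simp add: p_def)
      have pt: "p = 1 - t * t" by (simp add: p_def power2_eq_square)
      have e: "p ^ (2 * m + 1) = p * p ^ (2 * m)" "p ^ (2 * m + 2) = p * p * p ^ (2 * m)" by simp_all
      define Q where "Q = p ^ (2 * m)"
      have Q: "Q \<noteq> 0" using p by (simp add: Q_def)
      define c where "c = 1 + (4 * real m + 1) * (t * t)"
      have num: "(-1) * (p * Q) - (-t) * (real (2 * m + 1) * Q * (- (2 * t))) = - (c * Q)"
        unfolding pt c_def by (simp add: algebra_simps)
      show ?thesis
        unfolding \<phi>'_def p_def[symmetric] e Q_def[symmetric]
        unfolding power2_eq_square num c_def[symmetric]
        using p Q by (simp add: field_simps)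
    qed
    ultimately show ?thesis by simp
  qed
  have \<phi>c: "continuous_on J \<phi>'"
    unfolding \<phi>'_def by (intro continuous_intros) (use nz in auto)
  have bound: "integral {-b..b} (\<lambda>t. (norm (?u t))\<^sup>2) \<le> 4 * G + 4 * C" if b: "0 < b" "b < 1" for b
  proof -
    define D where "D t = 2 * (norm (g t))\<^sup>2 - (1/2) * (norm (?u t))\<^sup>2" for t
    have ig: "(\<lambda>t. (norm (g t))\<^sup>2) integrable_on {-b..b}" by (rule L2_interval(1)[OF g]) (use b in auto)
    have iu: "(\<lambda>t. (norm (?u t))\<^sup>2) integrable_on {-b..b}"
      by (rule continuous_integrable_interval[OF continuous_on_power[OF continuous_on_norm[OF uc]]]) (use b in auto)
    have hD: "(D has_integral (2 * integral {-b..b} (\<lambda>t. (norm (g t))\<^sup>2)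
        - (1/2) * integral {-b..b} (\<lambda>t. (norm (?u t))\<^sup>2))) {-b..b}"
      unfolding D_def by (intro has_integral_diff has_integral_mult_right integrable_integral ig iu)
    have "\<phi> b * (norm (W b))\<^sup>2 - \<phi> (-b) * (norm (W (-b)))\<^sup>2 \<le> integral {-b..b} D"
    proof (rule energy_inequality[OF W, where N = N and \<phi>' = \<phi>'])
      show "D integrable_on {-b..b}" using hD by blast
      fix t assume t0: "t \<in> {-b..b} - N"
      then have t: "t \<in> J" using b by auto
      define p P n n' where "p = 1 - t\<^sup>2" and "P = (1 - t\<^sup>2) ^ m"
        and "n = norm (W t)" and "n' = norm (g t)"
      have p: "0 < p" using weight_pos[OF t] by (auto simp: p_def)
      have P: "0 < P" unfolding P_def using p by (auto simp: p_def)
      have n: "0 \<le> n" "0 \<le> n'" by (auto simp: n_def n'_def)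
      define U where "U = n / (p * P)"
      have U: "0 \<le> U" "n = U * (p * P)" using n p P by (auto simp: U_def)
      have u: "norm (?u t) = U"
        using norm_weight_mult[OF t, of "m + 1" 1] by (simp add: norm_divide n_def P_def p_def U_def)
      have dW: "norm (vector_derivative W (at t)) = P * n'"
        using W'[of t] t0 t norm_weight_mult[OF t] by (simp add: P_def n'_def)
      have P2: "(1 - t\<^sup>2) ^ (2 * m + 1) = p * P\<^sup>2" "(1 - t\<^sup>2) ^ (2 * m + 2) = (p * P)\<^sup>2"
        by (simp_all add: P_def p_def power_mult[symmetric] power_mult_distrib mult.commute power2_eq_square)
          (simp_all add: power_add mult_2_right)
      have t1: "\<bar>t\<bar> \<le> 1" using t by auto
      have "2 * \<bar>\<phi> t\<bar> * n * (P * n') = 2 * \<bar>t\<bar> * U * n'"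
        using p P unfolding \<phi>_def P2 U(2) by (simp add: abs_mult field_simps power2_eq_square)
      also have "\<dots> \<le> 2 * 1 * U * n'"
        using n t1 U(1) by (intro mult_right_mono mult_left_mono) auto
      also have "\<dots> \<le> (1/2) * U\<^sup>2 + 2 * n'\<^sup>2"
        using zero_le_power2[of "U - 2 * n'"] by (simp add: power2_eq_square algebra_simps)
      finally have 1: "2 * \<bar>\<phi> t\<bar> * n * (P * n') \<le> (1/2) * U\<^sup>2 + 2 * n'\<^sup>2" .
      have "\<phi>' t * n\<^sup>2 = - ((1 + (4 * real m + 1) * t\<^sup>2) * U\<^sup>2)"
        using p P unfolding \<phi>'_def P2 U(2) by (simp add: power_mult_distrib field_simps)
      also have "\<dots> \<le> - U\<^sup>2" by (simp add: algebra_simps)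
      finally show "\<phi>' t * (norm (W t))\<^sup>2 + 2 * \<bar>\<phi> t\<bar> * norm (W t) * norm (vector_derivative W (at t)) \<le> D t"
        unfolding D_def u dW n_def[symmetric] n'_def[symmetric] using 1 by simp
    qed (use b \<phi> \<phi>c N in auto)
    moreover have "- (2 * C) \<le> \<phi> b * (norm (W b))\<^sup>2 - \<phi> (-b) * (norm (W (-b)))\<^sup>2"
    proof -
      have pb: "0 < (1 - b\<^sup>2) ^ (2 * m + 1)" using weight_pos[of b] b by simp
      have w: "(norm (W x))\<^sup>2 / (1 - b\<^sup>2) ^ (2 * m + 1) \<le> C" "0 \<le> (norm (W x))\<^sup>2 / (1 - b\<^sup>2) ^ (2 * m + 1)"
        if "x = b \<or> x = -b" for x
        using C[of x] that b pb by (auto simp: divide_le_eq)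
      have "b * ((norm (W x))\<^sup>2 / (1 - b\<^sup>2) ^ (2 * m + 1)) \<le> C" if "x = b \<or> x = -b" for x
        using w[OF that] b mult_right_mono[of b 1 "(norm (W x))\<^sup>2 / (1 - b\<^sup>2) ^ (2 * m + 1)"] by linarith
      from this[of b] this[of "-b"] show ?thesis by (simp add: \<phi>_def)
    qed
    moreover have "integral {-b..b} (\<lambda>t. (norm (g t))\<^sup>2) \<le> G"
      unfolding G_def by (rule L2_interval(2)[OF g]) (use b in auto)
    ultimately show ?thesis using integral_unique[OF hD] by simp
  qed
  show ?thesis by (rule L2_if_bounded[OF uc bound])
qed

text \<open>If \<open>|p z| \<ge> c\<close> on an interval whose length is comparable to \<open>q \<ge> p\<close>, then \<open>|z|\<^sup>2\<close> has integral at
  least of order \<open>c\<^sup>2 / q\<close> there.\<close>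

lemma L2_weighted_lower_bound:
  assumes z: "z \<in> L2" and uv: "-1 < u" "u \<le> v" "v < 1" and q: "0 < q" "q / 4 \<le> v - u"
    "\<And>t. t \<in> {u..v} \<Longrightarrow> 1 - t\<^sup>2 \<le> q"
    and c: "0 < c" "\<And>t. t \<in> {u..v} \<Longrightarrow> c \<le> norm (of_real (1 - t\<^sup>2) * z t)"
  shows "c\<^sup>2 \<le> 4 * q * integral J (\<lambda>t. (norm (z t))\<^sup>2)"
proof -
  have iz: "(\<lambda>t. (norm (z t))\<^sup>2) integrable_on {u..v}" by (rule L2_interval(1)[OF z]) (use uv in auto)
  have "c / q \<le> norm (z t)" if t: "t \<in> {u..v}" for t
  proof -
    have "t \<in> J" using t uv by auto
    then have "c \<le> (1 - t\<^sup>2) * norm (z t)" using c(2)[OF t] norm_weight_mult[of t 1 "z t"] by simp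
    also have "\<dots> \<le> q * norm (z t)" using q(3)[OF t] by (intro mult_right_mono) auto
    finally show ?thesis using q by (simp add: field_simps)
  qed
  then have "(c / q)\<^sup>2 \<le> (norm (z t))\<^sup>2" if "t \<in> {u..v}" for t
    using that c q by (intro power_mono) auto
  then have "integral {u..v} (\<lambda>_. (c / q)\<^sup>2) \<le> integral {u..v} (\<lambda>t. (norm (z t))\<^sup>2)"
    by (intro integral_le iz) auto
  also have "\<dots> \<le> integral J (\<lambda>t. (norm (z t))\<^sup>2)" by (rule L2_interval(2)[OF z]) (use uv in auto)
  finally have "(v - u) * (c / q)\<^sup>2 \<le> integral J (\<lambda>t. (norm (z t))\<^sup>2)" using uv by simp
  moreover have "(q / 4) * (c / q)\<^sup>2 \<le> (v - u) * (c / q)\<^sup>2" using q by (intro mult_right_mono) auto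
  ultimately have "(q / 4) * (c / q)\<^sup>2 \<le> integral J (\<lambda>t. (norm (z t))\<^sup>2)" by simp
  then show ?thesis using q by (simp add: field_simps power2_eq_square)
qed

text \<open>The lower bound, applied to intervals that shrink towards an end point, where \<open>q\<close> tends to 0.\<close>

lemma L2_weighted_frequently_small:
  assumes z: "z \<in> L2" and c: "0 < c"
  shows "\<exists>\<^sub>F y in at_left 1. norm (of_real (1 - y\<^sup>2) * z y) < c"
    and "\<exists>\<^sub>F y in at_right (-1). norm (of_real (1 - y\<^sup>2) * z y) < c"
proof -
  define G where "G = integral J (\<lambda>t. (norm (z t))\<^sup>2)"
  have G: "0 \<le> G" unfolding G_def using z by (intro integral_nonneg) (auto simp: L2_iff)
  define \<eta> where "\<eta> = c\<^sup>2 / (8 * (G + 1))"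
  have \<eta>: "0 < \<eta>" using c G by (simp add: \<eta>_def)
  have small: "\<not> c\<^sup>2 \<le> 4 * q * G" if "0 < q" "q < 2 * \<eta>" for q
  proof -
    have "4 * q * G \<le> 4 * q * (G + 1)" using that by simp
    also have "\<dots> < 4 * (2 * \<eta>) * (G + 1)" using that G by simp
    also have "\<dots> = c\<^sup>2" using G by (simp add: \<eta>_def field_simps)
    finally show ?thesis by simp
  qed
  show "\<exists>\<^sub>F y in at_left 1. norm (of_real (1 - y\<^sup>2) * z y) < c"
  proof (rule ccontr)
    assume "\<not> ?thesis"
    then have "\<forall>\<^sub>F y in at_left 1. c \<le> norm (of_real (1 - y\<^sup>2) * z y)"
      by (simp add: not_frequently not_less)
    then obtain b where b: "b < 1" "\<And>y. b < y \<Longrightarrow> y < 1 \<Longrightarrow> c \<le> norm (of_real (1 - y\<^sup>2) * z y)"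
      unfolding eventually_at_left_field by blast
    have "max (max b 0) (1 - \<eta>) < 1" using b \<eta> by simp
    then obtain x where "max (max b 0) (1 - \<eta>) < x" "x < 1" using dense by blast
    then have x: "b < x" "0 < x" "1 - \<eta> < x" "x < 1" by auto
    have "1 - x\<^sup>2 = (1 - x) * (1 + x)" by (simp add: algebra_simps power2_eq_square)
    also have "\<dots> \<le> (1 - x) * 2" using x by (intro mult_left_mono) auto
    finally have q2: "1 - x\<^sup>2 \<le> 2 * (1 - x)" by simp
    have "c\<^sup>2 \<le> 4 * (1 - x\<^sup>2) * G"
      unfolding G_def
    proof (rule L2_weighted_lower_bound[OF z, of x "(1 + x) / 2"])
      show "0 < 1 - x\<^sup>2" using weight_pos[of x] x by simp
      show "(1 - x\<^sup>2) / 4 \<le> (1 + x) / 2 - x" using q2 by (simp add: field_simps)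
      show "1 - t\<^sup>2 \<le> 1 - x\<^sup>2" if "t \<in> {x..(1 + x) / 2}" for t using that x by (simp add: power_mono)
    qed (use x b c in auto)
    then show False using small[of "1 - x\<^sup>2"] q2 x weight_pos[of x] by simp
  qed
  show "\<exists>\<^sub>F y in at_right (-1). norm (of_real (1 - y\<^sup>2) * z y) < c"
  proof (rule ccontr)
    assume "\<not> ?thesis"
    then have "\<forall>\<^sub>F y in at_right (-1). c \<le> norm (of_real (1 - y\<^sup>2) * z y)"
      by (simp add: not_frequently not_less)
    then obtain b where b: "-1 < b" "\<And>y. -1 < y \<Longrightarrow> y < b \<Longrightarrow> c \<le> norm (of_real (1 - y\<^sup>2) * z y)"
      unfolding eventually_at_right_field by blast
    have "-1 < min (min b 0) (-1 + \<eta>)" using b \<eta> by simp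
    then obtain x where "-1 < x" "x < min (min b 0) (-1 + \<eta>)" using dense by blast
    then have x: "x < b" "x < 0" "x < -1 + \<eta>" "-1 < x" by auto
    have "1 - x\<^sup>2 = (1 + x) * (1 - x)" by (simp add: algebra_simps power2_eq_square)
    also have "\<dots> \<le> (1 + x) * 2" using x by (intro mult_left_mono) auto
    finally have q2: "1 - x\<^sup>2 \<le> 2 * (1 + x)" by simp
    have "c\<^sup>2 \<le> 4 * (1 - x\<^sup>2) * G"
      unfolding G_def
    proof (rule L2_weighted_lower_bound[OF z, of "(x - 1) / 2" x])
      show "0 < 1 - x\<^sup>2" using weight_pos[of x] x by simp
      show "(1 - x\<^sup>2) / 4 \<le> x - (x - 1) / 2" using q2 by (simp add: field_simps)
      show "1 - t\<^sup>2 \<le> 1 - x\<^sup>2" if "t \<in> {(x - 1) / 2..x}" for t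
        using that x power_mono[of "-x" "-t" 2] by simp
    qed (use x b c in auto)
    then show False using small[of "1 - x\<^sup>2"] q2 x weight_pos[of x] by simp
  qed
qed

section \<open>Higher derivatives and regularity for the Legendre equation\<close>

abbreviation vd :: "(real \<Rightarrow> complex) \<Rightarrow> real \<Rightarrow> complex" where
  "vd f \<equiv> \<lambda>t. vector_derivative f (at t)"

lemma nth_vderiv_0 [simp]: "nth_vderiv 0 f = f"
  by (simp add: nth_vderiv_def)

lemma nth_vderiv_Suc: "nth_vderiv (Suc j) f = vd (nth_vderiv j f)"
  by (simp add: nth_vderiv_def)

lemma nth_vderiv_Suc_inner: "nth_vderiv (Suc j) f = nth_vderiv j (vd f)"
  by (simp add: nth_vderiv_def funpow_Suc_right del: funpow.simps)

lemma has_vd_cong: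
  assumes "\<And>s. s \<in> J \<Longrightarrow> f s = g s" "t \<in> J" "(f has_vector_derivative d) (at t)"
  shows "(g has_vector_derivative d) (at t)"
  using assms by (intro has_vector_derivative_transform_within_open[OF assms(3), of J]) auto

lemma vd_cong:
  assumes "\<And>s. s \<in> J \<Longrightarrow> f s = g s" "t \<in> J"
  shows "vd f t = vd g t"
proof -
  have "(f has_vector_derivative d) (at t) \<longleftrightarrow> (g has_vector_derivative d) (at t)" for d
    using has_vd_cong[of f g t d] has_vd_cong[of g f t d] assms by auto
  then show ?thesis by (simp add: vector_derivative_def)
qed

lemma AC_loc_order_0 [simp]: "AC_loc_order 0 = AC_loc"
  by (simp add: AC_loc_order_def)

text \<open>The recursion by which all closure properties of these classes are proved.\<close>

lemma AC_loc_order_Suc: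
  "f \<in> AC_loc_order (Suc m) \<longleftrightarrow>
     f \<in> AC_loc \<and> (\<forall>t\<in>J. f differentiable (at t)) \<and> vd f \<in> AC_loc_order m"
proof -
  have 1: "(\<forall>j<Suc m. P j) \<longleftrightarrow> P 0 \<and> (\<forall>j<m. P (Suc j))" for P :: "nat \<Rightarrow> bool"
    by (metis less_Suc_eq_0_disj Suc_less_eq)
  have 2: "(\<forall>j\<le>Suc m. P j) \<longleftrightarrow> P 0 \<and> (\<forall>j\<le>m. P (Suc j))" for P :: "nat \<Rightarrow> bool"
    by (metis Suc_le_mono le0 not0_implies_Suc)
  show ?thesis
    unfolding AC_loc_order_def mem_Collect_eq 1 2 nth_vderiv_Suc_inner nth_vderiv_0 by blast
qed

lemma AC_loc_order_mono: "f \<in> AC_loc_order m \<Longrightarrow> k \<le> m \<Longrightarrow> f \<in> AC_loc_order k"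
  by (auto simp: AC_loc_order_def)

lemma AC_loc_orderD:
  assumes "f \<in> AC_loc_order m"
  shows "j \<le> m \<Longrightarrow> nth_vderiv j f \<in> AC_loc"
    and "j < m \<Longrightarrow> t \<in> J \<Longrightarrow> (nth_vderiv j f has_vector_derivative nth_vderiv (Suc j) f t) (at t)"
  using assms by (auto simp: AC_loc_order_def nth_vderiv_Suc vector_derivative_works)

lemma AC_loc_order_cong:
  "f \<in> AC_loc_order m \<Longrightarrow> (\<And>t. t \<in> J \<Longrightarrow> f t = g t) \<Longrightarrow> g \<in> AC_loc_order m"
proof (induction m arbitrary: f g)
  case 0
  then show ?case using AC_loc_cong[of f g] by simp
next
  case (Suc m)
  have "vd g \<in> AC_loc_order m"
    using Suc.IH[of "vd f" "vd g"] Suc.prems(1) vd_cong[OF Suc.prems(2)] by (auto simp: AC_loc_order_Suc)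
  moreover have "g differentiable (at t)" if "t \<in> J" for t
    using Suc.prems(1) that has_vd_cong[OF Suc.prems(2) that]
    unfolding AC_loc_order_Suc by (meson differentiableI_vector vector_derivative_works)
  moreover have "g \<in> AC_loc"
    using AC_loc_cong[of f g] Suc.prems by (simp add: AC_loc_order_Suc)
  ultimately show ?case by (simp add: AC_loc_order_Suc)
qed

lemma AC_loc_order_SucI:
  assumes "\<And>t. t \<in> J \<Longrightarrow> (f has_vector_derivative f' t) (at t)" "f' \<in> AC_loc_order m"
  shows "f \<in> AC_loc_order (Suc m)"
proof -
  have "f' \<in> AC_loc" using AC_loc_order_mono[OF assms(2), of 0] by simp
  then have "f \<in> AC_loc" by (intro AC_loc_C1[OF assms(1)] AC_loc_continuous)
  moreover have "vd f \<in> AC_loc_order m"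
    by (rule AC_loc_order_cong[OF assms(2)]) (use assms(1) vector_derivative_at in metis)
  moreover have "f differentiable (at t)" if "t \<in> J" for t
    using assms(1)[OF that] by (rule differentiableI_vector)
  ultimately show ?thesis by (simp add: AC_loc_order_Suc)
qed

lemma AC_loc_order_SucD:
  assumes "f \<in> AC_loc_order (Suc m)"
  shows "vd f \<in> AC_loc_order m" "f \<in> AC_loc_order m"
    "\<And>t. t \<in> J \<Longrightarrow> (f has_vector_derivative vd f t) (at t)"
  using assms AC_loc_order_mono[OF assms, of m] by (auto simp: AC_loc_order_Suc vector_derivative_works)

lemma AC_loc_order_const [simp]: "(\<lambda>_. c) \<in> AC_loc_order m"
proof (induction m arbitrary: c)
  case (Suc m)
  show ?case by (rule AC_loc_order_SucI[OF has_vector_derivative_const Suc])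
qed simp

lemma AC_loc_order_add:
  "f \<in> AC_loc_order m \<Longrightarrow> g \<in> AC_loc_order m \<Longrightarrow> (\<lambda>t. f t + g t) \<in> AC_loc_order m"
proof (induction m arbitrary: f g)
  case 0
  then show ?case by (simp add: AC_loc_add)
next
  case (Suc m)
  show ?case
    by (rule AC_loc_order_SucI[OF has_vector_derivative_add Suc.IH])
      (use Suc.prems AC_loc_order_SucD in blast)+
qed

lemma AC_loc_order_mult:
  "f \<in> AC_loc_order m \<Longrightarrow> g \<in> AC_loc_order m \<Longrightarrow> (\<lambda>t. f t * g t) \<in> AC_loc_order m"
proof (induction m arbitrary: f g)
  case 0
  then show ?case by (simp add: AC_loc_mult)
next
  case (Suc m)
  note f = AC_loc_order_SucD[OF Suc.prems(1)] and g = AC_loc_order_SucD[OF Suc.prems(2)]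
  show ?case
    by (rule AC_loc_order_SucI[OF has_vector_derivative_mult[OF f(3) g(3)]])
      (assumption, assumption, intro AC_loc_order_add Suc.IH f g)
qed

lemma AC_loc_order_diff:
  "f \<in> AC_loc_order m \<Longrightarrow> g \<in> AC_loc_order m \<Longrightarrow> (\<lambda>t. f t - g t) \<in> AC_loc_order m"
  using AC_loc_order_add[of f m "\<lambda>t. -1 * g t"] AC_loc_order_mult[of "\<lambda>_. -1" m g] by simp

lemma AC_loc_order_ident: "complex_of_real \<in> AC_loc_order m"
proof (cases m)
  case 0
  have "complex_of_real \<in> AC_loc_order (Suc 0)"
    by (rule AC_loc_order_SucI[of _ "\<lambda>_. 1"]) (auto intro!: derivative_eq_intros has_vector_derivative_of_real simp: has_real_derivative_iff_has_vector_derivative[symmetric])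
  then show ?thesis using 0 AC_loc_order_mono[of _ "Suc 0" 0] by blast
next
  case (Suc l)
  show ?thesis unfolding Suc
    by (rule AC_loc_order_SucI[of _ "\<lambda>_. 1"]) (auto intro!: derivative_eq_intros has_vector_derivative_of_real simp: has_real_derivative_iff_has_vector_derivative[symmetric])
qed

lemma AC_loc_order_weight: "(\<lambda>t. complex_of_real (1 - t\<^sup>2)) \<in> AC_loc_order m"
proof -
  have "(\<lambda>t. 1 - complex_of_real t * complex_of_real t) \<in> AC_loc_order m"
    by (intro AC_loc_order_diff AC_loc_order_mult AC_loc_order_const AC_loc_order_ident)
  then show ?thesis by (simp add: power2_eq_square)
qed

lemma inverse_weight_derivative:
  assumes "t \<in> J"
  shows "((\<lambda>t. complex_of_real (1 / (1 - t\<^sup>2))) has_vector_derivative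
     (2 * complex_of_real t) * (complex_of_real (1 / (1 - t\<^sup>2)) * complex_of_real (1 / (1 - t\<^sup>2)))) (at t)"
proof -
  have "1 - t\<^sup>2 \<noteq> 0" using weight_pos[OF assms] by simp
  then have "((\<lambda>t. 1 / (1 - t\<^sup>2)) has_real_derivative (2 * t * (1 / (1 - t\<^sup>2) * (1 / (1 - t\<^sup>2))))) (at t)"
    by (auto intro!: derivative_eq_intros simp: power2_eq_square)
  then have "((\<lambda>t. complex_of_real (1 / (1 - t\<^sup>2))) has_vector_derivative
      complex_of_real (2 * t * (1 / (1 - t\<^sup>2) * (1 / (1 - t\<^sup>2))))) (at t)"
    by (intro has_vector_derivative_of_real) (simp add: has_real_derivative_iff_has_vector_derivative)
  then show ?thesis by (simp only: of_real_mult of_real_numeral)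
qed

lemma AC_loc_order_inverse_weight: "(\<lambda>t. complex_of_real (1 / (1 - t\<^sup>2))) \<in> AC_loc_order m"
proof (induction m)
  case 0
  have "1 - t\<^sup>2 \<noteq> 0" if "t \<in> J" for t :: real using weight_pos[OF that] by simp
  then show ?case unfolding AC_loc_order_0
    by (intro AC_loc_C1[OF inverse_weight_derivative] continuous_intros) auto
next
  case (Suc m)
  show ?case
    by (rule AC_loc_order_SucI[OF inverse_weight_derivative])
      (assumption, intro AC_loc_order_mult AC_loc_order_const AC_loc_order_ident Suc)
qed

lemma weight_has_derivative:
  "((\<lambda>t. complex_of_real (1 - t\<^sup>2)) has_vector_derivative - 2 * complex_of_real t) (at t within S)"
proof -
  have "((\<lambda>t. 1 - t\<^sup>2) has_real_derivative (- (2 * t))) (at t within S)"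
    by (auto intro!: derivative_eq_intros)
  then have "((\<lambda>t. complex_of_real (1 - t\<^sup>2)) has_vector_derivative complex_of_real (- (2 * t))) (at t within S)"
    by (intro has_vector_derivative_of_real) (simp add: has_real_derivative_iff_has_vector_derivative)
  then show ?thesis by simp
qed

lemma flux_derivative:
  fixes f' :: "real \<Rightarrow> complex"
  assumes "(f' has_vector_derivative d) (at t)"
  shows "((\<lambda>s. of_real (1 - s\<^sup>2) * f' s) has_vector_derivative
    of_real (1 - t\<^sup>2) * d - of_real (2 * t) * f' t) (at t)"
  using has_vector_derivative_mult[OF weight_has_derivative assms] by (simp add: algebra_simps)

text \<open>\<open>W\<close> is the integral of its derivative, hence of the continuous function \<open>r\<close>, and the classical
  fundamental theorem applies everywhere.\<close>

lemma AC_loc_continuous_derivative: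
  assumes W: "W \<in> AC_loc" and r: "continuous_on J r" and N: "negligible N"
    and eq: "\<And>t. t \<in> J - N \<Longrightarrow> vd W t = r t" and t: "t \<in> J"
  shows "(W has_vector_derivative r t) (at t)"
proof -
  obtain b where b: "0 < b" "b < 1" "\<bar>t\<bar> < b" using symmetric_interval[OF t t] by blast
  have tb: "t \<in> {-b<..<b}" "t \<in> {-b..b}" using b(3) by auto
  have W_eq: "W (-b) + integral {-b..u} r = W u" if "u \<in> {-b..b}" for u
  proof -
    have "(r has_integral (W u - W (-b))) {-b..u}"
      by (rule has_integral_spike[OF N _ AC_loc_FTC(1)[OF W]]) (use eq b that in auto)
    then show ?thesis by (simp add: integral_unique)
  qed
  have "continuous_on {-b..b} r" by (rule continuous_on_subset[OF r]) (use b in auto)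
  then have "((\<lambda>u. integral {-b..u} r) has_vector_derivative r t) (at t within {-b..b})"
    using tb(2) by (rule integral_has_vector_derivative)
  then have "((\<lambda>u. W (-b) + integral {-b..u} r) has_vector_derivative r t) (at t within {-b..b})"
    by (auto intro!: derivative_eq_intros)
  then have "(W has_vector_derivative r t) (at t within {-b..b})"
    by (rule has_vector_derivative_transform[OF tb(2), rotated]) (rule W_eq[symmetric])
  then show ?thesis using tb(1) by (simp add: at_within_Icc_at)
qed

text \<open>The flux \<open>p f'\<close> is absolutely continuous with derivative \<open>k f - h\<close>, which is continuous. Hence
  \<open>f'' = (2 t f' + k f - h) / p\<close> holds everywhere, and each pass through this equation improves the order
  of \<open>f\<close> by one until that of \<open>h\<close> is exhausted.\<close>

lemma legendre_regularity:
  assumes f: "f \<in> AC_loc_order 1" and h: "h \<in> AC_loc_order m" and N: "negligible N"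
    and eq: "\<And>t. t \<in> J - N \<Longrightarrow> h t = legendre_expr k f t"
  shows "f \<in> AC_loc_order (m + 2)"
    and "\<And>t. t \<in> J \<Longrightarrow> of_real (1 - t\<^sup>2) * vd (vd f) t = of_real (2 * t) * vd f t + of_real k * f t - h t"
proof -
  let ?W = "\<lambda>s. complex_of_real (1 - s\<^sup>2) * vd f s"
  let ?w = "\<lambda>s. complex_of_real (1 / (1 - s\<^sup>2))"
  define r where "r t = of_real k * f t - h t" for t
  note f1 = AC_loc_order_SucD[of f 0, simplified, OF f[simplified]]
  have fc: "continuous_on J f" and hc: "continuous_on J h"
    using f1(2) AC_loc_order_mono[OF h, of 0] by (auto intro: AC_loc_continuous)
  have W: "?W \<in> AC_loc"
    using AC_loc_order_weight[of 0] f1(1) by (simp add: AC_loc_mult)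
  have dW: "(?W has_vector_derivative r t) (at t)" if "t \<in> J" for t
  proof (rule AC_loc_continuous_derivative[OF W _ N _ that])
    show "continuous_on J r" unfolding r_def by (intro continuous_intros fc hc)
    show "vd ?W t = r t" if "t \<in> J - N" for t
      using eq[OF that] unfolding r_def legendre_expr_def by (simp add: algebra_simps)
  qed
  have ww: "?w t * of_real (1 - t\<^sup>2) = 1" if "t \<in> J" for t
    using weight_pos[OF that] unfolding of_real_mult[symmetric] by simp
  have d2: "(vd f has_vector_derivative ?w t * (of_real (2 * t) * vd f t + r t)) (at t)" if t: "t \<in> J" for t
  proof (rule has_vd_cong[OF _ t])
    show "?w s * ?W s = vd f s" if "s \<in> J" for s
      using ww[OF that] by (simp only: mult.assoc[symmetric] mult_1_left)
    have "?w t * r t + (2 * complex_of_real t) * (?w t * ?w t) * ?W t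
       = ?w t * (r t + of_real (2 * t) * (?w t * of_real (1 - t\<^sup>2)) * vd f t)"
      by (simp only: of_real_mult of_real_numeral ring_distribs mult_ac)
    also have "\<dots> = ?w t * (of_real (2 * t) * vd f t + r t)"
      unfolding ww[OF t] by (simp add: add.commute)
    finally show "((\<lambda>s. ?w s * ?W s) has_vector_derivative ?w t * (of_real (2 * t) * vd f t + r t)) (at t)"
      using has_vector_derivative_mult[OF inverse_weight_derivative[OF t] dW[OF t]] by simp
  qed
  have "f \<in> AC_loc_order (j + 2)" if "j \<le> m" for j
  proof -
    have step: "f \<in> AC_loc_order (Suc (Suc j))" if "f \<in> AC_loc_order (Suc j)" "j \<le> m" for j
    proof (rule AC_loc_order_SucI)
      note fj = AC_loc_order_SucD[OF that(1)]
      show "(f has_vector_derivative vd f t) (at t)" if "t \<in> J" for t by (rule fj(3)[OF that])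
      show "vd f \<in> AC_loc_order (Suc j)"
      proof (rule AC_loc_order_SucI[OF d2])
        have "(\<lambda>t. ?w t * ((of_real 2 * of_real t) * vd f t + r t)) \<in> AC_loc_order j"
          unfolding r_def
          by (intro AC_loc_order_mult AC_loc_order_add AC_loc_order_diff AC_loc_order_inverse_weight
            AC_loc_order_const AC_loc_order_ident fj AC_loc_order_mono[OF h that(2)])
        then show "(\<lambda>t. ?w t * (of_real (2 * t) * vd f t + r t)) \<in> AC_loc_order j" by simp
      qed
    qed
    show ?thesis using that
    proof (induction j)
      case 0
      then show ?case using step[of 0] f by (simp add: numeral_2_eq_2)
    next
      case (Suc j)
      then show ?case using step[of "Suc j"] by simp
    qed
  qed
  then show "f \<in> AC_loc_order (m + 2)" by simp
  fix t assume t: "t \<in> J"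
  have "vd (vd f) t = ?w t * (of_real (2 * t) * vd f t + r t)"
    using d2[OF t] by (rule vector_derivative_at)
  then have "of_real (1 - t\<^sup>2) * vd (vd f) t = (?w t * of_real (1 - t\<^sup>2)) * (of_real (2 * t) * vd f t + r t)"
    by (simp only: mult_ac)
  then show "of_real (1 - t\<^sup>2) * vd (vd f) t = of_real (2 * t) * vd f t + of_real k * f t - h t"
    unfolding ww[OF t] by (simp add: r_def)
qed

lemma differentiated_equation_step:
  fixes k :: real and F0 F1 F2 H :: "real \<Rightarrow> complex"
  assumes id: "\<And>s. s \<in> J \<Longrightarrow> of_real (1 - s\<^sup>2) * F2 s =
      of_real (2 * real (j + 1) * s) * F1 s + of_real (real j * real (j + 1) + k) * F0 s - H s"
    and d: "(F0 has_vector_derivative F1 t) (at t)" "(F1 has_vector_derivative F2 t) (at t)"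
      "(F2 has_vector_derivative F3) (at t)" "(H has_vector_derivative H1) (at t)" and t: "t \<in> J"
  shows "of_real (1 - t\<^sup>2) * F3 =
      of_real (2 * real (Suc j + 1) * t) * F2 t + of_real (real (Suc j) * real (Suc j + 1) + k) * F1 t - H1"
proof -
  let ?c = "of_real (real j * real (j + 1) + k) :: complex"
  have "((\<lambda>s. of_real (2 * real (j + 1) * s) :: complex) has_vector_derivative of_real (2 * real (j + 1))) (at t)"
    by (intro has_vector_derivative_of_real)
      (auto intro!: derivative_eq_intros simp: has_real_derivative_iff_has_vector_derivative[symmetric])
  from has_vector_derivative_mult[OF this d(2)]
  have "((\<lambda>s. of_real (2 * real (j + 1) * s) * F1 s + ?c * F0 s - H s) has_vector_derivative
      of_real (2 * real (j + 1) * t) * F2 t + of_real (2 * real (j + 1)) * F1 t + ?c * F1 t - H1) (at t)"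
    by (intro has_vector_derivative_diff has_vector_derivative_add has_vector_derivative_mult_right d(1,4))
  moreover have "((\<lambda>s. of_real (2 * real (j + 1) * s) * F1 s + ?c * F0 s - H s) has_vector_derivative
      of_real (1 - t\<^sup>2) * F3 - of_real (2 * t) * F2 t) (at t)"
    by (rule has_vd_cong[OF id t flux_derivative[OF d(3)]])
  ultimately have "of_real (1 - t\<^sup>2) * F3 - of_real (2 * t) * F2 t =
      of_real (2 * real (j + 1) * t) * F2 t + of_real (2 * real (j + 1)) * F1 t + ?c * F1 t - H1"
    by (rule vector_derivative_unique_at[rotated])
  then have "of_real (1 - t\<^sup>2) * F3 = of_real (2 * t) * F2 t +
      (of_real (2 * real (j + 1) * t) * F2 t + of_real (2 * real (j + 1)) * F1 t + ?c * F1 t - H1)"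
    by (simp only: diff_eq_eq add.commute)
  then show ?thesis by (simp add: algebra_simps)
qed

text \<open>The equation \<open>h = A f\<close> after \<open>j\<close> differentiations, solved for the highest derivative.\<close>

definition differentiated_eq :: "real \<Rightarrow> (real \<Rightarrow> complex) \<Rightarrow> (real \<Rightarrow> complex) \<Rightarrow> nat \<Rightarrow> real \<Rightarrow> bool" where
  "differentiated_eq k f h j t \<longleftrightarrow> of_real (1 - t\<^sup>2) * nth_vderiv (j + 2) f t =
     of_real (2 * real (j + 1) * t) * nth_vderiv (j + 1) f t
     + of_real (real j * real (j + 1) + k) * nth_vderiv j f t - nth_vderiv j h t"

text \<open>The last differentiation uses derivatives of functions that are only absolutely continuous, hence the
  exceptional null set.\<close>

lemma differentiated_eq_all:
  assumes f: "f \<in> AC_loc_order (m + 2)" and h: "h \<in> AC_loc_order m"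
    and eq: "\<And>t. t \<in> J \<Longrightarrow> of_real (1 - t\<^sup>2) * vd (vd f) t = of_real (2 * t) * vd f t + of_real k * f t - h t"
  shows "j \<le> m \<Longrightarrow> t \<in> J \<Longrightarrow> differentiated_eq k f h j t"
    and "\<exists>N. negligible N \<and> (\<forall>t\<in>J - N. differentiated_eq k f h (m + 1) t)"
proof -
  have all: "\<forall>t\<in>J. differentiated_eq k f h j t" if "j \<le> m" for j
    using that
  proof (induction j)
    case 0
    show ?case using eq by (simp add: differentiated_eq_def nth_vderiv_Suc numeral_2_eq_2)
  next
    case (Suc j)
    show ?case
    proof
      fix t assume t: "t \<in> J"
      show "differentiated_eq k f h (Suc j) t"
        unfolding differentiated_eq_def
        using differentiated_equation_step[of "nth_vderiv (j + 2) f" j "nth_vderiv (j + 1) f" k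
            "nth_vderiv j f" "nth_vderiv j h" t "nth_vderiv (Suc j + 2) f t" "nth_vderiv (Suc j) h t"]
          Suc AC_loc_orderD(2)[OF f _ t, of j] AC_loc_orderD(2)[OF f _ t, of "Suc j"]
          AC_loc_orderD(2)[OF f _ t, of "Suc (Suc j)"] AC_loc_orderD(2)[OF h _ t, of j] t
        by (simp add: differentiated_eq_def)
    qed
  qed
  then show "j \<le> m \<Longrightarrow> t \<in> J \<Longrightarrow> differentiated_eq k f h j t" by blast
  obtain N1 where N1: "negligible N1" "\<And>t. t \<in> J - N1 \<Longrightarrow>
      (nth_vderiv (m + 2) f has_vector_derivative vd (nth_vderiv (m + 2) f) t) (at t)"
    using AC_loc_derivative[OF AC_loc_orderD(1)[OF f order_refl]] by blast
  obtain N2 where N2: "negligible N2" "\<And>t. t \<in> J - N2 \<Longrightarrow>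
      (nth_vderiv m h has_vector_derivative vd (nth_vderiv m h) t) (at t)"
    using AC_loc_derivative[OF AC_loc_orderD(1)[OF h order_refl]] by blast
  have "differentiated_eq k f h (m + 1) t" if "t \<in> J - (N1 \<union> N2)" for t
  proof -
    have t: "t \<in> J" and t1: "t \<in> J - N1" and t2: "t \<in> J - N2" using that by auto
    show ?thesis
      unfolding differentiated_eq_def
      using differentiated_equation_step[of "nth_vderiv (m + 2) f" m "nth_vderiv (m + 1) f" k
          "nth_vderiv m f" "nth_vderiv m h" t "nth_vderiv (Suc m + 2) f t" "nth_vderiv (Suc m) h t"]
        all[of m] AC_loc_orderD(2)[OF f _ t, of m] AC_loc_orderD(2)[OF f _ t, of "Suc m"]
        N1(2)[OF t1] N2(2)[OF t2] t
      by (simp add: differentiated_eq_def nth_vderiv_Suc)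
  qed
  then show "\<exists>N. negligible N \<and> (\<forall>t\<in>J - N. differentiated_eq k f h (m + 1) t)"
    using N1(1) N2(1) by (intro exI[of _ "N1 \<union> N2"]) auto
qed

section \<open>The domains of the powers\<close>

lemma L2_weight_mono:
  assumes "(\<lambda>t. of_real ((1 - t\<^sup>2) ^ a) * f t) \<in> L2" "a \<le> b"
  shows "(\<lambda>t. of_real ((1 - t\<^sup>2) ^ b) * f t) \<in> L2"
proof (rule L2_cong)
  show "(\<lambda>t. of_real ((1 - t\<^sup>2) ^ (b - a)) * (of_real ((1 - t\<^sup>2) ^ a) * f t)) \<in> L2"
  proof (rule L2_mult_bounded[OF assms(1)])
    show "continuous_on J (\<lambda>t. complex_of_real ((1 - t\<^sup>2) ^ (b - a)))" by (intro continuous_intros)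
    show "norm (complex_of_real ((1 - t\<^sup>2) ^ (b - a))) \<le> 1" if "t \<in> J" for t
      using norm_weight_mult[OF that, of "b - a" 1] weight_pos[OF that] by (simp add: power_le_one)
  qed
  have "(1 - t\<^sup>2) ^ b = (1 - t\<^sup>2) ^ (b - a) * (1 - t\<^sup>2) ^ a" for t :: real
    using assms(2) by (simp add: power_add[symmetric])
  then show "of_real ((1 - t\<^sup>2) ^ b) * f t = of_real ((1 - t\<^sup>2) ^ (b - a)) * (of_real ((1 - t\<^sup>2) ^ a) * f t)" for t
    by (simp only: of_real_mult mult.assoc)
qed

lemma L2_ident_mult:
  assumes "(\<lambda>t. of_real ((1 - t\<^sup>2) ^ a) * f t) \<in> L2"
  shows "(\<lambda>t. of_real ((1 - t\<^sup>2) ^ a) * (of_real (c * t) * f t)) \<in> L2"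
proof (rule L2_cong)
  show "(\<lambda>t. of_real (c * t) * (of_real ((1 - t\<^sup>2) ^ a) * f t)) \<in> L2"
  proof (rule L2_mult_bounded[OF assms])
    show "continuous_on J (\<lambda>t. complex_of_real (c * t))" by (intro continuous_intros)
    show "norm (complex_of_real (c * t)) \<le> \<bar>c\<bar>" if "t \<in> J" for t
      using that mult_left_mono[of "\<bar>t\<bar>" 1 "\<bar>c\<bar>"] unfolding norm_of_real abs_mult by auto
  qed
qed (simp only: mult_ac)

definition power_dom :: "nat \<Rightarrow> (real \<Rightarrow> complex) set" where
  "power_dom n = {f. f \<in> AC_loc_order (2 * n - 1) \<and>
     (\<lambda>t. of_real ((1 - t\<^sup>2) ^ n) * nth_vderiv (2 * n) f t) \<in> L2}"

text \<open>Downward induction from \<open>m = 2 n\<close> with \<open>hardy_interior\<close>. Each integration lowers the exponent by one;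
  once it has reached 0, truncated subtraction keeps it there.\<close>

lemma power_dom_weighted:
  assumes f: "f \<in> power_dom n" and m: "m \<le> 2 * n"
  shows "(\<lambda>t. of_real ((1 - t\<^sup>2) ^ (m - n)) * nth_vderiv m f t) \<in> L2"
  using m
proof (induction rule: inc_induct)
  case base
  have "2 * n - n = n" by simp
  then show ?case using f by (simp add: power_dom_def)
next
  case (step m)
  have fo: "f \<in> AC_loc_order (2 * n - 1)" using f by (simp add: power_dom_def)
  show ?case
  proof (rule hardy_interior)
    show "nth_vderiv m f \<in> AC_loc" using AC_loc_orderD(1)[OF fo] step by simp
    show "(\<lambda>t. of_real ((1 - t\<^sup>2) ^ (m - n + 1)) * vector_derivative (nth_vderiv m f) (at t)) \<in> L2"
      using L2_weight_mono[OF step.IH, of "m - n + 1"] by (simp add: nth_vderiv_Suc)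
  qed
qed

lemma flux_vd_ae:
  assumes "f \<in> AC_loc_order 1"
  obtains N where "negligible N" "\<And>t. t \<in> J - N \<Longrightarrow>
    vd (\<lambda>s. of_real (1 - s\<^sup>2) * vd f s) t = of_real (1 - t\<^sup>2) * nth_vderiv 2 f t - of_real (2 * t) * vd f t"
proof -
  have "vd f \<in> AC_loc" using AC_loc_orderD(1)[OF assms, of 1] by (simp add: nth_vderiv_Suc)
  then obtain N where N: "negligible N" "\<And>t. t \<in> J - N \<Longrightarrow> (vd f has_vector_derivative vd (vd f) t) (at t)"
    using AC_loc_derivative by blast
  show thesis
  proof (rule that[OF N(1)])
    fix t assume "t \<in> J - N"
    from vector_derivative_at[OF flux_derivative[OF N(2)[OF this]]]
    show "vd (\<lambda>s. of_real (1 - s\<^sup>2) * vd f s) t = of_real (1 - t\<^sup>2) * nth_vderiv 2 f t - of_real (2 * t) * vd f t"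
      by (simp add: nth_vderiv_Suc numeral_2_eq_2)
  qed
qed

lemma flux_AC_loc:
  assumes "f \<in> AC_loc_order 1"
  shows "(\<lambda>s. of_real (1 - s\<^sup>2) * vd f s) \<in> AC_loc"
proof -
  have "vd f \<in> AC_loc" using AC_loc_orderD(1)[OF assms, of 1] by (simp add: nth_vderiv_Suc)
  then show ?thesis using AC_loc_mult[OF AC_loc_order_weight[of 0, unfolded AC_loc_order_0]] by simp
qed

text \<open>The flux \<open>W = p f'\<close> has derivative \<open>k f - A f\<close> in \<open>L\<^sup>2\<close> and vanishes at the end points, so
  \<open>hardy_boundary\<close> with \<open>m = 0\<close> yields \<open>f' \<in> L\<^sup>2\<close>; then \<open>p f'' = W' + 2 t f'\<close>.\<close>

lemma legendre_dom_subset: "legendre_dom k \<subseteq> power_dom 1"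
proof
  fix f assume "f \<in> legendre_dom k"
  then have f: "f \<in> AC_loc_order 1" "f \<in> L2" "legendre_expr k f \<in> L2"
    and lim: "((\<lambda>t. of_real (1 - t\<^sup>2) * vd f t) \<longlongrightarrow> 0) (at_left 1)"
      "((\<lambda>t. of_real (1 - t\<^sup>2) * vd f t) \<longlongrightarrow> 0) (at_right (-1))"
    by (auto simp: legendre_dom_def)
  let ?W = "\<lambda>s. complex_of_real (1 - s\<^sup>2) * vd f s"
  define g where "g t = of_real k * f t - legendre_expr k f t" for t
  have g: "g \<in> L2" unfolding g_def by (intro L2_diff L2_cmult f)
  have gW: "vd ?W t = g t" for t by (simp add: g_def legendre_expr_def)
  have small: "\<exists>\<^sub>F y in F. norm (?W y) < c"
    if "(?W \<longlongrightarrow> 0) F" "F \<noteq> bot" "c > 0" for F c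
  proof -
    have "\<forall>\<^sub>F y in F. norm (?W y) < c" using tendstoD[OF that(1,3)] by (simp add: dist_norm)
    then show ?thesis using that(2) by (rule eventually_frequently[rotated])
  qed
  have "(\<lambda>t. ?W t / of_real ((1 - t\<^sup>2) ^ (0 + 1))) \<in> L2"
  proof (rule hardy_boundary[OF flux_AC_loc[OF f(1)] g, of "{}"])
    show "vd ?W t = of_real ((1 - t\<^sup>2) ^ 0) * g t" for t using gW by simp
  qed (use small[OF lim(1)] small[OF lim(2)] in auto)
  then have f': "vd f \<in> L2"
  proof (rule L2_cong)
    show "vd f t = ?W t / of_real ((1 - t\<^sup>2) ^ (0 + 1))" if "t \<in> J" for t
      using weight_nonzero[OF that, of 1] by simp
  qed
  obtain N where N: "negligible N" "\<And>t. t \<in> J - N \<Longrightarrow>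
    vd ?W t = of_real (1 - t\<^sup>2) * nth_vderiv 2 f t - of_real (2 * t) * vd f t"
    using flux_vd_ae[OF f(1)] by blast
  have "(\<lambda>t. of_real (1 - t\<^sup>2) * nth_vderiv 2 f t) \<in> L2"
  proof (rule L2_spike[OF _ N(1)])
    show "(\<lambda>t. g t + of_real (2 * t) * vd f t) \<in> L2"
      using L2_add[OF g L2_ident_mult[of 0 "vd f" 2]] f' by simp
    show "of_real (1 - t\<^sup>2) * nth_vderiv 2 f t = g t + of_real (2 * t) * vd f t" if "t \<in> J - N" for t
      using N(2)[OF that] gW by simp
  qed
  then show "f \<in> power_dom 1" using f(1) by (simp add: power_dom_def)
qed

text \<open>The boundary condition is automatic: \<open>f'\<close> is square integrable, so \<open>p f'\<close> has small values near the end
  points, and \<open>primitive_decay\<close> turns these into a limit.\<close>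

lemma subset_legendre_dom: "power_dom 1 \<subseteq> legendre_dom k"
proof
  fix f assume fp: "f \<in> power_dom 1"
  then have fo: "f \<in> AC_loc_order 1" by (simp add: power_dom_def)
  have f: "f \<in> L2" and f': "vd f \<in> L2" and f'': "(\<lambda>t. of_real (1 - t\<^sup>2) * nth_vderiv 2 f t) \<in> L2"
    using power_dom_weighted[OF fp, of 0] power_dom_weighted[OF fp, of 1] power_dom_weighted[OF fp, of 2]
    by (simp_all add: nth_vderiv_Suc)
  let ?W = "\<lambda>s. complex_of_real (1 - s\<^sup>2) * vd f s"
  define g where "g t = of_real (1 - t\<^sup>2) * nth_vderiv 2 f t - of_real (2 * t) * vd f t" for t
  have g: "g \<in> L2"
    unfolding g_def using L2_diff[OF f'' L2_ident_mult[of 0 "vd f" 2]] f' by simp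
  obtain N where N: "negligible N" "\<And>t. t \<in> J - N \<Longrightarrow> vd ?W t = g t"
    unfolding g_def using flux_vd_ae[OF fo] by blast
  have "legendre_expr k f \<in> L2"
  proof (rule L2_spike[OF _ N(1)])
    show "(\<lambda>t. of_real k * f t - g t) \<in> L2" by (intro L2_diff L2_cmult f g)
    show "legendre_expr k f t = of_real k * f t - g t" if "t \<in> J - N" for t
      using N(2)[OF that] by (simp add: legendre_expr_def)
  qed
  moreover obtain C where C: "\<And>x. x \<in> J \<Longrightarrow> (norm (?W x))\<^sup>2 \<le> C * (1 - x\<^sup>2) ^ (2 * 0 + 1)"
  proof (rule primitive_decay[OF flux_AC_loc[OF fo] g N(1), where m = 0])
    show "vd ?W t = of_real ((1 - t\<^sup>2) ^ 0) * g t" if "t \<in> J - N" for t using N(2)[OF that] by simp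
  qed (use L2_weighted_frequently_small[OF f'] in blast)+
  have lim: "(?W \<longlongrightarrow> 0) F" if "\<forall>\<^sub>F x in F. x \<in> J" "((\<lambda>x. C * (1 - x\<^sup>2)) \<longlongrightarrow> 0) F" for F
  proof -
    have "((\<lambda>x. (norm (?W x))\<^sup>2) \<longlongrightarrow> 0) F"
    proof (rule tendsto_sandwich[OF _ _ tendsto_const that(2)])
      show "\<forall>\<^sub>F x in F. (norm (?W x))\<^sup>2 \<le> C * (1 - x\<^sup>2)"
        using that(1) by eventually_elim (use C in simp)
    qed simp
    from tendsto_real_sqrt[OF this] show ?thesis by (simp add: tendsto_norm_zero_iff)
  qed
  have "(?W \<longlongrightarrow> 0) (at_left 1)"
  proof (rule lim)
    show "\<forall>\<^sub>F x in at_left 1. x \<in> J"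
      using eventually_at_left_field[of "\<lambda>x. x \<in> J" 1] by (auto intro: exI[of _ 0])
    have "((\<lambda>x. C * (1 - x\<^sup>2)) \<longlongrightarrow> C * (1 - 1\<^sup>2)) (at_left 1)" by (intro tendsto_intros)
    then show "((\<lambda>x. C * (1 - x\<^sup>2)) \<longlongrightarrow> 0) (at_left 1)" by simp
  qed
  moreover have "(?W \<longlongrightarrow> 0) (at_right (-1))"
  proof (rule lim)
    show "\<forall>\<^sub>F x in at_right (-1). x \<in> J"
      using eventually_at_right_field[of "\<lambda>x. x \<in> J" "-1"] by (auto intro: exI[of _ 0])
    have "((\<lambda>x. C * (1 - x\<^sup>2)) \<longlongrightarrow> C * (1 - (-1)\<^sup>2)) (at_right (-1))" by (intro tendsto_intros)
    then show "((\<lambda>x. C * (1 - x\<^sup>2)) \<longlongrightarrow> 0) (at_right (-1))" by simp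
  qed
  ultimately show "f \<in> legendre_dom k" using fo f by (simp add: legendre_dom_def)
qed

lemma legendre_dom_eq: "legendre_dom k = power_dom 1"
  using legendre_dom_subset subset_legendre_dom by blast

lemma AE_J_iff: "(AE t in lebesgue_on J. P t) \<longleftrightarrow> (\<exists>N. negligible N \<and> (\<forall>t\<in>J - N. P t))"
proof -
  have "(AE t in lebesgue_on J. P t) \<longleftrightarrow> (AE t in lebesgue. t \<in> J \<longrightarrow> P t)"
    by (simp add: AE_restrict_space_iff)
  also have "\<dots> \<longleftrightarrow> (\<exists>N\<in>null_sets lebesgue. \<forall>t. t \<notin> N \<longrightarrow> t \<in> J \<longrightarrow> P t)"
    unfolding eventually_ae_filter by (simp add: subset_iff) blast
  finally show ?thesis unfolding negligible_iff_null_sets by blast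
qed

text \<open>The induction over \<open>m\<close> keeps the weighted bounds for two consecutive derivatives; the exponents are
  \<open>m - (n + 1)\<close>, truncated at 0, and its successor. For \<open>m \<le> n\<close> the bound on \<open>f\<^sup>(\<^sup>m\<^sup>+\<^sup>1\<^sup>)\<close> loses its
  weight through \<open>hardy_boundary\<close>; the next derivative is then read off the differentiated equation.\<close>

lemma power_dom_SucI:
  assumes n: "n \<ge> 1" and fh: "(f, h) \<in> legendre_op k" and h: "h \<in> power_dom n"
  shows "f \<in> power_dom (Suc n)"
proof -
  have fd: "f \<in> power_dom 1" using fh legendre_dom_eq by (auto simp: legendre_op_def)
  have f1: "f \<in> AC_loc_order 1" using fd by (simp add: power_dom_def)
  have ho: "h \<in> AC_loc_order (2 * n - 1)" using h by (simp add: power_dom_def)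
  obtain N where N: "negligible N" "\<And>t. t \<in> J - N \<Longrightarrow> h t = legendre_expr k f t"
    using fh unfolding legendre_op_def AE_J_iff by blast
  have reg: "f \<in> AC_loc_order (2 * n - 1 + 2)" "\<And>t. t \<in> J \<Longrightarrow>
      of_real (1 - t\<^sup>2) * vd (vd f) t = of_real (2 * t) * vd f t + of_real k * f t - h t"
    using legendre_regularity[OF f1 ho N] by blast+
  have ord: "2 * n - 1 + 2 = 2 * n + 1" "2 * n - 1 + 1 = 2 * n" using n by auto
  have fo: "f \<in> AC_loc_order (2 * n + 1)" using reg(1) unfolding ord .
  have eqs: "\<And>m t. m \<le> 2 * n - 1 \<Longrightarrow> t \<in> J \<Longrightarrow> differentiated_eq k f h m t"
    "\<exists>N. negligible N \<and> (\<forall>t\<in>J - N. differentiated_eq k f h (2 * n - 1 + 1) t)"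
    using differentiated_eq_all[OF reg(1) ho reg(2)] by blast+
  have ae: "\<exists>N. negligible N \<and> (\<forall>t\<in>J - N. differentiated_eq k f h m t)" if "m \<le> 2 * n" for m
  proof (cases "m = 2 * n")
    case True
    then show ?thesis using eqs(2) unfolding ord by simp
  next
    case False
    then have "m \<le> 2 * n - 1" using that by simp
    then show ?thesis using eqs(1)[of m] by (intro exI[of _ "{}"]) simp
  qed
  define G where "G m \<longleftrightarrow> (\<lambda>t. of_real ((1 - t\<^sup>2) ^ (m - (n + 1))) * nth_vderiv m f t) \<in> L2 \<and>
    (\<lambda>t. of_real ((1 - t\<^sup>2) ^ (m - (n + 1) + 1)) * nth_vderiv (m + 1) f t) \<in> L2" for m
  have "G m" if "1 \<le> m" "m \<le> 2 * n + 1" for m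
    using that
  proof (induction m rule: dec_induct)
    case base
    show ?case
      using power_dom_weighted[OF fd, of 1] power_dom_weighted[OF fd, of 2]
      by (simp add: G_def numeral_2_eq_2)
  next
    case (step m)
    then have G1: "(\<lambda>t. of_real ((1 - t\<^sup>2) ^ (m - (n + 1))) * nth_vderiv m f t) \<in> L2"
      and G2: "(\<lambda>t. of_real ((1 - t\<^sup>2) ^ (m - (n + 1) + 1)) * nth_vderiv (m + 1) f t) \<in> L2"
      by (simp_all add: G_def)
    let ?e = "m - n"
    have H: "(\<lambda>t. of_real ((1 - t\<^sup>2) ^ ?e) * nth_vderiv m h t) \<in> L2"
      using power_dom_weighted[OF h, of m] step by simp
    have F: "(\<lambda>t. of_real ((1 - t\<^sup>2) ^ ?e) * nth_vderiv m f t) \<in> L2"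
      by (rule L2_weight_mono[OF G1]) simp
    let ?c = "complex_of_real (real m * real (m + 1) + k)"
    have A: "(\<lambda>t. of_real ((1 - t\<^sup>2) ^ ?e) * nth_vderiv (m + 1) f t) \<in> L2"
    proof (cases "m \<le> n")
      case False
      then have "m - (n + 1) + 1 = ?e" by simp
      then show ?thesis using G2 by simp
    next
      case True
      then have e: "?e = 0" "m - (n + 1) = 0" by simp_all
      let ?u = "nth_vderiv (m + 1) f"
      let ?W = "\<lambda>t. complex_of_real ((1 - t\<^sup>2) ^ (m + 1)) * ?u t"
      let ?z = "\<lambda>t. complex_of_real ((1 - t\<^sup>2) ^ m) * ?u t"
      let ?g = "\<lambda>t. ?c * nth_vderiv m f t - nth_vderiv m h t"
      have g: "?g \<in> L2" using L2_diff[OF L2_cmult[of "nth_vderiv m f" ?c]] F H e by simp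
      \<comment> \<open>From \<open>p f\<^sup>(\<^sup>m\<^sup>+\<^sup>1\<^sup>) \<in> L\<^sup>2\<close>; this is where \<open>m \<ge> 1\<close> matters.\<close>
      have z: "?z \<in> L2" by (rule L2_weight_mono[OF G2]) (use e step in simp)
      have Wz: "?W t = of_real (1 - t\<^sup>2) * ?z t" for t by (simp add: mult.assoc)
      have pow: "((\<lambda>s. complex_of_real ((1 - s\<^sup>2) ^ (m + 1))) has_vector_derivative
          of_real (- (2 * real (m + 1) * t) * (1 - t\<^sup>2) ^ m)) (at t)" for t
      proof -
        have "((\<lambda>t. 1 - t\<^sup>2) has_real_derivative (- (2 * t))) (at t)"
          by (auto intro!: derivative_eq_intros)
        from DERIV_power_Suc[OF this, of m]
        have "((\<lambda>t. (1 - t\<^sup>2) ^ (m + 1)) has_real_derivative (- (2 * real (m + 1) * t) * (1 - t\<^sup>2) ^ m)) (at t)"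
          by (simp add: algebra_simps)
        then show ?thesis
          by (intro has_vector_derivative_of_real) (simp add: has_real_derivative_iff_has_vector_derivative)
      qed
      have "(\<lambda>t. ?W t / of_real ((1 - t\<^sup>2) ^ (m + 1))) \<in> L2"
      proof (rule hardy_boundary[OF _ g, of _ "{}"])
        have "(\<lambda>t. complex_of_real ((1 - t\<^sup>2) ^ (m + 1))) \<in> AC_loc"
          by (rule AC_loc_C1[OF pow]) (intro continuous_intros)
        then show "?W \<in> AC_loc"
          using AC_loc_orderD(1)[OF fo, of "m + 1"] step by (intro AC_loc_mult) auto
        fix t assume "t \<in> J - {}"
        then have t: "t \<in> J" by simp
        have "m + 1 < 2 * n + 1" using True n by simp
        then have du: "(?u has_vector_derivative nth_vderiv (m + 2) f t) (at t)"
          using AC_loc_orderD(2)[OF fo, of "m + 1" t] t by simp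
        have "vd ?W t = of_real ((1 - t\<^sup>2) ^ (m + 1)) * nth_vderiv (m + 2) f t +
            of_real (- (2 * real (m + 1) * t) * (1 - t\<^sup>2) ^ m) * ?u t"
          by (rule vector_derivative_at[OF has_vector_derivative_mult[OF pow du]])
        also have "\<dots> = of_real ((1 - t\<^sup>2) ^ m) *
            (of_real (1 - t\<^sup>2) * nth_vderiv (m + 2) f t - of_real (2 * real (m + 1) * t) * ?u t)"
          by (simp add: algebra_simps)
        also have "of_real (1 - t\<^sup>2) * nth_vderiv (m + 2) f t - of_real (2 * real (m + 1) * t) * ?u t = ?g t"
        proof -
          have "m \<le> 2 * n - 1" using True n by simp
          have "x = b + c - d \<Longrightarrow> x - b = c - d" for x b c d :: complex by simp
          with eqs(1)[OF \<open>m \<le> 2 * n - 1\<close> t] show ?thesis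
            unfolding differentiated_eq_def by blast
        qed
        finally show "vd ?W t = of_real ((1 - t\<^sup>2) ^ m) * ?g t" .
      qed (use L2_weighted_frequently_small[OF z] in \<open>simp_all only: Wz negligible_empty\<close>)
      then show ?thesis
      proof (rule L2_cong)
        show "of_real ((1 - t\<^sup>2) ^ ?e) * ?u t = ?W t / of_real ((1 - t\<^sup>2) ^ (m + 1))" if "t \<in> J" for t
          using nonzero_mult_div_cancel_left[OF weight_nonzero[OF that, of "m + 1"], of "?u t"] e
          by (simp only: power_0 of_real_1 mult_1_left)
      qed
    qed
    obtain N where N: "negligible N" "\<And>t. t \<in> J - N \<Longrightarrow> differentiated_eq k f h m t"
      using ae[of m] step by auto
    have B: "(\<lambda>t. of_real ((1 - t\<^sup>2) ^ (?e + 1)) * nth_vderiv (m + 2) f t) \<in> L2"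
    proof (rule L2_spike[OF _ N(1)])
      show "(\<lambda>t. of_real ((1 - t\<^sup>2) ^ ?e) * (of_real (2 * real (m + 1) * t) * nth_vderiv (m + 1) f t)
         + ?c * (of_real ((1 - t\<^sup>2) ^ ?e) * nth_vderiv m f t)
         - of_real ((1 - t\<^sup>2) ^ ?e) * nth_vderiv m h t) \<in> L2"
        by (intro L2_diff L2_add L2_cmult L2_ident_mult A F H)
      fix t assume "t \<in> J - N"
      from N(2)[OF this]
      have eq: "of_real (1 - t\<^sup>2) * nth_vderiv (m + 2) f t = of_real (2 * real (m + 1) * t) * nth_vderiv (m + 1) f t
         + ?c * nth_vderiv m f t - nth_vderiv m h t" unfolding differentiated_eq_def .
      have "of_real ((1 - t\<^sup>2) ^ (?e + 1)) * nth_vderiv (m + 2) f t =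
          of_real ((1 - t\<^sup>2) ^ ?e) * (of_real (1 - t\<^sup>2) * nth_vderiv (m + 2) f t)"
        by (simp add: algebra_simps)
      then show "of_real ((1 - t\<^sup>2) ^ (?e + 1)) * nth_vderiv (m + 2) f t =
          of_real ((1 - t\<^sup>2) ^ ?e) * (of_real (2 * real (m + 1) * t) * nth_vderiv (m + 1) f t)
         + ?c * (of_real ((1 - t\<^sup>2) ^ ?e) * nth_vderiv m f t)
         - of_real ((1 - t\<^sup>2) ^ ?e) * nth_vderiv m h t"
        unfolding eq by (simp only: ring_distribs mult_ac)
    qed
    have "Suc m - (n + 1) = ?e" by simp
    then show ?case using A B by (simp add: G_def)
  qed
  from this[of "2 * n + 1"] have "(\<lambda>t. of_real ((1 - t\<^sup>2) ^ (2 * n + 1 - (n + 1) + 1)) * nth_vderiv (2 * n + 1 + 1) f t) \<in> L2"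
    by (simp add: G_def)
  moreover have "2 * n + 1 - (n + 1) + 1 = Suc n" "2 * n + 1 + 1 = 2 * Suc n" "2 * Suc n - 1 = 2 * n + 1" by auto
  ultimately show ?thesis using fo unfolding power_dom_def by (simp only: mem_Collect_eq)
qed

text \<open>Here \<open>A f\<close> is given everywhere by the differential expression, since \<open>f\<close> is smooth enough, and the
  differentiated equation expresses its derivative of order \<open>2 n\<close> by functions with known weights.\<close>

lemma power_dom_SucD:
  assumes n: "n \<ge> 1" and f: "f \<in> power_dom (Suc n)"
  shows "(f, legendre_expr k f) \<in> legendre_op k" "legendre_expr k f \<in> power_dom n"
proof -
  define h where "h = legendre_expr k f"
  have ord: "2 * n - 1 + 2 = 2 * n + 1" "2 * n - 1 + 1 = 2 * n" "2 * Suc n - 1 = 2 * n + 1" using n by auto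
  have fo: "f \<in> AC_loc_order (2 * n + 1)" using f unfolding power_dom_def ord by simp
  have f1: "f \<in> AC_loc_order 1" by (rule AC_loc_order_mono[OF fo]) simp
  have "(\<lambda>t. of_real ((1 - t\<^sup>2) ^ 1) * nth_vderiv 2 f t) \<in> L2"
    by (rule L2_weight_mono[OF power_dom_weighted[OF f]]) (use n in auto)
  then have "f \<in> power_dom 1" using f1 by (simp add: power_dom_def)
  then show "(f, legendre_expr k f) \<in> legendre_op k"
    by (simp add: legendre_op_def legendre_dom_eq)
  have f3: "f \<in> AC_loc_order (Suc (Suc (2 * n - 1)))" using fo n by (simp add: Suc_diff_Suc numeral_2_eq_2)
  note f' = AC_loc_order_SucD[OF f3] and f'' = AC_loc_order_SucD[OF AC_loc_order_SucD(1)[OF f3]]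
  have h_eq: "h t = of_real k * f t + of_real 2 * of_real t * vd f t - of_real (1 - t\<^sup>2) * vd (vd f) t"
    if t: "t \<in> J" for t
    using vector_derivative_at[OF flux_derivative[OF f''(3)[OF t]]]
    by (simp add: h_def legendre_expr_def)
  have ho: "h \<in> AC_loc_order (2 * n - 1)"
  proof (rule AC_loc_order_cong)
    show "(\<lambda>t. of_real k * f t + of_real 2 * of_real t * vd f t - of_real (1 - t\<^sup>2) * vd (vd f) t)
        \<in> AC_loc_order (2 * n - 1)"
      by (intro AC_loc_order_diff AC_loc_order_add AC_loc_order_mult AC_loc_order_const
          AC_loc_order_ident AC_loc_order_weight f'' AC_loc_order_mono[OF fo]) simp
  qed (use h_eq in simp)
  have "\<exists>N. negligible N \<and> (\<forall>t\<in>J - N. differentiated_eq k f h (2 * n - 1 + 1) t)"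
  proof (rule differentiated_eq_all(2)[OF _ ho])
    show "f \<in> AC_loc_order (2 * n - 1 + 2)" unfolding ord by (rule fo)
    show "of_real (1 - t\<^sup>2) * vd (vd f) t = of_real (2 * t) * vd f t + of_real k * f t - h t" if "t \<in> J" for t
      unfolding h_eq[OF that] by simp
  qed
  then obtain N where N: "negligible N" "\<And>t. t \<in> J - N \<Longrightarrow> differentiated_eq k f h (2 * n) t"
    unfolding ord by blast
  let ?c = "complex_of_real (real (2 * n) * real (2 * n + 1) + k)"
  have F0: "(\<lambda>t. of_real ((1 - t\<^sup>2) ^ n) * nth_vderiv (2 * n) f t) \<in> L2"
    by (rule L2_weight_mono[OF power_dom_weighted[OF f]]) auto
  have F1: "(\<lambda>t. of_real ((1 - t\<^sup>2) ^ n) * nth_vderiv (2 * n + 1) f t) \<in> L2"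
    by (rule L2_weight_mono[OF power_dom_weighted[OF f]]) auto
  have F2: "(\<lambda>t. of_real ((1 - t\<^sup>2) ^ (n + 1)) * nth_vderiv (2 * n + 2) f t) \<in> L2"
    by (rule L2_weight_mono[OF power_dom_weighted[OF f]]) auto
  have "(\<lambda>t. of_real ((1 - t\<^sup>2) ^ n) * nth_vderiv (2 * n) h t) \<in> L2"
  proof (rule L2_spike[OF _ N(1)])
    show "(\<lambda>t. of_real ((1 - t\<^sup>2) ^ n) * (of_real (2 * real (2 * n + 1) * t) * nth_vderiv (2 * n + 1) f t)
         + ?c * (of_real ((1 - t\<^sup>2) ^ n) * nth_vderiv (2 * n) f t)
         - of_real ((1 - t\<^sup>2) ^ (n + 1)) * nth_vderiv (2 * n + 2) f t) \<in> L2"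
      by (intro L2_diff L2_add L2_cmult L2_ident_mult F0 F1 F2)
    fix t assume "t \<in> J - N"
    from N(2)[OF this]
    have eq: "nth_vderiv (2 * n) h t = of_real (2 * real (2 * n + 1) * t) * nth_vderiv (2 * n + 1) f t
         + ?c * nth_vderiv (2 * n) f t - of_real (1 - t\<^sup>2) * nth_vderiv (2 * n + 2) f t"
      unfolding differentiated_eq_def by simp
    have "of_real ((1 - t\<^sup>2) ^ (n + 1)) * nth_vderiv (2 * n + 2) f t =
          of_real ((1 - t\<^sup>2) ^ n) * (of_real (1 - t\<^sup>2) * nth_vderiv (2 * n + 2) f t)"
      by (simp add: algebra_simps)
    then show "of_real ((1 - t\<^sup>2) ^ n) * nth_vderiv (2 * n) h t =
        of_real ((1 - t\<^sup>2) ^ n) * (of_real (2 * real (2 * n + 1) * t) * nth_vderiv (2 * n + 1) f t)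
         + ?c * (of_real ((1 - t\<^sup>2) ^ n) * nth_vderiv (2 * n) f t)
         - of_real ((1 - t\<^sup>2) ^ (n + 1)) * nth_vderiv (2 * n + 2) f t"
      unfolding eq by (simp only: ring_distribs mult_ac)
  qed
  then show "legendre_expr k f \<in> power_dom n" using ho unfolding h_def power_dom_def by simp
qed

theorem mainTheorem3:
  fixes k :: real and n :: nat
  assumes "k \<ge> 0" and "n \<ge> 1"
  shows "Domain (legendre_op k ^^ n) =
    {f. f \<in> AC_loc_order (2 * n - 1) \<and>
        (\<lambda>x. of_real ((1 - x\<^sup>2) ^ n) * nth_vderiv (2 * n) f x) \<in> L2}"
proof -
  have "Domain (legendre_op k ^^ n) = power_dom n"
    using assms(2)
  proof (induction n rule: dec_induct)
    case base
    show ?case by (simp only: Domain_legendre_op_pow_1 legendre_dom_eq)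
  next
    case (step n)
    have "Domain (legendre_op k ^^ Suc n) = {f. \<exists>h. (f, h) \<in> legendre_op k \<and> h \<in> power_dom n}"
      unfolding step.IH[symmetric] by (auto simp: relpow_commute[symmetric])
    also have "\<dots> = power_dom (Suc n)"
      using power_dom_SucI[OF step.hyps(1)] power_dom_SucD[OF step.hyps(1)] by blast
    finally show ?case .
  qed
  then show ?thesis by (simp only: power_dom_def)
qed

end
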